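(* Let $R_{10}=\frac12\,\mathrm{circulant}(J,O,O,O,Y)$ with $2\times2$ blocks $J$, $O$, $Y=2I-J$. Consider on $\mathcal{B}_{R_{10}}$ the equivalence relation generated by: - complementation $B\mapsto J-I-B$ (with $J,I$ of order $10$); - replacing an off-diagonal $2\times 2$ block $B_{ij}$ ($i\ne j$), together with its transpose $B_{ji}$, by the complements $J-B_{ij}$ and $J-B_{ji}$; - conjugation $B\mapsto P^TBP$, where $P$ is a permutation matrix for which there exists a permutation matrix $P'$ with $P^TR_{10}P'=R_{10}$. Then $\mathcal{B}_{R_{10}}$ has exactly three matrices irreducible with respect to $R_{10}$ up to this equivalence. They are represented by $$\mathrm{circulant}(O,O,N,N^T,O),\qquad \mathrm{circulant}(O,I,N,N^T,I),\qquad \mathrm{circulant}(O,N,N^T,N,N^T),$$ where $N=\begin{bmatrix} 0&0 \\ 1&1 \end{bmatrix}$ and $I,O$ are of order $2$.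
   Context: $\mathrm{circulant}(X_1,\dots,X_m)$ with $2\times2$ blocks $X_k$ denotes the block matrix with block $X_k$ in block position $(i,i+k-1)$, block indices read modulo $m$. $I$ is the identity matrix, $J$ the all-ones matrix and $O$ the zero matrix. An adjacency matrix is a symmetric $01$-matrix with zero diagonal. An orthogonal matrix is regular if each of its rows sums to $1$. The level of a rational matrix is the smallest positive integer $\ell$ such that $\ell$ times the matrix is integral. A matrix is decomposable if it can be written as a non-trivial block-diagonal matrix after some permutation of its rows and columns (rows and columns may be permuted independently), and indecomposable otherwise. For a regular orthogonal matrix $R$, $\mathcal{V}_R$ is the set of $01$-vectors $v$ such that $R^Tv$ is again a $01$-vector, and $\mathcal{B}_R$ is the set of adjacency matrices $B$ such that $R^TBR$ is again an adjacency matrix. Reducibility: let $R$ be an indecomposable regular orthogonal matrix of level $2$ and let $B\in\mathcal{B}_R$. Then $B$ is reducible with respect to $R$ if there are decomposable regular orthogonal matrices $R_1,\dots,R_s$ of the same order as $R$, each of level at most $2$ (in particular $R_i$ may have the form $\mathrm{diag}(R_i',I)$ with $R_i'$ a smaller regular orthogonal matrix, and may have several non-trivial blocks), such that $R=R_1\cdots R_s$ and such that for every $i<s$ and every adjacency matrix $A=\begin{bmatrix} B&V \\ V^T&W \end{bmatrix}$ all of whose columns of $V$ lie in $\mathcal{V}_R$, the matrix $(Q_1\cdots Q_i)^TA(Q_1\cdots Q_i)$ is an adjacency matrix, where $Q_k=\begin{bmatrix} R_k&O \\ O&I \end{bmatrix}$. Otherwise $B$ is irreducible with respect to $R$. *)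

theory Defs
  imports "Jordan_Normal_Form.Matrix"
begin

text \<open>All matrices are over the rationals: only there is the level always defined, and every
  matrix below (entries in \<open>{0, 1}\<close>, or orthogonal of level at most 2) is rational.
  Row, column and block indices start at 0.\<close>

definition all_ones_mat :: "nat \<Rightarrow> rat mat" where
  "all_ones_mat n = mat n n (\<lambda>_. 1)"

definition zero_one_vec :: "rat vec \<Rightarrow> bool" where
  "zero_one_vec v \<longleftrightarrow> (\<forall>i<dim_vec v. v $ i \<in> {0, 1})"

definition adjacency_mat :: "nat \<Rightarrow> rat mat \<Rightarrow> bool" where
  "adjacency_mat n A \<longleftrightarrow> A \<in> carrier_mat n n \<and> transpose_mat A = A \<and>
     elements_mat A \<subseteq> {0, 1} \<and> (\<forall>i<n. A $$ (i, i) = 0)"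

definition permutation_mat :: "nat \<Rightarrow> rat mat \<Rightarrow> bool" where
  "permutation_mat n P \<longleftrightarrow>
     (\<exists>p. p permutes {..<n} \<and> P = mat n n (\<lambda>(i, j). if j = p i then 1 else 0))"

text \<open>The library's \<open>orthogonal_mat\<close> only asks for pairwise orthogonal non-zero columns,
  hence the explicit condition here.\<close>

definition regular_orthogonal :: "nat \<Rightarrow> rat mat \<Rightarrow> bool" where
  "regular_orthogonal n R \<longleftrightarrow> R \<in> carrier_mat n n \<and>
     transpose_mat R * R = 1\<^sub>m n \<and> R * transpose_mat R = 1\<^sub>m n \<and>
     (\<forall>i<n. (\<Sum>j<n. R $$ (i, j)) = 1)"

definition level :: "rat mat \<Rightarrow> nat" where
  "level M = (LEAST l. 0 < l \<and> elements_mat (of_nat l \<cdot>\<^sub>m M) \<subseteq> \<int>)"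

text \<open>Decomposability is used for invertible matrices only; the diagonal blocks of an
  invertible block-diagonal matrix are square.\<close>

definition decomposable :: "nat \<Rightarrow> rat mat \<Rightarrow> bool" where
  "decomposable n M \<longleftrightarrow> (\<exists>P Q k M1 M2.
     permutation_mat n P \<and> permutation_mat n Q \<and> 0 < k \<and> k < n \<and>
     M1 \<in> carrier_mat k k \<and> M2 \<in> carrier_mat (n - k) (n - k) \<and>
     P * M * Q = four_block_mat M1 (0\<^sub>m k (n - k)) (0\<^sub>m (n - k) k) M2)"

definition VV :: "rat mat \<Rightarrow> rat vec set" where
  "VV R = {v \<in> carrier_vec (dim_row R). zero_one_vec v \<and> zero_one_vec (transpose_mat R *\<^sub>v v)}"

definition BB :: "rat mat \<Rightarrow> rat mat set" where
  "BB R = {B. adjacency_mat (dim_row R) B \<and> adjacency_mat (dim_row R) (transpose_mat R * B * R)}"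

definition mat_list_prod :: "nat \<Rightarrow> rat mat list \<Rightarrow> rat mat" where
  "mat_list_prod n Ms = foldr (*) Ms (1\<^sub>m n)"

definition extend_by_id :: "nat \<Rightarrow> nat \<Rightarrow> rat mat \<Rightarrow> rat mat" where
  "extend_by_id n m M = four_block_mat M (0\<^sub>m n m) (0\<^sub>m m n) (1\<^sub>m m)"

text \<open>Intended for an indecomposable regular orthogonal matrix \<open>R\<close> of level 2 and
  \<open>B \<in> BB R\<close>. The order \<open>m\<close> of \<open>W\<close> is arbitrary.\<close>

definition reducible_wrt :: "rat mat \<Rightarrow> rat mat \<Rightarrow> bool" where
  "reducible_wrt R B \<longleftrightarrow> (let n = dim_row R in \<exists>Rs.
     (\<forall>M\<in>set Rs. regular_orthogonal n M \<and> decomposable n M \<and> level M \<le> 2) \<and>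
     R = mat_list_prod n Rs \<and>
     (\<forall>i\<in>{1..<length Rs}. \<forall>m V W.
        let A = four_block_mat B V (transpose_mat V) W;
            Q = mat_list_prod (n + m) (map (extend_by_id n m) (take i Rs))
        in V \<in> carrier_mat n m \<and> W \<in> carrier_mat m m \<and> adjacency_mat (n + m) A \<and>
           (\<forall>j<m. col V j \<in> VV R) \<longrightarrow>
           adjacency_mat (n + m) (transpose_mat Q * A * Q)))"

definition irreducibles :: "rat mat \<Rightarrow> rat mat set" where
  "irreducibles R = {B \<in> BB R. \<not> reducible_wrt R B}"

text \<open>\<open>circulant [X\<^sub>1, \<dots>, X\<^sub>m]\<close> for \<open>2 \<times> 2\<close> blocks: the block in block position \<open>(i, j)\<close> is the
  list element with index \<open>(j - i) mod m\<close>; adding \<open>m\<close> avoids truncated subtraction.\<close>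

definition circulant :: "rat mat list \<Rightarrow> rat mat" where
  "circulant Xs = (let m = length Xs in mat (2 * m) (2 * m) (\<lambda>(a, b).
     (Xs ! ((b div 2 + m - a div 2) mod m)) $$ (a mod 2, b mod 2)))"

abbreviation I2 :: "rat mat" where "I2 \<equiv> 1\<^sub>m 2"
abbreviation O2 :: "rat mat" where "O2 \<equiv> 0\<^sub>m 2 2"
abbreviation J2 :: "rat mat" where "J2 \<equiv> all_ones_mat 2"

definition Y2 :: "rat mat" where "Y2 = 2 \<cdot>\<^sub>m I2 - J2"

definition N2 :: "rat mat" where "N2 = mat_of_rows_list 2 [[0, 0], [1, 1]]"

abbreviation N2T :: "rat mat" where "N2T \<equiv> transpose_mat N2"

definition R10 :: "rat mat" where
  "R10 = (1 / 2) \<cdot>\<^sub>m circulant [J2, O2, O2, O2, Y2]"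

definition complement_block :: "nat \<Rightarrow> nat \<Rightarrow> rat mat \<Rightarrow> rat mat" where
  "complement_block i j B = mat (dim_row B) (dim_col B) (\<lambda>(a, b).
     if (a div 2, b div 2) \<in> {(i, j), (j, i)} then 1 - B $$ (a, b) else B $$ (a, b))"

text \<open>The generating moves are moves on \<open>BB R10\<close>: both ends are required to lie in it.\<close>

inductive move :: "rat mat \<Rightarrow> rat mat \<Rightarrow> bool" where
  complement: "\<lbrakk>B \<in> BB R10; B' \<in> BB R10; B' = all_ones_mat 10 - 1\<^sub>m 10 - B\<rbrakk> \<Longrightarrow> move B B'"
| block: "\<lbrakk>B \<in> BB R10; B' \<in> BB R10; i < 5; j < 5; i \<noteq> j; B' = complement_block i j B\<rbrakk>
    \<Longrightarrow> move B B'"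
| conjugate: "\<lbrakk>B \<in> BB R10; B' \<in> BB R10; permutation_mat 10 P; permutation_mat 10 P';
    transpose_mat P * R10 * P' = R10; B' = transpose_mat P * B * P\<rbrakk> \<Longrightarrow> move B B'"

definition equiv_R10 :: "(rat mat \<times> rat mat) set" where
  "equiv_R10 = {(B, B'). B \<in> BB R10 \<and> B' \<in> BB R10 \<and> equivclp move B B'}"

end

theory Submission
  imports Defs "Jordan_Normal_Form.Determinant"
begin

text \<open>In every block use the basis \<open>e = (1, 1)\<close>, \<open>f = (1, -1)\<close>. Then \<open>R10\<close> fixes the \<open>e\<close>-vectors of the five
  blocks and permutes their \<open>f\<close>-vectors by the 5-cycle \<open>cyc\<close>; write \<open>switch p\<close> for the analogous matrix with a
  permutation \<open>p\<close>. Two facts reduce everything to these matrices. First, for \<open>B \<in> BB R10\<close> all off-diagonal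
  blocks have even sum, so up to complements there are four possibilities for each of the ten blocks, and
  whether \<open>transpose_mat (switch p) * B * switch p\<close> is an adjacency matrix depends only on these
  possibilities. Second, a regular orthogonal matrix that maps \<open>VV R10\<close> to 0/1-vectors is some \<open>switch p\<close> up
  to a permutation of its columns, hence so is every partial product of a factorization that witnesses
  reducibility.

  A finite search shows that apart from three block patterns there is always an admissible \<open>p\<close>
  such that neither \<open>p\<close> nor \<open>inv p \<circ> cyc\<close> is a 5-cycle, which gives a factorization of length two.
  For the three remaining patterns the only admissible \<open>p\<close> are the identity and \<open>cyc\<close>. A decomposable factor cannot
  lead from the identity to \<open>cyc\<close>, so these patterns are irreducible. Matrices with the same pattern
  differ by complementations only. The three patterns are separated by the behaviour of the rows on
  cyclically adjacent blocks, because the symmetries of \<open>R10\<close> preserve the cyclic adjacency of blocks.\<close>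

section \<open>Decomposability and bordered matrices\<close>

text \<open>A factorization may be arbitrarily long, its factors are arbitrary decomposable
  matrices, and the condition on the partial products quantifies over all borders. What makes this
  finite is that \<open>VV R10\<close> is large: it contains the indicator of every block and every
  choice of one index from each block. A partial product must send all of them to 0/1-vectors, which
  leaves each of its columns only half of one sum vector plus or minus one difference vector;
  orthogonality then organizes the columns into some \<open>switch p\<close>, so only 120
  permutations remain. Decomposability enters as an obstruction to connectedness: the supports of
  the columns of \<open>R10\<close> link the five blocks into a single cycle, and this survives
  relabelling of columns and multiplication by a permutation matrix. Evenness of the blocks is
  inherited from the zero diagonal of the congruent matrix: it holds first for cyclic neighbours,
  then for blocks at distance two, and with five blocks there are no other pairs.\<close>

text \<open>\<open>X\<close> and \<open>Y\<close> are the rows and columns of the first diagonal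
  block before any reordering, so no permutation matrices are involved. Equal cardinalities express
  that the diagonal blocks are square.\<close>

definition split_by :: "nat \<Rightarrow> rat mat \<Rightarrow> nat set \<Rightarrow> nat set \<Rightarrow> bool" where
  "split_by n M X Y \<longleftrightarrow> X \<subseteq> {..<n} \<and> Y \<subseteq> {..<n} \<and> X \<noteq> {} \<and> X \<noteq> {..<n} \<and> card X = card Y \<and>
     (\<forall>a<n. \<forall>b<n. M $$ (a, b) \<noteq> 0 \<longrightarrow> (a \<in> X \<longleftrightarrow> b \<in> Y))"

lemma mult_mat_entry:
  assumes "A \<in> carrier_mat n m" "B \<in> carrier_mat m k" "i < n" "j < k"
  shows "(A * B) $$ (i, j) = (\<Sum>l = 0..<m. A $$ (i, l) * B $$ (l, j))"
  using assms by (auto simp: scalar_prod_def intro!: sum.cong)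

lemma perm_mat_mult_left:
  assumes p: "p permutes {..<n}" and M: "M \<in> carrier_mat n m" and a: "a < n" and b: "b < m"
  shows "(mat n n (\<lambda>(i, j). if j = p i then 1 else 0) * M) $$ (a, b) = (M $$ (p a, b) :: rat)"
proof -
  have pa: "p a < n" using permutes_in_image[OF p] a by simp
  have "(mat n n (\<lambda>(i, j). if j = p i then 1 else 0) * M) $$ (a, b)
      = (\<Sum>k = 0..<n. (if k = p a then 1 else 0) * M $$ (k, b))"
    using M a b by (simp add: scalar_prod_def)
  also have "\<dots> = (\<Sum>k = 0..<n. if k = p a then M $$ (k, b) else 0)"
    by (rule sum.cong) auto
  also have "\<dots> = M $$ (p a, b)" using pa by simp
  finally show ?thesis .
qed

lemma perm_mat_mult_right:
  assumes p: "p permutes {..<m}" and M: "M \<in> carrier_mat n m" and a: "a < n" and b: "b < m"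
  shows "(M * mat m m (\<lambda>(i, j). if j = p i then 1 else 0)) $$ (a, p b) = (M $$ (a, b) :: rat)"
proof -
  have pb: "p b < m" using permutes_in_image[OF p] b by simp
  have inj: "p b = p k \<longleftrightarrow> k = b" for k using permutes_inj[OF p] by (auto dest: injD)
  have "(M * mat m m (\<lambda>(i, j). if j = p i then 1 else 0)) $$ (a, p b)
      = (\<Sum>k = 0..<m. M $$ (a, k) * (if p b = p k then 1 else 0))"
    by (subst mult_mat_entry[OF M mat_carrier a pb]) (rule sum.cong, use pb in auto)
  also have "\<dots> = (\<Sum>k = 0..<m. if k = b then M $$ (a, k) else 0)"
    by (rule sum.cong) (simp_all add: inj)
  also have "\<dots> = M $$ (a, b)" using b by simp
  finally show ?thesis .
qed

lemma permutes_onto_initial_segment: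
  assumes "X \<subseteq> {..<n}"
  obtains p where "p permutes {..<n}" "\<And>i. i < n \<Longrightarrow> p i \<in> X \<longleftrightarrow> i < card X"
proof -
  have fin: "finite X" using assms finite_subset by auto
  have le: "card X \<le> n" using card_mono[OF _ assms] by simp
  obtain f where f: "bij_betw f {..<card X} X"
    using finite_same_card_bij[of "{..<card X}" X] fin by auto
  have "card {card X..<n} = card ({..<n} - X)"
    using card_Diff_subset[OF fin assms] by simp
  then obtain g where g: "bij_betw g {card X..<n} ({..<n} - X)"
    using finite_same_card_bij[of "{card X..<n}" "{..<n} - X"] by auto
  define h where "h i = (if i < card X then f i else g i)" for i
  have h1: "bij_betw h {..<card X} X"
    using f by (subst bij_betw_cong[of _ _ f]) (auto simp: h_def)
  have h2: "bij_betw h {card X..<n} ({..<n} - X)"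
    using g by (subst bij_betw_cong[of _ _ g]) (auto simp: h_def)
  have "bij_betw h ({..<card X} \<union> {card X..<n}) (X \<union> ({..<n} - X))"
    by (rule bij_betw_combine[OF h1 h2]) auto
  moreover have "{..<card X} \<union> {card X..<n} = {..<n}" "X \<union> ({..<n} - X) = {..<n}"
    using le assms by auto
  ultimately have hb: "bij_betw h {..<n} {..<n}" by simp
  define p where "p i = (if i < n then h i else i)" for i
  have "p permutes {..<n}"
  proof (rule bij_imp_permutes)
    show "bij_betw p {..<n} {..<n}"
      using hb by (subst bij_betw_cong[of _ _ h]) (auto simp: p_def)
  qed (auto simp: p_def)
  moreover have "p i \<in> X \<longleftrightarrow> i < card X" if "i < n" for i
  proof (cases "i < card X")
    case True
    then show ?thesis using h1 that by (auto simp: p_def bij_betw_def)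
  next
    case False
    then have "h i \<in> {..<n} - X" using h2 that by (auto simp: bij_betw_def)
    then show ?thesis using False that by (auto simp: p_def)
  qed
  ultimately show ?thesis using that by blast
qed

lemma split_by_imp_decomposable:
  assumes M: "M \<in> carrier_mat n n" and s: "split_by n M X Y"
  shows "decomposable n M"
proof -
  have X: "X \<subseteq> {..<n}" "X \<noteq> {}" "X \<noteq> {..<n}" and Y: "Y \<subseteq> {..<n}" and c: "card X = card Y"
    and z: "\<And>a b. a < n \<Longrightarrow> b < n \<Longrightarrow> M $$ (a, b) \<noteq> 0 \<Longrightarrow> a \<in> X \<longleftrightarrow> b \<in> Y"
    using s by (auto simp: split_by_def)
  obtain p where p: "p permutes {..<n}" "\<And>i. i < n \<Longrightarrow> p i \<in> X \<longleftrightarrow> i < card X"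
    using permutes_onto_initial_segment[OF X(1)] by blast
  obtain q where q: "q permutes {..<n}" "\<And>i. i < n \<Longrightarrow> q i \<in> Y \<longleftrightarrow> i < card X"
    using permutes_onto_initial_segment[OF Y] c by metis
  \<comment> \<open>Right multiplication by the matrix of a permutation moves column
    \<open>b\<close> to its image under it. Hence the inverse of \<open>q\<close> is needed to bring
    column \<open>q b\<close> to position \<open>b\<close>.\<close>
  define q' where "q' = inv_into UNIV q"
  have q': "q' permutes {..<n}" unfolding q'_def by (rule permutes_inv[OF q(1)])
  have qq: "q' (q b) = b" for b unfolding q'_def by (rule permutes_inverses[OF q(1)])
  define P Q where "P = mat n n (\<lambda>(i, j). if j = p i then 1 else 0 :: rat)"
    and "Q = mat n n (\<lambda>(i, j). if j = q' i then 1 else 0 :: rat)"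
  have k: "0 < card X" "card X < n"
    using X psubset_card_mono[of "{..<n}" X] finite_subset[OF X(1)] by (auto simp: card_gt_0_iff)
  have ent: "(P * M * Q) $$ (a, b) = M $$ (p a, q b)" if "a < n" "b < n" for a b
  proof -
    have qb: "q b < n" using permutes_in_image[OF q(1)] that by simp
    have "(P * M * Q) $$ (a, q' (q b)) = (P * M) $$ (a, q b)"
      unfolding Q_def by (rule perm_mat_mult_right[OF q' _ that(1) qb]) (use M in \<open>auto simp: P_def\<close>)
    then show ?thesis using perm_mat_mult_left[OF p(1) M that(1) qb] by (simp add: qq P_def)
  qed
  obtain k where kX: "k = card X" by simp
  note k = k[folded kX]
  obtain N where N: "N = P * M * Q" by simp
  define M1 M2 where "M1 = mat k k (\<lambda>(a, b). N $$ (a, b))"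
    and "M2 = mat (n - k) (n - k) (\<lambda>(a, b). N $$ (a + k, b + k))"
  let ?F = "four_block_mat M1 (0\<^sub>m k (n - k)) (0\<^sub>m (n - k) k) M2"
  have "N = ?F"
  proof (rule eq_matI)
    fix a b assume "a < dim_row ?F" "b < dim_col ?F"
    then have ab: "a < n" "b < n" using k by (simp_all add: M1_def M2_def)
    have pa: "p a < n" using permutes_in_image[OF p(1)] ab by simp
    have qb: "q b < n" using permutes_in_image[OF q(1)] ab by simp
    have z0: "N $$ (a, b) = 0" if "(a < k) \<noteq> (b < k)"
      using z[OF pa qb] p(2)[OF ab(1)] q(2)[OF ab(2)] that ent[OF ab, folded N] unfolding kX by argo
    have "?F $$ (a, b) = (if a < k then if b < k then M1 $$ (a, b) else 0
        else if b < k then 0 else M2 $$ (a - k, b - k))"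
      using ab k by (simp add: M1_def M2_def)
    then show "N $$ (a, b) = ?F $$ (a, b)"
      using ab z0 by (cases "a < k"; cases "b < k") (simp_all add: M1_def M2_def)
  qed (use k in \<open>simp_all add: M1_def M2_def N P_def Q_def\<close>)
  moreover have "permutation_mat n P" "permutation_mat n Q"
    unfolding permutation_mat_def P_def Q_def using p(1) q' by blast+
  moreover have "M1 \<in> carrier_mat k k" "M2 \<in> carrier_mat (n - k) (n - k)"
    unfolding M1_def M2_def by simp_all
  ultimately show ?thesis unfolding decomposable_def N using k by blast
qed

lemma decomposable_imp_split_by:
  assumes M: "M \<in> carrier_mat n n" and d: "decomposable n M"
  obtains X Y where "split_by n M X Y"
proof -
  obtain P Q k M1 M2 where PQ: "permutation_mat n P" "permutation_mat n Q" and k: "0 < k" "k < n"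
    and M12: "M1 \<in> carrier_mat k k" "M2 \<in> carrier_mat (n - k) (n - k)"
    and eq: "P * M * Q = four_block_mat M1 (0\<^sub>m k (n - k)) (0\<^sub>m (n - k) k) M2"
    using d unfolding decomposable_def by blast
  obtain p where p: "p permutes {..<n}" and P: "P = mat n n (\<lambda>(i, j). if j = p i then 1 else 0)"
    using PQ(1) by (auto simp: permutation_mat_def)
  obtain q where q: "q permutes {..<n}" and Q: "Q = mat n n (\<lambda>(i, j). if j = q i then 1 else 0)"
    using PQ(2) by (auto simp: permutation_mat_def)
  have ent: "(P * M * Q) $$ (a, q b) = M $$ (p a, b)" if "a < n" "b < n" for a b
  proof -
    have "(P * M * Q) $$ (a, q b) = (P * M) $$ (a, b)"
      unfolding Q by (rule perm_mat_mult_right[OF q _ that]) (use M in \<open>auto simp: P\<close>)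
    then show ?thesis using perm_mat_mult_left[OF p M that] by (simp add: P)
  qed
  define q' where "q' = inv_into UNIV q"
  have q': "q' permutes {..<n}" unfolding q'_def by (rule permutes_inv[OF q])
  have qq: "q' (q b) = b" "q (q' b) = b" for b unfolding q'_def by (rule permutes_inverses[OF q])+
  define X Y where "X = p ` {..<k}" and "Y = q' ` {..<k}"
  have pX: "p a \<in> X \<longleftrightarrow> a < k" for a
    using permutes_inj[OF p] by (auto simp: X_def dest: injD)
  have qY: "b \<in> Y \<longleftrightarrow> q b < k" for b
    unfolding Y_def using qq by (auto intro: image_eqI[of _ _ "q b"])
  have "(M $$ (a, b) \<noteq> 0) \<longrightarrow> (a \<in> X \<longleftrightarrow> b \<in> Y)" if ab: "a < n" "b < n" for a b
  proof -
    obtain a' where a': "a = p a'" "a' < n"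
      using permutes_image[OF p] ab(1) by (metis imageE lessThan_iff)
    have qb: "q b < n" using permutes_in_image[OF q] ab by simp
    have "M $$ (a, b) = (P * M * Q) $$ (a', q b)" using ent a' ab by simp
    then show ?thesis using eq k M12 a' qb by (auto simp: pX qY)
  qed
  moreover have "X \<subseteq> {..<n}" "Y \<subseteq> {..<n}"
    using image_mono[of "{..<k}" "{..<n}" p] image_mono[of "{..<k}" "{..<n}" q'] k
      permutes_image[OF p] permutes_image[OF q'] unfolding X_def Y_def by simp_all
  moreover have "card X = k" "card Y = k"
    unfolding X_def Y_def using card_image[OF inj_on_subset[OF permutes_inj[OF p]]]
      card_image[OF inj_on_subset[OF permutes_inj[OF q']]] by simp_all
  moreover from this have "X \<noteq> {}" "X \<noteq> {..<n}" using k by auto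
  ultimately show ?thesis using that[of X Y] unfolding split_by_def by auto
qed

section \<open>Adjacency matrices with a border\<close>

lemma adjacency_mat_iff:
  "adjacency_mat n A \<longleftrightarrow> A \<in> carrier_mat n n \<and>
     (\<forall>i<n. \<forall>j<n. A $$ (i, j) \<in> {0, 1} \<and> A $$ (j, i) = A $$ (i, j)) \<and> (\<forall>i<n. A $$ (i, i) = 0)"
proof (cases "A \<in> carrier_mat n n")
  case True
  then have "transpose_mat A = A \<longleftrightarrow> (\<forall>i<n. \<forall>j<n. A $$ (j, i) = A $$ (i, j))"
    by (auto simp: mat_eq_iff)
  moreover have "elements_mat A \<subseteq> {0, 1} \<longleftrightarrow> (\<forall>i<n. \<forall>j<n. A $$ (i, j) \<in> {0, 1})"
  proof
    show "\<forall>i<n. \<forall>j<n. A $$ (i, j) \<in> {0, 1}" if "elements_mat A \<subseteq> {0, 1}"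
      using elements_matI[OF True] that by blast
    show "elements_mat A \<subseteq> {0, 1}" if h: "\<forall>i<n. \<forall>j<n. A $$ (i, j) \<in> {0, 1}"
    proof
      fix x assume "x \<in> elements_mat A"
      then obtain i j where "i < n" "j < n" "x = A $$ (i, j)" using elements_matD[of x A] carrier_matD[OF True] by auto
      then show "x \<in> {0, 1}" using h by blast
    qed
  qed
  ultimately show ?thesis using True unfolding adjacency_mat_def by blast
qed (simp add: adjacency_mat_def)

lemma adjacency_four_block:
  assumes c: "B \<in> carrier_mat n n" "V \<in> carrier_mat n m" "V' \<in> carrier_mat m n" "W \<in> carrier_mat m m"
  shows "adjacency_mat (n + m) (four_block_mat B V V' W) \<longleftrightarrow>
    adjacency_mat n B \<and> adjacency_mat m W \<and>
    (\<forall>i<n. \<forall>j<m. V $$ (i, j) \<in> {0, 1} \<and> V' $$ (j, i) = V $$ (i, j))" (is "?L \<longleftrightarrow> ?R")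
proof
  let ?A = "four_block_mat B V V' W"
  have e: "?A $$ (i, j) = (if i < n then if j < n then B $$ (i, j) else V $$ (i, j - n)
      else if j < n then V' $$ (i - n, j) else W $$ (i - n, j - n))" if "i < n + m" "j < n + m" for i j
    using c that by simp
  show ?R if L: ?L
  proof -
    have L: "?A $$ (i, j) \<in> {0, 1}" "?A $$ (j, i) = ?A $$ (i, j)" "?A $$ (i, i) = 0"
      if "i < n + m" "j < n + m" for i j using L that by (auto simp: adjacency_mat_iff)
    have "B $$ (i, j) \<in> {0, 1} \<and> B $$ (j, i) = B $$ (i, j) \<and> B $$ (i, i) = 0"
      if "i < n" "j < n" for i j
      using L[of i j] e[of i j] e[of j i] e[of i i] that by simp
    then have "adjacency_mat n B" unfolding adjacency_mat_iff using c(1) by blast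
    moreover have "W $$ (i, j) \<in> {0, 1} \<and> W $$ (j, i) = W $$ (i, j) \<and> W $$ (i, i) = 0"
      if "i < m" "j < m" for i j
      using L[of "n + i" "n + j"] e[of "n + i" "n + j"] e[of "n + j" "n + i"] e[of "n + i" "n + i"] that by simp
    then have "adjacency_mat m W" unfolding adjacency_mat_iff using c(4) by blast
    moreover have "V $$ (i, j) \<in> {0, 1} \<and> V' $$ (j, i) = V $$ (i, j)" if "i < n" "j < m" for i j
      using L[of i "n + j"] e[of i "n + j"] e[of "n + j" i] that by simp
    ultimately show ?thesis by blast
  qed
  show ?L if R: ?R
  proof -
    have R: "\<And>i j. i < n \<Longrightarrow> j < n \<Longrightarrow> B $$ (i, j) \<in> {0, 1} \<and> B $$ (j, i) = B $$ (i, j)"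
      "\<And>i. i < n \<Longrightarrow> B $$ (i, i) = 0"
      "\<And>i j. i < m \<Longrightarrow> j < m \<Longrightarrow> W $$ (i, j) \<in> {0, 1} \<and> W $$ (j, i) = W $$ (i, j)"
      "\<And>i. i < m \<Longrightarrow> W $$ (i, i) = 0"
      "\<And>i j. i < n \<Longrightarrow> j < m \<Longrightarrow> V $$ (i, j) \<in> {0, 1} \<and> V' $$ (j, i) = V $$ (i, j)"
      using R by (simp_all add: adjacency_mat_iff)
    have "?A $$ (i, j) \<in> {0, 1} \<and> ?A $$ (j, i) = ?A $$ (i, j)" if "i < n + m" "j < n + m" for i j
    proof -
      have "i - n < m" if "\<not> i < n" using that \<open>i < n + m\<close> by simp
      moreover have "j - n < m" if "\<not> j < n" using that \<open>j < n + m\<close> by simp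
      ultimately show ?thesis
        using R(1)[of i j] R(3)[of "i - n" "j - n"] R(5)[of i "j - n"] R(5)[of j "i - n"]
        unfolding e[OF that] e[OF that(2,1)] by (cases "i < n"; cases "j < n") simp_all
    qed
    moreover have "?A $$ (i, i) = 0" if "i < n + m" for i
      using R(2)[of i] R(4)[of "i - n"] that unfolding e[OF that that] by (cases "i < n") simp_all
    ultimately show ?thesis unfolding adjacency_mat_iff using c by simp
  qed
qed

lemma extend_by_id_congruence:
  assumes "S \<in> carrier_mat n n" "B \<in> carrier_mat n n" "V \<in> carrier_mat n m" "W \<in> carrier_mat m m"
  shows "transpose_mat (extend_by_id n m S) * four_block_mat B V (transpose_mat V) W * extend_by_id n m S
    = four_block_mat (transpose_mat S * B * S) (transpose_mat S * V) (transpose_mat V * S) W"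
proof -
  have t: "transpose_mat (extend_by_id n m S) = four_block_mat (transpose_mat S) (0\<^sub>m n m) (0\<^sub>m m n) (1\<^sub>m m)"
    unfolding extend_by_id_def using assms
    by (subst transpose_four_block_mat[of _ n n _ m _ m]) auto
  have "transpose_mat (extend_by_id n m S) * four_block_mat B V (transpose_mat V) W
      = four_block_mat (transpose_mat S * B) (transpose_mat S * V) (transpose_mat V) W"
    unfolding t using assms by (subst mult_four_block_mat[of _ n n _ m _ m _ _ n _ m]) auto
  then show ?thesis unfolding extend_by_id_def using assms
    by (simp, subst mult_four_block_mat[of _ n n _ m _ m _ _ n _ m]) auto
qed

lemma mat_list_prod_Nil [simp]: "mat_list_prod n [] = 1\<^sub>m n"
  and mat_list_prod_Cons [simp]: "mat_list_prod n (M # Ms) = M * mat_list_prod n Ms"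
  by (simp_all add: mat_list_prod_def)

lemma mat_list_prod_carrier:
  "set Ms \<subseteq> carrier_mat n n \<Longrightarrow> mat_list_prod n Ms \<in> carrier_mat n n"
  by (induction Ms) auto

lemma mat_list_prod_snoc:
  "set Ms \<subseteq> carrier_mat n n \<Longrightarrow> M \<in> carrier_mat n n \<Longrightarrow>
    mat_list_prod n (Ms @ [M]) = mat_list_prod n Ms * M"
  by (induction Ms) (simp_all add: assoc_mult_mat[of _ n n _ n _ n] mat_list_prod_carrier)

lemma mat_list_prod_extend_by_id:
  "set Ms \<subseteq> carrier_mat n n \<Longrightarrow>
    mat_list_prod (n + m) (map (extend_by_id n m) Ms) = extend_by_id n m (mat_list_prod n Ms)"
proof (induction Ms)
  case Nil
  show ?case by (rule eq_matI) (auto simp: extend_by_id_def)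
next
  case (Cons M Ms)
  then have "M \<in> carrier_mat n n" "mat_list_prod n Ms \<in> carrier_mat n n"
    by (simp_all add: mat_list_prod_carrier)
  then show ?case using Cons
    by (simp add: extend_by_id_def, subst mult_four_block_mat[of _ n n _ m _ m _ _ n _ m]) auto
qed

text \<open>Congruence by \<open>extend_by_id n m S\<close> keeps \<open>W\<close> and applies the
  transpose of \<open>S\<close> to each column of \<open>V\<close> separately. The demand on a
  partial product \<open>S\<close> therefore splits into one condition on \<open>B\<close> and one
  on single vectors.\<close>

definition preserves :: "rat mat \<Rightarrow> rat mat \<Rightarrow> rat mat \<Rightarrow> bool" where
  "preserves R B S \<longleftrightarrow> adjacency_mat (dim_row R) (transpose_mat S * B * S) \<and>
     (\<forall>v\<in>VV R. zero_one_vec (transpose_mat S *\<^sub>v v))"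

text \<open>Testing the bordered matrices with a single extra vertex already gives the full condition.\<close>

lemma bordered_iff_preserves:
  assumes S: "S \<in> carrier_mat n n" and R: "R \<in> carrier_mat n n" and B: "adjacency_mat n B"
  shows "(\<forall>m V W. V \<in> carrier_mat n m \<and> W \<in> carrier_mat m m \<and>
        adjacency_mat (n + m) (four_block_mat B V (transpose_mat V) W) \<and> (\<forall>j<m. col V j \<in> VV R) \<longrightarrow>
        adjacency_mat (n + m) (transpose_mat (extend_by_id n m S) *
          four_block_mat B V (transpose_mat V) W * extend_by_id n m S))
    \<longleftrightarrow> preserves R B S" (is "?L \<longleftrightarrow> ?P")
proof
  have Bc: "B \<in> carrier_mat n n" using B by (simp add: adjacency_mat_def)
  have SBS: "transpose_mat S * B * S \<in> carrier_mat n n" using S Bc by simp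
  have VVc: "v \<in> carrier_vec n" if "v \<in> VV R" for v using that R by (simp add: VV_def)
  show ?P if L: ?L
  proof -
    \<comment> \<open>The border consists of the single column \<open>v\<close>, with
      \<open>W\<close> the zero matrix of order 1. The condition on \<open>B\<close> is obtained
      along with the one on \<open>v\<close>; it always becomes available because the zero vector
      lies in \<open>VV R\<close>.\<close>
    have main: "adjacency_mat n (transpose_mat S * B * S) \<and> zero_one_vec (transpose_mat S *\<^sub>v v)"
      if v: "v \<in> VV R" for v
    proof -
      let ?V = "mat_of_cols n [v]" and ?W = "0\<^sub>m 1 1 :: rat mat"
      have V: "?V \<in> carrier_mat n 1" using mat_of_cols_carrier[of n "[v]"] by simp
      have Vi: "?V $$ (i, 0) = v $ i" if "i < n" for i
        using that by (simp add: mat_of_cols_def)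
      have col: "col ?V 0 = v" using VVc[OF v] by (intro eq_vecI) (auto simp: Vi)
      have "v $ i \<in> {0, 1}" if "i < n" for i
        using v that VVc[OF v] by (auto simp: VV_def zero_one_vec_def)
      then have "adjacency_mat (n + 1) (four_block_mat B ?V (transpose_mat ?V) ?W)"
        using V B by (subst adjacency_four_block[OF Bc]) (auto simp: Vi adjacency_mat_iff)
      then have "adjacency_mat (n + 1) (four_block_mat (transpose_mat S * B * S) (transpose_mat S * ?V)
          (transpose_mat ?V * S) ?W)"
        using L[rule_format, of ?V 1 ?W] extend_by_id_congruence[OF S Bc V, of ?W] V v col by simp
      then have a: "adjacency_mat n (transpose_mat S * B * S)"
        "\<forall>i<n. (transpose_mat S * ?V) $$ (i, 0) \<in> {0, 1}"
        using adjacency_four_block[OF SBS, of "transpose_mat S * ?V" 1 "transpose_mat ?V * S" ?W] S V by auto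
      have "(transpose_mat S * ?V) $$ (i, 0) = (transpose_mat S *\<^sub>v v) $ i" if "i < n" for i
        using that S V col by simp
      then show ?thesis using a S by (simp add: zero_one_vec_def)
    qed
    have "0\<^sub>v n \<in> VV R" using R by (auto simp: VV_def zero_one_vec_def)
    then show ?thesis using main R by (auto simp: preserves_def)
  qed
  show ?L if P: ?P
  proof (intro allI impI)
    fix m V W
    assume h: "V \<in> carrier_mat n m \<and> W \<in> carrier_mat m m \<and>
        adjacency_mat (n + m) (four_block_mat B V (transpose_mat V) W) \<and> (\<forall>j<m. col V j \<in> VV R)"
    then have V: "V \<in> carrier_mat n m" and W: "W \<in> carrier_mat m m" by auto
    have W': "adjacency_mat m W"
      using h adjacency_four_block[OF Bc V _ W, of "transpose_mat V"] V by auto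
    have e: "(transpose_mat S * V) $$ (i, j) = (transpose_mat S *\<^sub>v col V j) $ i" if "i < n" "j < m" for i j
      using S V that by simp
    have "(transpose_mat S * V) $$ (i, j) \<in> {0, 1}" if "i < n" "j < m" for i j
      using P h S that unfolding e[OF that] preserves_def zero_one_vec_def by auto
    moreover have "(transpose_mat V * S) $$ (j, i) = (transpose_mat S * V) $$ (i, j)" if "i < n" "j < m" for i j
      using S V that by (simp add: comm_scalar_prod[of _ n])
    ultimately have "adjacency_mat (n + m) (four_block_mat (transpose_mat S * B * S) (transpose_mat S * V)
        (transpose_mat V * S) W)"
      using P R W' S V W by (subst adjacency_four_block[OF SBS]) (auto simp: preserves_def)
    then show "adjacency_mat (n + m) (transpose_mat (extend_by_id n m S) *
          four_block_mat B V (transpose_mat V) W * extend_by_id n m S)"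
      unfolding extend_by_id_congruence[OF S Bc V W] .
  qed
qed

lemma reducible_wrt_iff:
  assumes R: "R \<in> carrier_mat n n" and B: "adjacency_mat n B"
  shows "reducible_wrt R B \<longleftrightarrow> (\<exists>Rs.
     (\<forall>M\<in>set Rs. regular_orthogonal n M \<and> decomposable n M \<and> level M \<le> 2) \<and>
     R = mat_list_prod n Rs \<and> (\<forall>i\<in>{1..<length Rs}. preserves R B (mat_list_prod n (take i Rs))))"
proof -
  have n: "dim_row R = n" using R by simp
  have *: "(\<forall>m V W.
        let A = four_block_mat B V (transpose_mat V) W;
            Q = mat_list_prod (n + m) (map (extend_by_id n m) (take i Rs))
        in V \<in> carrier_mat n m \<and> W \<in> carrier_mat m m \<and> adjacency_mat (n + m) A \<and>
           (\<forall>j<m. col V j \<in> VV R) \<longrightarrow>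
           adjacency_mat (n + m) (transpose_mat Q * A * Q)) \<longleftrightarrow> preserves R B (mat_list_prod n (take i Rs))"
    if "\<forall>M\<in>set Rs. regular_orthogonal n M \<and> decomposable n M \<and> level M \<le> 2" for i Rs
  proof -
    have c: "set (take i Rs) \<subseteq> carrier_mat n n"
      using that set_take_subset[of i Rs] by (auto simp: regular_orthogonal_def)
    show ?thesis
      unfolding Let_def mat_list_prod_extend_by_id[OF c]
      by (rule bordered_iff_preserves[OF mat_list_prod_carrier[OF c] R B])
  qed
  show ?thesis unfolding reducible_wrt_def n
    unfolding Let_def[of n] using * by (intro ex_cong1) blast
qed

section \<open>Matrices permuting the block differences\<close>

definition sg :: "nat \<Rightarrow> rat" where "sg y = (if even y then 1 else -1)"

text \<open>Column \<open>y\<close> is half of the sum vector of block \<open>\<alpha> y\<close>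
  plus \<open>\<epsilon> y\<close> times half of the difference vector of block
  \<open>\<beta> y\<close>; \<open>sg\<close> lists the entries of the difference vectors.\<close>

definition col_mat :: "(nat \<Rightarrow> nat) \<Rightarrow> (nat \<Rightarrow> nat) \<Rightarrow> (nat \<Rightarrow> rat) \<Rightarrow> rat mat" where
  "col_mat \<alpha> \<beta> \<epsilon> = mat 10 10 (\<lambda>(a, y).
     ((if a div 2 = \<alpha> y then 1 else 0) + (if a div 2 = \<beta> y then sg a * \<epsilon> y else 0)) / 2)"

lemma col_mat_carrier [simp]: "col_mat \<alpha> \<beta> \<epsilon> \<in> carrier_mat 10 10"
  and col_mat_dim [simp]: "dim_row (col_mat \<alpha> \<beta> \<epsilon>) = 10" "dim_col (col_mat \<alpha> \<beta> \<epsilon>) = 10"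
  by (simp_all add: col_mat_def)

lemma sum_pairs: "(\<Sum>a = 0..<10. g a) = (\<Sum>i<5. g (2 * i) + g (2 * i + 1))"
  for g :: "nat \<Rightarrow> rat"
  by (simp add: eval_nat_numeral)

lemma sum_block:
  fixes g :: "nat \<Rightarrow> rat"
  assumes "i < 5"
  shows "(\<Sum>a = 0..<10. if a div 2 = i then g a else 0) = g (2 * i) + g (2 * i + 1)"
proof -
  have "(\<Sum>a = 0..<10. if a div 2 = i then g a else 0)
      = (\<Sum>j<5. if j = i then g (2 * i) + g (2 * i + 1) else 0)"
    unfolding sum_pairs by (rule sum.cong) auto
  then show ?thesis using assms by simp
qed

lemma sum_col_mat:
  assumes "\<alpha> y < 5" "\<beta> y < 5" "y < 10"
  shows "(\<Sum>a = 0..<10. F a * col_mat \<alpha> \<beta> \<epsilon> $$ (a, y)) =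
    (F (2 * \<alpha> y) + F (2 * \<alpha> y + 1) + \<epsilon> y * (F (2 * \<beta> y) - F (2 * \<beta> y + 1))) / 2"
proof -
  have "(\<Sum>a = 0..<10. F a * col_mat \<alpha> \<beta> \<epsilon> $$ (a, y)) =
     (\<Sum>a = 0..<10. (if a div 2 = \<alpha> y then F a / 2 else 0) +
        (if a div 2 = \<beta> y then F a * sg a * \<epsilon> y / 2 else 0))"
    using assms(3) by (intro sum.cong) (auto simp: col_mat_def field_simps)
  also have "\<dots> = F (2 * \<alpha> y) / 2 + F (2 * \<alpha> y + 1) / 2 +
      (F (2 * \<beta> y) * sg (2 * \<beta> y) * \<epsilon> y / 2 + F (2 * \<beta> y + 1) * sg (2 * \<beta> y + 1) * \<epsilon> y / 2)"
    unfolding sum.distrib sum_block[OF assms(1)] sum_block[OF assms(2)] ..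
  finally show ?thesis by (simp add: sg_def field_simps)
qed

text \<open>The coordinates of the \<open>2 \<times> 2\<close> block in position \<open>(i, j)\<close> with respect to the
  vectors \<open>e = (1, 1)\<close> and \<open>f = (1, -1)\<close> on either side.\<close>

definition ee :: "rat mat \<Rightarrow> nat \<Rightarrow> nat \<Rightarrow> rat" where
  "ee B i j = B $$ (2*i, 2*j) + B $$ (2*i, 2*j+1) + B $$ (2*i+1, 2*j) + B $$ (2*i+1, 2*j+1)"

definition ef :: "rat mat \<Rightarrow> nat \<Rightarrow> nat \<Rightarrow> rat" where
  "ef B i j = B $$ (2*i, 2*j) - B $$ (2*i, 2*j+1) + B $$ (2*i+1, 2*j) - B $$ (2*i+1, 2*j+1)"

definition fe :: "rat mat \<Rightarrow> nat \<Rightarrow> nat \<Rightarrow> rat" where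
  "fe B i j = B $$ (2*i, 2*j) + B $$ (2*i, 2*j+1) - B $$ (2*i+1, 2*j) - B $$ (2*i+1, 2*j+1)"

definition ff :: "rat mat \<Rightarrow> nat \<Rightarrow> nat \<Rightarrow> rat" where
  "ff B i j = B $$ (2*i, 2*j) - B $$ (2*i, 2*j+1) - B $$ (2*i+1, 2*j) + B $$ (2*i+1, 2*j+1)"

lemma congruence_entry:
  assumes S: "S \<in> carrier_mat n n" and B: "B \<in> carrier_mat n n" and yz: "y < n" "z < n"
  shows "(transpose_mat S * B * S) $$ (y, z) =
    (\<Sum>b = 0..<n. (\<Sum>a = 0..<n. B $$ (a, b) * S $$ (a, y)) * (S $$ (b, z) :: rat))"
proof -
  have T: "transpose_mat S \<in> carrier_mat n n" using S by simp
  show ?thesis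
    unfolding mult_mat_entry[OF mult_carrier_mat[OF T B] S yz]
    by (rule sum.cong) (use S in \<open>auto simp: mult_mat_entry[OF T B yz(1)] mult.commute yz\<close>)
qed

lemma col_mat_congruence:
  assumes B: "B \<in> carrier_mat 10 10" and yz: "y < 10" "z < 10"
    and b: "\<alpha> y < 5" "\<beta> y < 5" "\<alpha> z < 5" "\<beta> z < 5"
  shows "(transpose_mat (col_mat \<alpha> \<beta> \<epsilon>) * B * col_mat \<alpha> \<beta> \<epsilon>) $$ (y, z) =
    (ee B (\<alpha> y) (\<alpha> z) + \<epsilon> z * ef B (\<alpha> y) (\<beta> z) + \<epsilon> y * fe B (\<beta> y) (\<alpha> z)
      + \<epsilon> y * \<epsilon> z * ff B (\<beta> y) (\<beta> z)) / 4"
  unfolding congruence_entry[OF col_mat_carrier B yz] sum_col_mat[of \<alpha> y \<beta>, OF b(1,2) yz(1)]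
    sum_col_mat[of \<alpha> z \<beta>, OF b(3,4) yz(2)]
  by (simp add: ee_def ef_def fe_def ff_def field_simps)

text \<open>\<open>switch p\<close> fixes the sum vector of every block and sends the difference vector of block \<open>i\<close>
  to that of block \<open>p i\<close>.\<close>

definition switch :: "(nat \<Rightarrow> nat) \<Rightarrow> rat mat" where
  "switch p = col_mat (\<lambda>y. y div 2) (\<lambda>y. p (y div 2)) sg"

lemma switch_carrier [simp]: "switch p \<in> carrier_mat 10 10"
  and switch_dim [simp]: "dim_row (switch p) = 10" "dim_col (switch p) = 10"
  by (simp_all add: switch_def)

lemma switch_entry:
  assumes "a < 10" "y < 10"
  shows "switch p $$ (a, y) = ((if a div 2 = y div 2 then 1 else 0)
    + (if a div 2 = p (y div 2) then sg a * sg y else 0)) / 2"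
  using assms by (simp add: switch_def col_mat_def)

lemma div2_less [simp]: "y < 10 \<Longrightarrow> y div 2 < (5::nat)" by simp

lemma switch_congruence:
  assumes "B \<in> carrier_mat 10 10" "\<And>i. i < 5 \<Longrightarrow> p i < 5" "y < 10" "z < 10"
  shows "(transpose_mat (switch p) * B * switch p) $$ (y, z) =
    (ee B (y div 2) (z div 2) + sg z * ef B (y div 2) (p (z div 2)) + sg y * fe B (p (y div 2)) (z div 2)
      + sg y * sg z * ff B (p (y div 2)) (p (z div 2))) / 4"
  unfolding switch_def using assms by (subst col_mat_congruence) simp_all

lemma switch_row_pair:
  assumes "a < 10" "j < 5"
  shows "switch p $$ (a, 2 * j) + switch p $$ (a, 2 * j + 1) = (if a div 2 = j then 1 else 0)"
    "switch p $$ (a, 2 * j) - switch p $$ (a, 2 * j + 1) = (if a div 2 = p j then sg a else 0)"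
  using assms by (simp_all add: switch_entry sg_def)

lemma switch_mult:
  assumes "\<And>i. i < 5 \<Longrightarrow> p i < 5" "\<And>i. i < 5 \<Longrightarrow> q i < 5"
  shows "switch p * switch q = switch (\<lambda>i. p (q i))"
proof (rule eq_matI)
  fix a y assume "a < dim_row (switch (\<lambda>i. p (q i)))" "y < dim_col (switch (\<lambda>i. p (q i)))"
  then have ay: "a < 10" "y < 10" by simp_all
  have d: "y div 2 < 5" using ay by simp
  have "(switch p * switch q) $$ (a, y) = (\<Sum>b = 0..<10. switch p $$ (a, b) * switch q $$ (b, y))"
    by (rule mult_mat_entry[OF switch_carrier switch_carrier ay])
  also have "\<dots> = ((if a div 2 = y div 2 then 1 else 0)
      + sg y * (if a div 2 = p (q (y div 2)) then sg a else 0)) / 2"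
    unfolding switch_def[of q] sum_col_mat[of "\<lambda>y. y div 2" y "\<lambda>y. q (y div 2)", OF d assms(2)[OF d] ay(2)]
    unfolding switch_row_pair[OF ay(1) d] switch_row_pair[OF ay(1) assms(2)[OF d]] ..
  finally show "(switch p * switch q) $$ (a, y) = switch (\<lambda>i. p (q i)) $$ (a, y)"
    using ay by (simp add: switch_entry)
qed simp_all

lemma switch_regular_orthogonal:
  assumes p: "\<And>i. i < 5 \<Longrightarrow> p i < 5" and inj: "inj_on p {..<5}"
  shows "regular_orthogonal 10 (switch p)"
proof -
  have i1: "transpose_mat (switch p) * switch p = 1\<^sub>m 10"
  proof (rule eq_matI)
    fix y z assume "y < dim_row (1\<^sub>m 10 :: rat mat)" "z < dim_col (1\<^sub>m 10 :: rat mat)"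
    then have yz: "y < 10" "z < 10" by simp_all
    \<comment> \<open>Orthogonality is the congruence formula for the identity matrix in place of
      \<open>B\<close>.\<close>
    have one: "ee (1\<^sub>m 10) i j = (if i = j then 2 else 0)" "ef (1\<^sub>m 10) i j = 0" "fe (1\<^sub>m 10) i j = 0"
      "ff (1\<^sub>m 10) i j = (if i = j then 2 else 0)" if "i < 5" "j < 5" for i j
      using that by (auto simp: ee_def ef_def fe_def ff_def Suc_double_not_eq_double double_not_eq_Suc_double)
    have pj: "p (y div 2) = p (z div 2) \<longleftrightarrow> y div 2 = z div 2"
      using inj yz by (auto simp: inj_on_def)
    have par: "y = z \<longleftrightarrow> y div 2 = z div 2 \<and> even y = even z" by presburger
    have "(transpose_mat (switch p) * switch p) $$ (y, z) = (transpose_mat (switch p) * 1\<^sub>m 10 * switch p) $$ (y, z)"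
      by simp
    also have "\<dots> = (if y = z then 1 else 0)"
    proof -
      have "(transpose_mat (switch p) * 1\<^sub>m 10 * switch p) $$ (y, z) =
        ((if y div 2 = z div 2 then 2 else 0) + sg y * sg z * (if y div 2 = z div 2 then 2 else 0)) / 4"
        by (subst switch_congruence) (use p yz in \<open>simp_all add: one pj del: right_mult_one_mat mult_carrier_mat\<close>)
      then show ?thesis unfolding par by (cases "even y"; cases "even z"; cases "y div 2 = z div 2") (simp_all add: sg_def)
    qed
    finally show "(transpose_mat (switch p) * switch p) $$ (y, z) = 1\<^sub>m 10 $$ (y, z)" using yz by simp
  qed simp_all
  moreover have "switch p * transpose_mat (switch p) = 1\<^sub>m 10"
    by (rule mat_mult_left_right_inverse[OF _ _ i1]) simp_all
  moreover have "(\<Sum>y<10. switch p $$ (a, y)) = 1" if "a < 10" for a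
  proof -
    have "(\<Sum>y<10. switch p $$ (a, y)) = (\<Sum>j<5. if a div 2 = j then 1 else 0)"
      unfolding lessThan_atLeast0[of 10] sum_pairs
      using switch_row_pair(1)[OF that] by (intro sum.cong) simp_all
    then show ?thesis using that by simp
  qed
  ultimately show ?thesis by (simp add: regular_orthogonal_def)
qed

lemma switch_level: "level (switch p) \<le> 2"
proof -
  have "x \<in> \<int>" if x: "x \<in> elements_mat (of_nat 2 \<cdot>\<^sub>m switch p)" for x
  proof -
    obtain a y where ay: "a < 10" "y < 10" "x = (of_nat 2 \<cdot>\<^sub>m switch p) $$ (a, y)"
      using elements_matD[OF x] by auto
    then have "x = (if a div 2 = y div 2 then 1 else 0) + (if a div 2 = p (y div 2) then sg a * sg y else 0)"
      by (simp add: switch_entry)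
    then show ?thesis by (auto simp: sg_def)
  qed
  then show ?thesis unfolding level_def by (intro Least_le) auto
qed

text \<open>Column \<open>y\<close> is supported on the blocks \<open>y div 2\<close> and
  \<open>p (y div 2)\<close>. The indices of the blocks in \<open>I\<close> thus serve as both the
  row set and the column set of a splitting.\<close>

lemma switch_decomposable:
  assumes p: "\<And>i. i < 5 \<Longrightarrow> p i < 5" and inj: "inj_on p {..<5}"
    and I: "I \<subseteq> {..<5}" "I \<noteq> {}" "I \<noteq> {..<5}" and pI: "\<And>i. i < 5 \<Longrightarrow> p i \<in> I \<longleftrightarrow> i \<in> I"
  shows "decomposable 10 (switch p)"
proof (rule split_by_imp_decomposable[OF switch_carrier])
  let ?X = "{a. a div 2 \<in> I}"
  obtain i where i: "i \<in> I" using I by blast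
  obtain j where j: "j < 5" "j \<notin> I" using I by blast
  have "?X \<subseteq> {..<10}" using I by auto
  moreover have "2 * i \<in> ?X" "2 * j \<notin> ?X" "2 * j \<in> {..<10}" using i j by auto
  moreover have "a div 2 \<in> I \<longleftrightarrow> y div 2 \<in> I" if "a < 10" "y < 10" "switch p $$ (a, y) \<noteq> 0" for a y
    using that pI[of "y div 2"] by (auto simp: switch_entry split: if_splits)
  ultimately show "split_by 10 (switch p) ?X ?X" unfolding split_by_def by blast
qed

definition cyc :: "nat \<Rightarrow> nat" where "cyc i = (i + 1) mod 5"

lemma less_5_cases: "i < 5 \<Longrightarrow> i = 0 \<or> i = 1 \<or> i = 2 \<or> i = 3 \<or> i = (4::nat)" by auto

lemma cyc_neq: "i < 5 \<Longrightarrow> cyc i \<noteq> i"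
  using less_5_cases[of i] by (auto simp: cyc_def)

lemma cyc_values: "cyc 0 = 1" "cyc 1 = 2" "cyc (Suc 0) = 2" "cyc 2 = 3" "cyc 3 = 4" "cyc 4 = 0"
  by (simp_all add: cyc_def)

lemma circulant_dim [simp]: "dim_row (circulant Xs) = 2 * length Xs" "dim_col (circulant Xs) = 2 * length Xs"
  by (simp_all add: circulant_def Let_def)

lemma circulant_entry:
  assumes "length Xs = 5" "a < 10" "b < 10"
  shows "circulant Xs $$ (a, b) = (Xs ! ((b div 2 + 5 - a div 2) mod 5)) $$ (a mod 2, b mod 2)"
  using assms by (simp add: circulant_def)

text \<open>With column vectors \<open>e\<close> and \<open>f\<close>, \<open>J2 = e e^T\<close> and
  \<open>Y2 = f f^T\<close>. The block \<open>Y2\<close> has list index 4, so it stands at block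
  positions \<open>(i, j)\<close> with \<open>j - i = 4\<close> modulo 5, that is
  \<open>i = j + 1\<close>; this fixes the direction of \<open>cyc\<close>.\<close>

lemma R10_eq_switch: "R10 = switch cyc"
proof (rule eq_matI)
  fix a b assume "a < dim_row (switch cyc)" "b < dim_col (switch cyc)"
  then have ab: "a < 10" "b < 10" by simp_all
  have x: "a mod 2 < 2" "b mod 2 < 2" by simp_all
  have nth: "[J2, O2, O2, O2, Y2] ! (k mod 5) = (if k mod 5 = 0 then J2 else if k mod 5 = 4 then Y2 else O2)" for k
    using less_5_cases[OF mod_less_divisor[of 5 k]] by auto
  have idx: "(j + 5 - i) mod 5 = 0 \<longleftrightarrow> i = j" "(j + 5 - i) mod 5 = 4 \<longleftrightarrow> i = cyc j" if "i < 5" "j < 5" for i j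
    using less_5_cases[OF that(1)] less_5_cases[OF that(2)] by (elim disjE; simp add: cyc_def)+
  have Y: "Y2 $$ (a mod 2, b mod 2) = sg a * sg b"
    using x by (simp add: Y2_def all_ones_mat_def sg_def) presburger
  have J: "J2 $$ (a mod 2, b mod 2) = 1" "O2 $$ (a mod 2, b mod 2) = 0"
    using x by (simp_all add: all_ones_mat_def)
  have "R10 $$ (a, b) = ([J2, O2, O2, O2, Y2] ! ((b div 2 + 5 - a div 2) mod 5)) $$ (a mod 2, b mod 2) / 2"
    using ab circulant_dim[of "[J2, O2, O2, O2, Y2]"]
    by (simp add: R10_def circulant_entry del: circulant_dim)
  also have "\<dots> = switch cyc $$ (a, b)"
    unfolding switch_entry[OF ab]
    unfolding nth idx[OF div2_less[OF ab(1)] div2_less[OF ab(2)]] 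
    using cyc_neq[OF div2_less[OF ab(2)]]
    by (cases "a div 2 = b div 2"; cases "a div 2 = cyc (b div 2)") (simp_all add: J Y)
  finally show "R10 $$ (a, b) = switch cyc $$ (a, b)" .
qed (simp_all add: R10_def)

lemma R10_carrier [simp]: "R10 \<in> carrier_mat 10 10" and R10_dim [simp]: "dim_row R10 = 10"
  by (simp_all add: R10_eq_switch)

section \<open>Blocks of even sum\<close>

text \<open>A \<open>2 \<times> 2\<close> block with entries in \<open>{0, 1}\<close> and even sum is, up to complement, one of \<open>O2\<close>,
  \<open>N2T\<close>, \<open>N2\<close>, \<open>I2\<close>; these have the codes 0, 1, 2, 3.\<close>

definition code :: "rat mat \<Rightarrow> nat \<Rightarrow> nat \<Rightarrow> nat" where
  "code B i j = (if i = j then 0 else if ef B i j \<noteq> 0 then 1 else if fe B i j \<noteq> 0 then 2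
     else if ff B i j \<noteq> 0 then 3 else 0)"

definition transp_code :: "nat \<Rightarrow> nat" where
  "transp_code c = (if c = 1 then 2 else if c = 2 then 1 else c)"

text \<open>If \<open>B\<close> has even blocks and \<open>t = code B\<close>, then \<open>row_ok t p i\<close> and \<open>pair_ok t p i j\<close> say that the blocks
  \<open>(i, i)\<close> and \<open>(i, j)\<close> of \<open>transpose_mat (switch p) * B * switch p\<close> are admissible in an adjacency matrix.
  The block \<open>(i, j)\<close> has coordinates \<open>ee B i j\<close>, \<open>ef B i (p j) = fe B (p j) i\<close>, \<open>fe B (p i) j\<close>,
  \<open>ff B (p i) (p j)\<close>: exactly one of the last three must be non-zero if \<open>ee B i j = 2\<close>, and none otherwise.\<close>

definition row_ok :: "(nat \<Rightarrow> nat \<Rightarrow> nat) \<Rightarrow> (nat \<Rightarrow> nat) \<Rightarrow> nat \<Rightarrow> bool" where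
  "row_ok t p i \<longleftrightarrow> t (p i) i \<noteq> 2"

definition pair_ok :: "(nat \<Rightarrow> nat \<Rightarrow> nat) \<Rightarrow> (nat \<Rightarrow> nat) \<Rightarrow> nat \<Rightarrow> nat \<Rightarrow> bool" where
  "pair_ok t p i j \<longleftrightarrow>
     (if t (p j) i = 2 then t i j \<noteq> 0 \<and> t (p i) j \<noteq> 2 \<and> t (p i) (p j) \<noteq> 3
      else if t (p i) j = 2 then t i j \<noteq> 0 \<and> t (p i) (p j) \<noteq> 3
      else (t (p i) (p j) = 3) = (t i j \<noteq> 0))"

text \<open>Each unordered pair of blocks is listed in one orientation. The congruent matrix is
  symmetric, so the opposite block is admissible as well. Explicit lists make the predicate
  executable.\<close>

definition allowed :: "(nat \<Rightarrow> nat \<Rightarrow> nat) \<Rightarrow> (nat \<Rightarrow> nat) \<Rightarrow> bool" where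
  "allowed t p \<longleftrightarrow> list_all (\<lambda>(i, j). pair_ok t p i j)
       [(0,2), (1,3), (2,4), (3,0), (4,1), (0,1), (1,2), (2,3), (3,4), (4,0)] \<and>
     list_all (row_ok t p) [0, 1, 2, 3, 4]"

definition zero_one_block :: "rat mat \<Rightarrow> nat \<Rightarrow> nat \<Rightarrow> bool" where
  "zero_one_block B i j \<longleftrightarrow> B $$ (2*i, 2*j) \<in> {0, 1} \<and> B $$ (2*i, 2*j+1) \<in> {0, 1} \<and>
     B $$ (2*i+1, 2*j) \<in> {0, 1} \<and> B $$ (2*i+1, 2*j+1) \<in> {0, 1}"

lemma block_entries:
  "B $$ (2*i, 2*j) = (ee B i j + ef B i j + fe B i j + ff B i j) / 4"
  "B $$ (2*i, 2*j+1) = (ee B i j - ef B i j + fe B i j - ff B i j) / 4"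
  "B $$ (2*i+1, 2*j) = (ee B i j + ef B i j - fe B i j - ff B i j) / 4"
  "B $$ (2*i+1, 2*j+1) = (ee B i j - ef B i j - fe B i j + ff B i j) / 4"
  by (simp_all add: ee_def ef_def fe_def ff_def)

text \<open>The four coordinates of an integral block have the same parity, so one even coordinate
  makes the sum even. Of the eight blocks left, \<open>O2\<close> and \<open>J2\<close> have
  vanishing \<open>ef\<close>, \<open>fe\<close>, \<open>ff\<close>, and each of the six blocks of
  sum 2 has exactly one of these non-zero.\<close>

lemma zero_one_block_cases:
  assumes "zero_one_block B i j" and "ef B i j \<in> {0, 2, -2} \<or> fe B i j \<in> {0, 2, -2} \<or> ee B i j \<in> {0, 2, 4}"
  shows "ee B i j \<in> {0, 4} \<and> ef B i j = 0 \<and> fe B i j = 0 \<and> ff B i j = 0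
    \<or> ee B i j = 2 \<and> ef B i j \<in> {2, -2} \<and> fe B i j = 0 \<and> ff B i j = 0
    \<or> ee B i j = 2 \<and> ef B i j = 0 \<and> fe B i j \<in> {2, -2} \<and> ff B i j = 0
    \<or> ee B i j = 2 \<and> ef B i j = 0 \<and> fe B i j = 0 \<and> ff B i j \<in> {2, -2}"
  using assms unfolding zero_one_block_def ee_def ef_def fe_def ff_def by (elim conjE insertE emptyE; simp)

text \<open>The cases are nested in the same order as in \<open>pair_ok\<close>, into which this
  criterion is translated.\<close>

lemma zero_one_block_iff:
  assumes "ee B i j \<in> {0, 2, 4}" "ef B i j \<in> {0, 2, -2}" "fe B i j \<in> {0, 2, -2}" "ff B i j \<in> {0, 2, -2}"
  shows "zero_one_block B i j \<longleftrightarrow> (if ef B i j \<noteq> 0 then ee B i j = 2 \<and> fe B i j = 0 \<and> ff B i j = 0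
    else if fe B i j \<noteq> 0 then ee B i j = 2 \<and> ff B i j = 0 else (ff B i j \<noteq> 0) = (ee B i j = 2))"
  unfolding zero_one_block_def block_entries using assms by (elim insertE emptyE; simp)

lemma pair_index:
  obtains i x where "a = 2 * i + x" "x < (2::nat)" "a < 10 \<Longrightarrow> i < 5"
proof
  show "a = 2 * (a div 2) + a mod 2" by simp
qed auto

lemma less_2_cases: "x < 2 \<Longrightarrow> x = 0 \<or> x = (1::nat)" by auto

lemma adjacency_mat_blocks:
  "adjacency_mat 10 B \<longleftrightarrow> B \<in> carrier_mat 10 10 \<and>
     (\<forall>i<5. \<forall>j<5. zero_one_block B i j \<and> ee B j i = ee B i j \<and> ef B j i = fe B i j \<and> ff B j i = ff B i j) \<and>
     (\<forall>i<5. B $$ (2*i, 2*i) = 0 \<and> B $$ (2*i+1, 2*i+1) = 0)" (is "?L \<longleftrightarrow> ?R")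
proof
  assume L: ?L
  have L': "B $$ (a, b) \<in> {0, 1} \<and> B $$ (b, a) = B $$ (a, b)" if "a < 10" "b < 10" for a b
    using L that unfolding adjacency_mat_iff by blast
  have "zero_one_block B i j \<and> ee B j i = ee B i j \<and> ef B j i = fe B i j \<and> ff B j i = ff B i j"
    if ij: "i < 5" "j < 5" for i j
  proof -
    have b: "2*i < 10" "2*i+1 < 10" "2*j < 10" "2*j+1 < 10" using ij by simp_all
    show ?thesis
      unfolding zero_one_block_def ee_def ef_def fe_def ff_def
      using L'[OF b(1,3)] L'[OF b(1,4)] L'[OF b(2,3)] L'[OF b(2,4)] by auto
  qed
  then show ?R using L by (auto simp: adjacency_mat_iff)
next
  assume R: ?R
  have R': "zero_one_block B i j" "ee B j i = ee B i j" "ef B j i = fe B i j" "ff B j i = ff B i j"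
    if "i < 5" "j < 5" for i j using R that by blast+
  have "B $$ (a, b) \<in> {0, 1} \<and> B $$ (b, a) = B $$ (a, b)" if ab: "a < 10" "b < 10" for a b
  proof -
    obtain i x where a: "a = 2 * i + x" "x < 2" "i < 5" using pair_index ab(1) by blast
    obtain j y where b: "b = 2 * j + y" "y < 2" "j < 5" using pair_index ab(2) by blast
    note s = R'[OF a(3) b(3)] R'(3)[OF b(3) a(3), symmetric]
    have "B $$ (2*j+y, 2*i+x) = B $$ (2*i+x, 2*j+y)"
      using less_2_cases[OF a(2)] less_2_cases[OF b(2)]
      by (elim disjE) (simp_all add: block_entries[of B j i, unfolded s(2-5)] block_entries[of B i j]
          del: One_nat_def)
    moreover have "B $$ (2*i+x, 2*j+y) \<in> {0, 1}"
      using less_2_cases[OF a(2)] less_2_cases[OF b(2)] s(1) unfolding zero_one_block_def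
      by (elim disjE) (simp_all del: One_nat_def)
    ultimately show ?thesis unfolding a(1) b(1) by blast
  qed
  moreover have "B $$ (a, a) = 0" if a10: "a < 10" for a
  proof -
    obtain i x where a: "a = 2 * i + x" "x < 2" "i < 5" using pair_index a10 by blast
    have "B $$ (2*i, 2*i) = 0" "B $$ (2*i+1, 2*i+1) = 0" using R a(3) by blast+
    then show ?thesis using less_2_cases[OF a(2)] unfolding a(1) by (elim disjE) simp_all
  qed
  ultimately show ?L using R unfolding adjacency_mat_iff by blast
qed

lemma switch_blocks:
  assumes B: "B \<in> carrier_mat 10 10" and p: "\<And>i. i < 5 \<Longrightarrow> p i < 5" and ij: "i < 5" "j < 5"
  defines "M \<equiv> transpose_mat (switch p) * B * switch p"
  shows "ee M i j = ee B i j" "ef M i j = ef B i (p j)" "fe M i j = fe B (p i) j" "ff M i j = ff B (p i) (p j)"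
proof -
  have e: "M $$ (2*i, 2*j) = (ee B i j + ef B i (p j) + fe B (p i) j + ff B (p i) (p j)) / 4"
    "M $$ (2*i, 2*j+1) = (ee B i j - ef B i (p j) + fe B (p i) j - ff B (p i) (p j)) / 4"
    "M $$ (2*i+1, 2*j) = (ee B i j + ef B i (p j) - fe B (p i) j - ff B (p i) (p j)) / 4"
    "M $$ (2*i+1, 2*j+1) = (ee B i j - ef B i (p j) - fe B (p i) j + ff B (p i) (p j)) / 4"
    unfolding M_def by (subst switch_congruence; use B p ij in \<open>simp add: sg_def\<close>)+
  show "ee M i j = ee B i j" "ef M i j = ef B i (p j)" "fe M i j = fe B (p i) j" "ff M i j = ff B (p i) (p j)"
    unfolding ee_def[of M] ef_def[of M] fe_def[of M] ff_def[of M] e by (simp_all add: field_simps)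
qed

text \<open>The diagonal block \<open>i\<close> of the congruent matrix combines the
  \<open>ee\<close> coordinate of block \<open>i\<close> with the \<open>ff\<close> coordinate of
  block \<open>p i\<close>. Equality of all diagonal blocks makes these cancel on the diagonal for
  every \<open>p\<close>.\<close>

definition even_blocks :: "rat mat \<Rightarrow> bool" where
  "even_blocks B \<longleftrightarrow> adjacency_mat 10 B \<and> (\<forall>i<5. B $$ (2*i, 2*i+1) = B $$ (0, 1)) \<and>
     (\<forall>i<5. \<forall>j<5. i \<noteq> j \<longrightarrow> ee B i j \<in> {0, 2, 4})"

lemma diagonal_block:
  assumes "adjacency_mat 10 B" "i < 5"
  shows "ee B i i = 2 * B $$ (2*i, 2*i+1)" "ef B i i = 0" "fe B i i = 0" "ff B i i = - 2 * B $$ (2*i, 2*i+1)"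
proof -
  have "B $$ (2*i+1, 2*i) = B $$ (2*i, 2*i+1)" "B $$ (2*i, 2*i) = 0" "B $$ (2*i+1, 2*i+1) = 0"
    using assms(1)[unfolded adjacency_mat_iff] assms(2) by (auto simp del: One_nat_def)
  then show "ee B i i = 2 * B $$ (2*i, 2*i+1)" "ef B i i = 0" "fe B i i = 0" "ff B i i = - 2 * B $$ (2*i, 2*i+1)"
    by (simp_all add: ee_def ef_def fe_def ff_def)
qed

context
  fixes B :: "rat mat"
  assumes ev: "even_blocks B"
begin

lemma even_adjacency: "adjacency_mat 10 B" using ev by (simp add: even_blocks_def)

lemma even_block_cases:
  assumes "i < 5" "j < 5" "i \<noteq> j"
  shows "code B i j = 0 \<and> ee B i j \<in> {0, 4} \<and> ef B i j = 0 \<and> fe B i j = 0 \<and> ff B i j = 0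
    \<or> code B i j = 1 \<and> ee B i j = 2 \<and> ef B i j \<in> {2, -2} \<and> fe B i j = 0 \<and> ff B i j = 0
    \<or> code B i j = 2 \<and> ee B i j = 2 \<and> ef B i j = 0 \<and> fe B i j \<in> {2, -2} \<and> ff B i j = 0
    \<or> code B i j = 3 \<and> ee B i j = 2 \<and> ef B i j = 0 \<and> fe B i j = 0 \<and> ff B i j \<in> {2, -2}"
proof -
  have "zero_one_block B i j" using even_adjacency assms by (simp add: adjacency_mat_blocks)
  from zero_one_block_cases[OF this] show ?thesis
    using ev assms unfolding even_blocks_def code_def by force
qed

lemma even_fe:
  assumes "i < 5" "j < 5"
  shows "fe B i j \<in> {0, 2, -2}" "fe B i j \<noteq> 0 \<longleftrightarrow> code B i j = 2"
  using even_block_cases[OF assms] diagonal_block(3)[OF even_adjacency assms(1)]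
  by (cases "i = j"; fastforce simp: code_def)+

lemma even_ee_ff:
  assumes "i < 5" "j < 5" "i \<noteq> j"
  shows "ee B i j \<in> {0, 2, 4}" "ee B i j = 2 \<longleftrightarrow> code B i j \<noteq> 0"
    "ff B i j \<in> {0, 2, -2}" "ff B i j \<noteq> 0 \<longleftrightarrow> code B i j = 3"
  using even_block_cases[OF assms] by fastforce+

lemma even_ef:
  assumes "i < 5" "j < 5"
  shows "ef B i j = fe B j i"
  using even_adjacency assms by (simp add: adjacency_mat_blocks)

lemma code_transpose:
  assumes "i < 5" "j < 5"
  shows "code B j i = transp_code (code B i j)"
proof (cases "i = j")
  case False
  have "ef B j i = fe B i j" "fe B j i = ef B i j" "ff B j i = ff B i j"
    using even_adjacency assms by (simp_all add: adjacency_mat_blocks)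
  then show ?thesis using even_block_cases[OF assms False] unfolding code_def transp_code_def by auto
qed (simp add: code_def transp_code_def)

text \<open>The 0/1-criterion asks only whether \<open>ee\<close> equals 2 and which of the other
  coordinates vanish. The code of a block records exactly this; the signs, and the choice between a
  block and its complement, do not matter.\<close>

lemma switch_adjacency_iff:
  assumes p: "\<And>i. i < 5 \<Longrightarrow> p i < 5" and inj: "inj_on p {..<5}"
  shows "adjacency_mat 10 (transpose_mat (switch p) * B * switch p) \<longleftrightarrow> allowed (code B) p"
proof -
  let ?M = "transpose_mat (switch p) * B * switch p"
  let ?pairs = "[(0,2), (1,3), (2,4), (3,0), (4,1), (0,1), (1,2), (2,3), (3,4), (4,0)] :: (nat \<times> nat) list"
  have B: "B \<in> carrier_mat 10 10" using even_adjacency by (simp add: adjacency_mat_def)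
  have M: "?M \<in> carrier_mat 10 10" using carrier_matD[OF B] by (intro carrier_matI) simp_all
  have sb: "ee ?M i j = ee B i j" "ef ?M i j = ef B i (p j)" "fe ?M i j = fe B (p i) j"
    "ff ?M i j = ff B (p i) (p j)" if "i < 5" "j < 5" for i j
    using switch_blocks[of B p i j] B p that by blast+
  have sym: "ee ?M j i = ee ?M i j" "ef ?M j i = fe ?M i j" "ff ?M j i = ff ?M i j"
    if "i < 5" "j < 5" for i j
    using even_adjacency that p by (simp_all add: sb adjacency_mat_blocks)
  have zo_sym: "zero_one_block ?M j i \<longleftrightarrow> zero_one_block ?M i j" if "i < 5" "j < 5" for i j
    unfolding zero_one_block_def block_entries[of ?M] sym[OF that] sym(2)[OF that(2,1), symmetric]
    by (auto simp: algebra_simps)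
  have off: "zero_one_block ?M i j \<longleftrightarrow> pair_ok (code B) p i j" if ij: "i < 5" "j < 5" "i \<noteq> j" for i j
  proof -
    have pij: "p i < 5" "p j < 5" "p i \<noteq> p j" using p inj ij by (auto simp: inj_on_def)
    note M = sb[OF ij(1,2)] even_ef[OF ij(1) pij(2)]
    note v = even_fe[OF pij(2) ij(1)] even_fe[OF pij(1) ij(2)] even_ee_ff[OF ij] even_ee_ff[OF pij]
    show ?thesis
      unfolding zero_one_block_iff[of ?M i j, unfolded M, OF v(5,1,3,11)] pair_ok_def
        v(2,4,6,12)[symmetric] by simp
  qed
  \<comment> \<open>After \<open>ee\<close> and \<open>ff\<close> cancel, the two diagonal entries
    are plus and minus one half of \<open>fe B (p i) i\<close>, so they vanish exactly when the code
    of block \<open>(p i, i)\<close> is not 2.\<close>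
  have diag: "zero_one_block ?M i i \<and> ?M $$ (2*i, 2*i) = 0 \<and> ?M $$ (2*i+1, 2*i+1) = 0 \<longleftrightarrow> row_ok (code B) p i"
    if i: "i < 5" for i
  proof -
    have b: "B $$ (2*i, 2*i+1) = B $$ (0, 1)" "B $$ (2*p i, 2*p i+1) = B $$ (0, 1)"
      using ev i p unfolding even_blocks_def by blast+
    have "B $$ (0, 1) \<in> {0, 1}" using even_adjacency by (simp add: adjacency_mat_iff)
    then show ?thesis
      unfolding zero_one_block_def block_entries[of ?M] sb[OF i i] even_ef[OF i p[OF i]] row_ok_def
        diagonal_block[OF even_adjacency i] diagonal_block[OF even_adjacency p[OF i]] b
      using even_fe(2)[OF p[OF i] i] by auto
  qed
  have "adjacency_mat 10 ?M \<longleftrightarrow> (\<forall>i<5. row_ok (code B) p i) \<and> (\<forall>i<5. \<forall>j<5. i \<noteq> j \<longrightarrow> zero_one_block ?M i j)"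
    unfolding adjacency_mat_blocks using M sym diag by metis
  also have "(\<forall>i<5. \<forall>j<5. i \<noteq> j \<longrightarrow> zero_one_block ?M i j) \<longleftrightarrow> (\<forall>(i, j)\<in>set ?pairs. zero_one_block ?M i j)"
  proof (intro iffI allI impI)
    fix i j :: nat assume h: "\<forall>(i, j)\<in>set ?pairs. zero_one_block ?M i j" and ij: "i < 5" "j < 5" "i \<noteq> j"
    have "(i, j) \<in> set ?pairs \<or> (j, i) \<in> set ?pairs"
      using less_5_cases[OF ij(1)] less_5_cases[OF ij(2)] ij(3) by (elim disjE) simp_all
    then show "zero_one_block ?M i j" using h zo_sym[OF ij(1,2)] by blast
  qed auto
  also have "\<dots> \<longleftrightarrow> (\<forall>(i, j)\<in>set ?pairs. pair_ok (code B) p i j)"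
    by (rule ball_cong) (use off in auto)
  also have "(\<forall>i<5. row_ok (code B) p i) \<longleftrightarrow> (\<forall>i\<in>set [0, 1, 2, 3, 4]. row_ok (code B) p i)"
    using less_5_cases by auto
  finally show ?thesis unfolding allowed_def list_all_iff by blast
qed

end

lemma cyc_less [simp]: "cyc i < 5" by (simp add: cyc_def)

lemma inj_cyc: "inj_on cyc {..<5}"
proof (rule inj_onI)
  fix i j assume "i \<in> {..<5}" "j \<in> {..<5}" and eq: "cyc i = cyc j"
  then show "i = j" using less_5_cases[of i] less_5_cases[of j] by (auto simp: cyc_def)
qed

lemma BB_R10_iff:
  "B \<in> BB R10 \<longleftrightarrow> adjacency_mat 10 B \<and> adjacency_mat 10 (transpose_mat (switch cyc) * B * switch cyc)"
  unfolding BB_def R10_eq_switch switch_dim by blast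

text \<open>The two zero diagonal entries in block \<open>i\<close> of the congruent matrix give by
  sum and difference that neighbouring diagonal blocks agree and that
  \<open>ef B i (cyc i) = 0\<close>; by parity, blocks of cyclic neighbours have even sum. In the
  congruent matrix the block \<open>(i, cyc i)\<close> has \<open>fe\<close> coordinate
  \<open>fe B (cyc i) (cyc i) = 0\<close>, so it is even too, and its \<open>ef\<close> coordinate
  is \<open>ef B i (cyc (cyc i))\<close>. This makes the blocks at distance two even.\<close>

lemma BB_imp_even:
  assumes "B \<in> BB R10"
  shows "even_blocks B"
proof -
  let ?M = "transpose_mat (switch cyc) * B * switch cyc"
  have A: "adjacency_mat 10 B" and M: "adjacency_mat 10 ?M"
    using assms unfolding BB_R10_iff by blast+
  have B: "B \<in> carrier_mat 10 10" using A by (simp add: adjacency_mat_def)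
  note sb = switch_blocks[of B cyc, OF B cyc_less]
  have sym: "ee B j i = ee B i j" "ef B j i = fe B i j" "ff B j i = ff B i j" "zero_one_block B i j"
    "zero_one_block ?M i j"
    if "i < 5" "j < 5" for i j using A M that by (simp_all add: adjacency_mat_blocks)
  have d: "ef B i (cyc i) = 0" "B $$ (2 * cyc i, 2 * cyc i + 1) = B $$ (2*i, 2*i+1)" if i: "i < 5" for i
  proof -
    have "?M $$ (2*i, 2*i) = 0" "?M $$ (2*i+1, 2*i+1) = 0" using M i unfolding adjacency_mat_blocks by blast+
    then show "ef B i (cyc i) = 0" "B $$ (2 * cyc i, 2 * cyc i + 1) = B $$ (2*i, 2*i+1)"
      unfolding block_entries(1,4)[of ?M] sb[OF i i] sym(2)[OF cyc_less i] sym(2)[OF i cyc_less]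
        diagonal_block[OF A i] diagonal_block[OF A cyc_less]
      using sym(2)[OF i cyc_less] by auto
  qed
  have e1: "ee B i (cyc i) \<in> {0, 2, 4}" if i: "i < 5" for i
    using zero_one_block_cases[OF sym(4)[OF i cyc_less]] d(1)[OF i] by auto
  have e2: "ee B i (cyc (cyc i)) \<in> {0, 2, 4}" if i: "i < 5" for i
  proof -
    have "fe ?M i (cyc i) = 0" unfolding sb[OF i cyc_less] by (rule diagonal_block[OF A cyc_less])
    then have "ef ?M i (cyc i) \<in> {0, 2, -2}"
      using zero_one_block_cases[OF sym(5)[OF i cyc_less]] by auto
    then show ?thesis unfolding sb[OF i cyc_less]
      using zero_one_block_cases[OF sym(4)[OF i cyc_less]] by auto
  qed
  have "ee B i j \<in> {0, 2, 4}" if ij: "i < 5" "j < 5" "i \<noteq> j" for i j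
  proof -
    have "j = cyc i \<or> j = cyc (cyc i) \<or> i = cyc j \<or> i = cyc (cyc j)"
      using less_5_cases[OF ij(1)] less_5_cases[OF ij(2)] ij(3) by (elim disjE) (simp_all add: cyc_def)
    then show ?thesis using e1 e2 ij sym(1)[OF ij(1,2)] by metis
  qed
  moreover have "B $$ (2*i, 2*i+1) = B $$ (0, 1)" if "i < 5" for i
    using d(2)[of 0] d(2)[of 1] d(2)[of 2] d(2)[of 3] less_5_cases[OF that] by (auto simp: cyc_def)
  ultimately show ?thesis using A unfolding even_blocks_def by blast
qed

lemma BB_iff: "B \<in> BB R10 \<longleftrightarrow> even_blocks B \<and> allowed (code B) cyc"
proof -
  have "adjacency_mat 10 (transpose_mat (switch cyc) * B * switch cyc) \<longleftrightarrow> allowed (code B) cyc"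
    if "even_blocks B" by (rule switch_adjacency_iff[OF that cyc_less inj_cyc])
  then show ?thesis using BB_R10_iff BB_imp_even[of B] even_adjacency[of B] by blast
qed

section \<open>Reducible matrices\<close>

lemma switch_transpose_vec:
  assumes v: "v \<in> carrier_vec 10" and p: "\<And>i. i < 5 \<Longrightarrow> p i < 5" and y: "y < 10"
  shows "(transpose_mat (switch p) *\<^sub>v v) $ y =
    (v $ (2 * (y div 2)) + v $ (2 * (y div 2) + 1)
      + sg y * (v $ (2 * p (y div 2)) - v $ (2 * p (y div 2) + 1))) / 2"
proof -
  have "(transpose_mat (switch p) *\<^sub>v v) $ y = (\<Sum>a = 0..<10. v $ a * switch p $$ (a, y))"
    using v y by (simp add: scalar_prod_def mult.commute)
  then show ?thesis
    unfolding switch_def by (subst (asm) sum_col_mat) (use p y in simp_all)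
qed

text \<open>An entry of the image is half of the sum of \<open>v\<close> on block \<open>i\<close>
  plus or minus its difference on block \<open>cyc i\<close>. It lies in \<open>{0, 1}\<close>
  exactly if \<open>v\<close> is constant on both blocks or on neither, and this property spreads
  around the cycle.\<close>

lemma VV_R10_iff:
  "v \<in> VV R10 \<longleftrightarrow> v \<in> carrier_vec 10 \<and> (\<forall>a<10. v $ a \<in> {0, 1}) \<and>
     ((\<forall>i<5. v $ (2*i) = v $ (2*i+1)) \<or> (\<forall>i<5. v $ (2*i) + v $ (2*i+1) = 1))"
proof (cases "v \<in> carrier_vec 10 \<and> (\<forall>a<10. v $ a \<in> {0, 1})")
  case True
  define u where "u i \<longleftrightarrow> v $ (2*i) = v $ (2*i+1)" for i
  have z: "v $ (2*i) \<in> {0, 1}" "v $ (2*i+1) \<in> {0, 1}" if "i < 5" for i using True that by simp_all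
  have u: "v $ (2*i) + v $ (2*i+1) = 1 \<longleftrightarrow> \<not> u i" if "i < 5" for i
    using z[OF that] unfolding u_def by auto
  have e: "(transpose_mat R10 *\<^sub>v v) $ y = (v $ (2 * (y div 2)) + v $ (2 * (y div 2) + 1)
      + sg y * (v $ (2 * cyc (y div 2)) - v $ (2 * cyc (y div 2) + 1))) / 2" if "y < 10" for y
    unfolding R10_eq_switch by (rule switch_transpose_vec) (use True that in simp_all)
  have "(transpose_mat R10 *\<^sub>v v) $ y \<in> {0, 1} \<longleftrightarrow> u (cyc (y div 2)) = u (y div 2)" if y: "y < 10" for y
    unfolding e[OF y] u_def using z[of "y div 2"] z[of "cyc (y div 2)"] y by (auto simp: sg_def)
  then have "zero_one_vec (transpose_mat R10 *\<^sub>v v) \<longleftrightarrow> (\<forall>y<10. u (cyc (y div 2)) = u (y div 2))"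
    by (simp add: zero_one_vec_def R10_eq_switch)
  also have "\<dots> \<longleftrightarrow> (\<forall>i<5. u (cyc i) = u i)"
  proof safe
    fix i :: nat assume h: "\<forall>y<10. u (cyc (y div 2)) = u (y div 2)" and "i < 5"
    then show "u i" if "u (cyc i)" using that h[rule_format, of "2 * i"] by simp
    show "u (cyc i)" if "u i" using that h[rule_format, of "2 * i"] \<open>i < 5\<close> by simp
  qed auto
  also have "\<dots> \<longleftrightarrow> (\<forall>i<5. u i) \<or> (\<forall>i<5. \<not> u i)"
  proof
    assume h: "\<forall>i<5. u (cyc i) = u i"
    have "u i = u 0" if "i < 5" for i
      using h[rule_format, of 0] h[rule_format, of 1] h[rule_format, of 2] h[rule_format, of 3]
        less_5_cases[OF that] by (auto simp: cyc_values)
    then show "(\<forall>i<5. u i) \<or> (\<forall>i<5. \<not> u i)" by blast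
  qed auto
  finally show ?thesis using True u by (auto simp: VV_def zero_one_vec_def u_def)
next
  case False
  then show ?thesis by (auto simp: VV_def zero_one_vec_def)
qed

text \<open>Vectors in \<open>VV R10\<close> have the same type on all five blocks, so any sum may
  be combined with any difference. Hence only \<open>B\<close> restricts the choice of
  \<open>p\<close>.\<close>

lemma switch_transpose_VV:
  assumes v: "v \<in> VV R10" and p: "\<And>i. i < 5 \<Longrightarrow> p i < 5"
  shows "zero_one_vec (transpose_mat (switch p) *\<^sub>v v)"
proof -
  have vc: "v \<in> carrier_vec 10" and v01: "\<And>a. a < 10 \<Longrightarrow> v $ a \<in> {0, 1}"
    and vv: "(\<forall>i<5. v $ (2*i) = v $ (2*i+1)) \<or> (\<forall>i<5. v $ (2*i) + v $ (2*i+1) = 1)"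
    using v unfolding VV_R10_iff by blast+
  have "(transpose_mat (switch p) *\<^sub>v v) $ y \<in> {0, 1}" if y: "y < 10" for y
  proof -
    obtain i j where ij: "i = y div 2" "j = p (y div 2)" "i < 5" "j < 5" using y p by simp
    have z: "v $ (2*i) \<in> {0, 1}" "v $ (2*i+1) \<in> {0, 1}" "v $ (2*j) \<in> {0, 1}" "v $ (2*j+1) \<in> {0, 1}"
      using v01 ij by simp_all
    have "v $ (2*i) = v $ (2*i+1) \<and> v $ (2*j) = v $ (2*j+1) \<or> v $ (2*i) + v $ (2*i+1) = 1 \<and> v $ (2*j) + v $ (2*j+1) = 1"
      using vv ij by blast
    moreover have "(transpose_mat (switch p) *\<^sub>v v) $ y =
        (v $ (2*i) + v $ (2*i+1) + sg y * (v $ (2*j) - v $ (2*j+1))) / 2"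
      using switch_transpose_vec[of v p y] vc p y unfolding ij(1,2) by blast
    ultimately show ?thesis using z by (cases "even y") (auto simp: sg_def)
  qed
  then show ?thesis by (simp add: zero_one_vec_def)
qed

section \<open>Exhaustive search over the code lists\<close>

text \<open>Five pairs at cyclic distance one, then five at distance two, all oriented forward. A
  circulant thus yields two constant runs.\<close>

definition codes :: "rat mat \<Rightarrow> nat list" where
  "codes B = map (\<lambda>(i, j). code B i j)
     [(0,1), (1,2), (2,3), (3,4), (4,0), (0,2), (1,3), (2,4), (3,0), (4,1)]"

definition code_matrix :: "nat list \<Rightarrow> nat list list" where
  "code_matrix L =
    [[0, L ! 0, L ! 5, transp_code (L ! 8), transp_code (L ! 4)],
     [transp_code (L ! 0), 0, L ! 1, L ! 6, transp_code (L ! 9)],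
     [transp_code (L ! 5), transp_code (L ! 1), 0, L ! 2, L ! 7],
     [L ! 8, transp_code (L ! 6), transp_code (L ! 2), 0, L ! 3],
     [L ! 4, L ! 9, transp_code (L ! 7), transp_code (L ! 3), 0]]"

definition nth2 :: "'a list list \<Rightarrow> nat \<Rightarrow> nat \<Rightarrow> 'a" where
  "nth2 T i j = T ! i ! j"

definition table :: "nat list \<Rightarrow> nat \<Rightarrow> nat \<Rightarrow> nat" where
  "table L = nth2 (code_matrix L)"

text \<open>These are the code lists of the three representatives, see
  \<open>circulant_codes\<close>.\<close>

definition special_codes :: "nat list list" where
  "special_codes = [[0,0,0,0,0, 2,2,2,2,2], [3,3,3,3,3, 2,2,2,2,2], [2,2,2,2,2, 1,1,1,1,1]]"

text \<open>Tuples \<open>(p, q, I, K)\<close> with \<open>p \<circ> q = cyc\<close>, where \<open>p\<close> and \<open>q\<close> leave the proper subsets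
  \<open>I\<close> and \<open>K\<close> of the five blocks invariant, so that \<open>R10 = switch p * switch q\<close> with decomposable factors.
  The list was found by computer.\<close>

definition reductions :: "(nat list \<times> nat list \<times> nat list \<times> nat list) list" where
  "reductions =
    [([0,1,4,3,2], [1,4,3,2,0], [0], [2,3]),
     ([0,4,2,3,1], [4,2,3,1,0], [0], [0,4]),
     ([3,2,1,4,0], [2,1,0,3,4], [1,2], [1]),
     ([0,3,2,1,4], [3,2,1,4,0], [0], [1,2]),
     ([1,2,0,4,3], [0,1,4,3,2], [3,4], [0]),
     ([0,2,3,4,1], [4,1,2,3,0], [0], [1]),
     ([1,2,3,0,4], [0,1,2,4,3], [4], [0]),
     ([3,1,2,0,4], [1,2,0,4,3], [1], [3,4]),
     ([2,1,0,3,4], [1,0,3,4,2], [1], [0,1]),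
     ([0,2,1,4,3], [2,1,4,3,0], [0], [1]),
     ([1,0,2,3,4], [0,2,3,4,1], [2], [0]),
     ([0,1,3,4,2], [1,4,2,3,0], [0], [2]),
     ([0,4,3,2,1], [4,3,2,1,0], [0], [2]),
     ([0,2,3,1,4], [3,1,2,4,0], [0], [1]),
     ([0,2,4,3,1], [4,1,3,2,0], [0], [1]),
     ([0,3,2,4,1], [4,2,1,3,0], [0], [3])]"

definition invariant_blocks :: "nat list \<Rightarrow> nat list \<Rightarrow> bool" where
  "invariant_blocks p I \<longleftrightarrow> length p = 5 \<and> distinct p \<and> list_all (\<lambda>i. p ! i < 5) [0, 1, 2, 3, 4] \<and>
     list_all (\<lambda>i. i < 5) I \<and> I \<noteq> [] \<and> list_ex (\<lambda>i. i \<notin> set I) [0, 1, 2, 3, 4] \<and>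
     list_all (\<lambda>i. (p ! i \<in> set I) = (i \<in> set I)) [0, 1, 2, 3, 4]"

lemma reductions_correct:
  "list_all (\<lambda>(p, q, I, K). invariant_blocks p I \<and> invariant_blocks q K \<and>
     list_all (\<lambda>i. p ! (q ! i) = cyc i) [0, 1, 2, 3, 4]) reductions"
  by code_simp

text \<open>\<open>edge_ok e e' d\<close> collects conditions from \<open>allowed (table L) cyc\<close> that involve only the codes
  \<open>e\<close>, \<open>e'\<close>, \<open>d\<close> of the pairs \<open>(i, i + 1)\<close>, \<open>(i + 1, i + 2)\<close>, \<open>(i, i + 2)\<close>. Pruning by them leaves about
  3000 of the \<open>4^10\<close> code lists to be tested.\<close>

definition edge_ok :: "nat \<Rightarrow> nat \<Rightarrow> nat \<Rightarrow> bool" where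
  "edge_ok e e' d \<longleftrightarrow> (if d = 1 then e \<noteq> 0 \<and> e' \<noteq> 3
     else if d = 0 \<and> e' = 2 then False else (e' = 3) = (e \<noteq> 0))"

text \<open>The lookup in \<open>[1, 2, 3, 4, 0]\<close> is \<open>cyc\<close> on the five blocks,
  so the outer test is membership in \<open>BB R10\<close> at the level of codes.\<close>

definition leaf_ok :: "nat list \<Rightarrow> bool" where
  "leaf_ok L \<longleftrightarrow> (if allowed (table L) ((!) [1, 2, 3, 4, 0]) then
     (if L \<in> set special_codes then True else list_ex (\<lambda>(p, q, I, K). allowed (table L) ((!) p)) reductions) else True)"

text \<open>The length of the prefix tells which pair comes next. At cyclic neighbours
  \<open>row_ok\<close> excludes the code 1, whence the default \<open>[0,2,3]\<close>; a pair at
  distance two is filtered by the two neighbouring pairs that it spans.\<close>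

fun choices :: "nat list \<Rightarrow> nat list" where
  "choices [e0,e1,e2,e3,e4] = filter (edge_ok e0 e1) [0,1,2,3]"
| "choices [e0,e1,e2,e3,e4,d0] = filter (edge_ok e1 e2) [0,1,2,3]"
| "choices [e0,e1,e2,e3,e4,d0,d1] = filter (edge_ok e2 e3) [0,1,2,3]"
| "choices [e0,e1,e2,e3,e4,d0,d1,d2] = filter (edge_ok e3 e4) [0,1,2,3]"
| "choices [e0,e1,e2,e3,e4,d0,d1,d2,d3] = filter (edge_ok e4 e0) [0,1,2,3]"
| "choices L = [0,2,3]"

fun search :: "('a list \<Rightarrow> 'a list) \<Rightarrow> ('a list \<Rightarrow> bool) \<Rightarrow> nat \<Rightarrow> 'a list \<Rightarrow> bool"
  and search_list :: "('a list \<Rightarrow> 'a list) \<Rightarrow> ('a list \<Rightarrow> bool) \<Rightarrow> nat \<Rightarrow> 'a list \<Rightarrow> 'a list \<Rightarrow> bool" where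
  "search ch P 0 L = P L"
| "search ch P (Suc n) L = search_list ch P n L (ch L)"
| "search_list ch P n L [] = True"
| "search_list ch P n L (c # cs) = (if search ch P n (L @ [c]) then search_list ch P n L cs else False)"

lemma search_list_iff: "search_list ch P n L cs \<longleftrightarrow> (\<forall>c\<in>set cs. search ch P n (L @ [c]))"
  by (induction cs) auto

text \<open>The search is split by the first code, that of the neighbouring blocks 0 and 1; hence 1
  does not occur there.\<close>

lemma search_0: "search choices leaf_ok 9 [0]" by code_simp

lemma search_2: "search choices leaf_ok 9 [2]" by code_simp

lemma search_3: "search choices leaf_ok 9 [3]" by code_simp

lemma invariant_blocksD:
  assumes "invariant_blocks p I"
  shows "\<And>i. i < 5 \<Longrightarrow> p ! i < 5" "inj_on ((!) p) {..<5}" "decomposable 10 (switch ((!) p))"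
    "regular_orthogonal 10 (switch ((!) p))"
proof -
  have five: "(\<forall>i<5. P i) \<longleftrightarrow> list_all P [0, 1, 2, 3, 4]" for P :: "nat \<Rightarrow> bool"
    using less_5_cases by (auto simp: list_all_iff)
  have p: "length p = 5" "distinct p" "\<forall>i<5. p ! i < 5" and I: "list_all (\<lambda>i. i < 5) I" "I \<noteq> []"
    "list_ex (\<lambda>i. i \<notin> set I) [0, 1, 2, 3, 4]" and pI: "\<forall>i<5. (p ! i \<in> set I) = (i \<in> set I)"
    using assms unfolding invariant_blocks_def five by blast+
  show p5: "p ! i < 5" if "i < 5" for i using p(3) that by blast
  show inj: "inj_on ((!) p) {..<5}" using p(1,2) by (intro inj_onI) (simp add: nth_eq_iff_index_eq)
  show "regular_orthogonal 10 (switch ((!) p))" by (rule switch_regular_orthogonal[OF p5 inj])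
  obtain k where "k \<in> set [0, 1, 2, 3, 4]" "k \<notin> set I" using I(3) unfolding list_ex_iff by blast
  moreover from this(1) have "k < 5" by auto
  ultimately have "set I \<noteq> {..<5}" by blast
  moreover have "set I \<subseteq> {..<5}" "set I \<noteq> {}"
    using I(1,2) by (auto simp: list_all_iff)
  ultimately show "decomposable 10 (switch ((!) p))"
    using switch_decomposable[OF p5 inj, of "set I"] pI by blast
qed

lemma reducible_by_switch:
  assumes B: "even_blocks B" and p: "invariant_blocks p I" and q: "invariant_blocks q K"
    and pq: "\<And>i. i < 5 \<Longrightarrow> p ! (q ! i) = cyc i" and a: "allowed (code B) ((!) p)"
  shows "reducible_wrt R10 B"
proof -
  note pD = invariant_blocksD[OF p] and qD = invariant_blocksD[OF q]
  have "switch ((!) p) * switch ((!) q) = switch (\<lambda>i. p ! (q ! i))"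
    by (rule switch_mult[OF pD(1) qD(1)])
  also have "\<dots> = R10" unfolding R10_eq_switch switch_def col_mat_def
    by (rule cong_mat) (auto simp: pq)
  finally have R: "R10 = mat_list_prod 10 [switch ((!) p), switch ((!) q)]" by simp
  have pr: "preserves R10 B (switch ((!) p))"
    unfolding preserves_def R10_dim
    using switch_adjacency_iff[of B "(!) p"] B pD(1,2) a switch_transpose_VV[of _ "(!) p"] by blast
  show ?thesis
    unfolding reducible_wrt_iff[OF R10_carrier even_adjacency[OF B]]
  proof (intro exI[of _ "[switch ((!) p), switch ((!) q)]"] conjI ballI)
    fix i assume "i \<in> {1..<length [switch ((!) p), switch ((!) q)]}"
    then have "i = 1" by simp
    then show "preserves R10 B (mat_list_prod 10 (take i [switch ((!) p), switch ((!) q)]))"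
      using pr by simp
  qed (use R pD(3,4) qD(3,4) switch_level in auto)
qed

lemma allowed_cong:
  assumes "\<And>i j. i < 5 \<Longrightarrow> j < 5 \<Longrightarrow> t i j = t' i j" "\<And>i. i < 5 \<Longrightarrow> p i < 5" "\<And>i. i < 5 \<Longrightarrow> p' i = p i"
  shows "allowed t p = allowed t' p'"
proof -
  have "row_ok t p i = row_ok t' p' i" if "i < 5" for i
    unfolding row_ok_def assms(3)[OF that] assms(1)[OF assms(2)[OF that] that] ..
  moreover have "pair_ok t p i j = pair_ok t' p' i j" if ij: "i < 5" "j < 5" for i j
    unfolding pair_ok_def assms(3)[OF ij(1)] assms(3)[OF ij(2)] assms(1)[OF ij]
      assms(1)[OF assms(2)[OF ij(1)] ij(2)] assms(1)[OF assms(2)[OF ij(2)] ij(1)]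
      assms(1)[OF assms(2)[OF ij(1)] assms(2)[OF ij(2)]] ..
  ultimately show ?thesis unfolding allowed_def by simp
qed

lemma code_eq_table:
  assumes "even_blocks B" "i < 5" "j < 5"
  shows "code B i j = table (codes B) i j"
proof -
  have d: "code B k k = 0" for k by (simp add: code_def)
  note t = code_transpose[OF assms(1)]
  have "code B 0 4 = transp_code (code B 4 0)" "code B 1 0 = transp_code (code B 0 1)"
     "code B 2 1 = transp_code (code B 1 2)" "code B 3 2 = transp_code (code B 2 3)"
     "code B 4 3 = transp_code (code B 3 4)" "code B 2 0 = transp_code (code B 0 2)"
     "code B 3 1 = transp_code (code B 1 3)" "code B 4 2 = transp_code (code B 2 4)"
     "code B 0 3 = transp_code (code B 3 0)" "code B 1 4 = transp_code (code B 4 1)"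
    by (rule t; simp)+
  then show ?thesis using less_5_cases[OF assms(2)] less_5_cases[OF assms(3)]
    by (elim disjE; hypsubst) (simp_all add: table_def code_matrix_def nth2_def codes_def d)
qed

lemma search_step: "search ch P m L \<Longrightarrow> m = Suc n \<Longrightarrow> c \<in> set (ch L) \<Longrightarrow> search ch P n (L @ [c])"
  by (simp add: search_list_iff)

text \<open>For \<open>p = cyc\<close> and the pair \<open>(i, cyc i)\<close> the middle test of
  \<open>pair_ok\<close> falls on a diagonal block, whose code is 0. The rest involves only the
  three codes passed to \<open>edge_ok\<close>.\<close>

lemma edge_codes:
  assumes B: "even_blocks B" and a: "allowed (code B) cyc" and i: "i < 5"
  shows "code B i (cyc i) \<in> {0, 2, 3}"
    "edge_ok (code B i (cyc i)) (code B (cyc i) (cyc (cyc i))) (code B i (cyc (cyc i)))"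
    "code B i j \<in> {0, 1, 2, 3}"
proof -
  have d: "code B (cyc i) (cyc i) = 0" by (simp add: code_def)
  have t: "code B (cyc (cyc i)) i = transp_code (code B i (cyc (cyc i)))"
    "code B (cyc i) i = transp_code (code B i (cyc i))"
    by (rule code_transpose[OF B]; use i in simp)+
  show r: "code B i j \<in> {0, 1, 2, 3}" for j by (simp add: code_def)
  have r5: "row_ok (code B) cyc i" using a less_5_cases[OF i] unfolding allowed_def by auto
  have p1: "pair_ok (code B) cyc i (cyc i)" and p2: "pair_ok (code B) cyc i (cyc (cyc i))"
    using a less_5_cases[OF i] unfolding allowed_def by (auto simp: cyc_values)
  show "code B i (cyc i) \<in> {0, 2, 3}"
    using r5 r[of "cyc i"] unfolding row_ok_def t transp_code_def by auto
  \<comment> \<open>This comes from the pair at distance two: code 2 of the block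
    \<open>(cyc i, cyc (cyc i))\<close> leads into one of the first two branches of
    \<open>pair_ok\<close>, and both demand a non-zero code.\<close>
  have "code B i (cyc (cyc i)) \<noteq> 0" if "code B (cyc i) (cyc (cyc i)) = 2"
    using p2 that unfolding pair_ok_def by (auto split: if_splits)
  then show "edge_ok (code B i (cyc i)) (code B (cyc i) (cyc (cyc i))) (code B i (cyc (cyc i)))"
    using p1 r[of "cyc (cyc i)"] unfolding pair_ok_def edge_ok_def t d transp_code_def
    by (auto split: if_splits)
qed

declare search.simps [simp del]

lemma special_or_reducible:
  assumes B: "B \<in> BB R10"
  shows "codes B \<in> set special_codes \<or> reducible_wrt R10 B"
proof -
  have ev: "even_blocks B" and al: "allowed (code B) cyc" using B by (simp_all add: BB_iff)
  note ec = edge_codes[OF ev al]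
  obtain e0 e1 e2 e3 e4 d0 d1 d2 d3 d4 where c: "e0 = code B 0 1" "e1 = code B 1 2" "e2 = code B 2 3"
    "e3 = code B 3 4" "e4 = code B 4 0" "d0 = code B 0 2" "d1 = code B 1 3" "d2 = code B 2 4"
    "d3 = code B 3 0" "d4 = code B 4 1" by simp
  have e: "e0 \<in> {0,2,3}" "e1 \<in> {0,2,3}" "e2 \<in> {0,2,3}" "e3 \<in> {0,2,3}" "e4 \<in> {0,2,3}"
    using ec(1)[of 0] ec(1)[of 1] ec(1)[of 2] ec(1)[of 3] ec(1)[of 4] by (simp_all add: cyc_values c)
  have d: "d0 \<in> {0,1,2,3}" "d1 \<in> {0,1,2,3}" "d2 \<in> {0,1,2,3}" "d3 \<in> {0,1,2,3}" "d4 \<in> {0,1,2,3}"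
    unfolding c by (rule ec(3); simp)+
  have ed: "edge_ok e0 e1 d0" "edge_ok e1 e2 d1" "edge_ok e2 e3 d2" "edge_ok e3 e4 d3" "edge_ok e4 e0 d4"
    using ec(2)[of 0] ec(2)[of 1] ec(2)[of 2] ec(2)[of 3] ec(2)[of 4] by (simp_all add: cyc_values c)
  have L: "codes B = [e0,e1,e2,e3,e4,d0,d1,d2,d3,d4]" by (simp add: codes_def c)
  \<comment> \<open>From here on the codes of \<open>B\<close> are followed down one branch of the
    search tree, the facts \<open>e\<close>, \<open>d\<close> and \<open>ed\<close> showing that
    each code is among the choices.\<close>
  have s9: "search choices leaf_ok 9 [e0]" using e(1) search_0 search_2 search_3 by auto
  have "e1 \<in> set (choices [e0])" using e(2) by auto
  from search_step[OF s9 _ this, of 8] have s8: "search choices leaf_ok 8 [e0,e1]" by simp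
  have "e2 \<in> set (choices [e0,e1])" using e(3) by auto
  from search_step[OF s8 _ this, of 7] have s7: "search choices leaf_ok 7 [e0,e1,e2]" by simp
  have "e3 \<in> set (choices [e0,e1,e2])" using e(4) by auto
  from search_step[OF s7 _ this, of 6] have s6: "search choices leaf_ok 6 [e0,e1,e2,e3]" by simp
  have "e4 \<in> set (choices [e0,e1,e2,e3])" using e(5) by auto
  from search_step[OF s6 _ this, of 5] have s5: "search choices leaf_ok 5 [e0,e1,e2,e3,e4]" by simp
  have "d0 \<in> set (choices [e0,e1,e2,e3,e4])" using d(1) ed(1) by auto
  from search_step[OF s5 _ this, of 4] have s4: "search choices leaf_ok 4 [e0,e1,e2,e3,e4,d0]" by simp
  have "d1 \<in> set (choices [e0,e1,e2,e3,e4,d0])" using d(2) ed(2) by auto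
  from search_step[OF s4 _ this, of 3] have s3: "search choices leaf_ok 3 [e0,e1,e2,e3,e4,d0,d1]" by simp
  have "d2 \<in> set (choices [e0,e1,e2,e3,e4,d0,d1])" using d(3) ed(3) by auto
  from search_step[OF s3 _ this, of 2] have s2: "search choices leaf_ok 2 [e0,e1,e2,e3,e4,d0,d1,d2]" by simp
  have "d3 \<in> set (choices [e0,e1,e2,e3,e4,d0,d1,d2])" using d(4) ed(4) by auto
  from search_step[OF s2 _ this, of 1] have s1: "search choices leaf_ok 1 [e0,e1,e2,e3,e4,d0,d1,d2,d3]" by simp
  have "d4 \<in> set (choices [e0,e1,e2,e3,e4,d0,d1,d2,d3])" using d(5) ed(5) by auto
  from search_step[OF s1 _ this, of 0] have s0: "search choices leaf_ok 0 [e0,e1,e2,e3,e4,d0,d1,d2,d3,d4]" by simp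
  have leaf: "leaf_ok (codes B)" using s0 unfolding L search.simps(1) .
  have tab: "allowed (table (codes B)) p = allowed (code B) p" if "\<And>i. i < 5 \<Longrightarrow> p i < 5" for p
    by (rule allowed_cong) (use code_eq_table[OF ev] that in simp_all)
  have "[1, 2, 3, 4, 0] ! i = cyc i" if "i < 5" for i
    using less_5_cases[OF that] by (elim disjE) (simp_all add: cyc_values)
  then have "allowed (table (codes B)) ((!) [1, 2, 3, 4, 0])"
    using allowed_cong[of "code B" "table (codes B)" cyc "(!) [1, 2, 3, 4, 0]"] code_eq_table[OF ev] al by simp
  then consider "codes B \<in> set special_codes"
    | "list_ex (\<lambda>(p, q, I, K). allowed (table (codes B)) ((!) p)) reductions"
    using leaf unfolding leaf_ok_def by presburger
  then show ?thesis
  proof cases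
    case 2
    then obtain p q I K where r: "(p, q, I, K) \<in> set reductions" and ap: "allowed (table (codes B)) ((!) p)"
      by (auto simp: list_ex_iff)
    have c: "invariant_blocks p I" "invariant_blocks q K" "list_all (\<lambda>i. p ! (q ! i) = cyc i) [0, 1, 2, 3, 4]"
      using reductions_correct r unfolding list_all_iff by fastforce+
    have pq: "p ! (q ! i) = cyc i" if "i < 5" for i
      using c(3) less_5_cases[OF that] by (elim disjE) simp_all
    have "allowed (code B) ((!) p)" using tab[of "(!) p"] invariant_blocksD(1)[OF c(1)] ap by blast
    then show ?thesis using reducible_by_switch[OF ev c(1,2) pq] by blast
  qed simp
qed

section \<open>Irreducible matrices\<close>

text \<open>A consequence of decomposability in which properness is asked of the row set alone. In
  this form it passes easily through a permutation of the rows and a relabelling of the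
  columns.\<close>

definition row_split :: "nat \<Rightarrow> rat mat \<Rightarrow> bool" where
  "row_split n M \<longleftrightarrow> (\<exists>X Y. X \<subseteq> {..<n} \<and> X \<noteq> {} \<and> X \<noteq> {..<n} \<and>
     (\<forall>a<n. \<forall>b<n. M $$ (a, b) \<noteq> 0 \<longrightarrow> (a \<in> X \<longleftrightarrow> b \<in> Y)))"

lemma decomposable_imp_row_split:
  assumes "M \<in> carrier_mat n n" "decomposable n M"
  shows "row_split n M"
  using decomposable_imp_split_by[OF assms] unfolding split_by_def row_split_def by metis

lemma regular_orthogonal_mult:
  assumes A: "regular_orthogonal n A" and B: "regular_orthogonal n B"
  shows "regular_orthogonal n (A * B)"
proof -
  have Ac: "A \<in> carrier_mat n n" and Bc: "B \<in> carrier_mat n n"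
    and Ao: "transpose_mat A * A = 1\<^sub>m n" and Bo: "transpose_mat B * B = 1\<^sub>m n"
    and As: "\<And>i. i < n \<Longrightarrow> (\<Sum>j<n. A $$ (i, j)) = 1" and Bs: "\<And>i. i < n \<Longrightarrow> (\<Sum>j<n. B $$ (i, j)) = 1"
    using A B by (simp_all add: regular_orthogonal_def)
  have At: "transpose_mat A \<in> carrier_mat n n" and Bt: "transpose_mat B \<in> carrier_mat n n"
    and AB: "A * B \<in> carrier_mat n n" using Ac Bc by auto
  have "transpose_mat (A * B) * (A * B) = transpose_mat B * (transpose_mat A * (A * B))"
    unfolding transpose_mult[OF Ac Bc] by (rule assoc_mult_mat[OF Bt At AB])
  also have "transpose_mat A * (A * B) = (transpose_mat A * A) * B"
    by (rule assoc_mult_mat[OF At Ac Bc, symmetric])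
  finally have o: "transpose_mat (A * B) * (A * B) = 1\<^sub>m n" using Ao Bo Bc by simp
  have "(\<Sum>j<n. (A * B) $$ (i, j)) = 1" if i: "i < n" for i
  proof -
    have "(\<Sum>j<n. (A * B) $$ (i, j)) = (\<Sum>j<n. \<Sum>l<n. A $$ (i, l) * B $$ (l, j))"
      by (rule sum.cong) (simp_all add: mult_mat_entry[OF Ac Bc i] lessThan_atLeast0)
    also have "\<dots> = (\<Sum>l<n. A $$ (i, l) * (\<Sum>j<n. B $$ (l, j)))"
      by (subst sum.swap) (simp add: sum_distrib_left)
    also have "\<dots> = 1" using Bs As[OF i] by simp
    finally show ?thesis .
  qed
  moreover have "A * B * transpose_mat (A * B) = 1\<^sub>m n"
    by (rule mat_mult_left_right_inverse[OF _ AB o]) (use AB in simp)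
  ultimately show ?thesis using AB o unfolding regular_orthogonal_def by blast
qed

lemma regular_orthogonal_one: "regular_orthogonal n (1\<^sub>m n)"
  unfolding regular_orthogonal_def by simp

text \<open>If \<open>S\<close> fixes the all-ones vector, then so does its transpose, which is its
  inverse.\<close>

lemma regular_orthogonal_col_sum:
  assumes S: "regular_orthogonal n S" and y: "y < n"
  shows "(\<Sum>a<n. S $$ (a, y)) = 1"
proof -
  have Sc: "S \<in> carrier_mat n n" and So: "transpose_mat S * S = 1\<^sub>m n"
    and Ss: "\<And>i. i < n \<Longrightarrow> (\<Sum>j<n. S $$ (i, j)) = 1"
    using S by (simp_all add: regular_orthogonal_def)
  have St: "transpose_mat S \<in> carrier_mat n n" using Sc by simp
  have e: "(\<Sum>a<n. S $$ (a, y) * S $$ (a, z)) = (if y = z then 1 else 0)" if "z < n" for z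
  proof -
    have "(transpose_mat S * S) $$ (y, z) = (\<Sum>a<n. S $$ (a, y) * S $$ (a, z))"
      unfolding mult_mat_entry[OF St Sc y that] lessThan_atLeast0 by (rule sum.cong) (use Sc y in auto)
    then show ?thesis using So y that by simp
  qed
  have "(\<Sum>a<n. S $$ (a, y)) = (\<Sum>a<n. \<Sum>z<n. S $$ (a, y) * S $$ (a, z))"
    by (rule sum.cong) (simp_all add: Ss flip: sum_distrib_left)
  also have "\<dots> = (\<Sum>z<n. if y = z then 1 else 0)"
    by (subst sum.swap) (simp add: e)
  finally show ?thesis using y by simp
qed

lemma regular_orthogonal_row_inner:
  assumes S: "regular_orthogonal n S" and ab: "a < n" "b < n"
  shows "(\<Sum>y<n. S $$ (a, y) * S $$ (b, y)) = (if a = b then 1 else 0)"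
proof -
  have Sc: "S \<in> carrier_mat n n" and So: "S * transpose_mat S = 1\<^sub>m n"
    using S by (simp_all add: regular_orthogonal_def)
  have St: "transpose_mat S \<in> carrier_mat n n" using Sc by simp
  have "(S * transpose_mat S) $$ (a, b) = (\<Sum>y<n. S $$ (a, y) * S $$ (b, y))"
    unfolding mult_mat_entry[OF Sc St ab] lessThan_atLeast0 by (rule sum.cong) (use Sc ab in auto)
  then show ?thesis using So ab by simp
qed

lemma sum_zero_one_eq_1:
  fixes f :: "'a \<Rightarrow> rat"
  assumes "finite A" "\<And>x. x \<in> A \<Longrightarrow> f x \<in> {0, 1}" "sum f A = 1"
  obtains x where "x \<in> A" "f x = 1" "\<And>z. z \<in> A \<Longrightarrow> z \<noteq> x \<Longrightarrow> f z = 0"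
proof -
  obtain x where x: "x \<in> A" "f x = 1"
    using assms(2,3) sum.neutral[of A f] by fastforce
  have "sum f A = f x + sum f (A - {x})" by (rule sum.remove[OF assms(1) x(1)])
  then have "sum f (A - {x}) = 0" using x assms(3) by simp
  moreover have "0 \<le> f z" if "z \<in> A - {x}" for z using assms(2)[of z] that by auto
  ultimately have "\<forall>z\<in>A - {x}. f z = 0" using sum_nonneg_eq_0_iff[of "A - {x}" f] assms(1) by simp
  then show ?thesis using that[OF x] by blast
qed

section \<open>Matrices that send \<open>VV R10\<close> to 0/1-vectors\<close>

context
  fixes S :: "rat mat"
  assumes S: "regular_orthogonal 10 S"
    and S_VV: "\<And>v. v \<in> VV R10 \<Longrightarrow> zero_one_vec (transpose_mat S *\<^sub>v v)"
begin

lemma S_carrier: "S \<in> carrier_mat 10 10" using S by (simp add: regular_orthogonal_def)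

lemma S_transpose_vec_entry:
  assumes v: "v \<in> VV R10" and y: "y < 10"
  shows "(\<Sum>i<5. S $$ (2*i, y) * v $ (2*i) + S $$ (2*i+1, y) * v $ (2*i+1)) \<in> {0, 1}"
proof -
  have vc: "v \<in> carrier_vec 10" using v by (simp add: VV_R10_iff)
  have "(transpose_mat S *\<^sub>v v) $ y = (\<Sum>a = 0..<10. S $$ (a, y) * v $ a)"
    using S_carrier vc y by (simp add: scalar_prod_def)
  moreover have "(transpose_mat S *\<^sub>v v) $ y \<in> {0, 1}"
    using S_VV[OF v] S_carrier y by (auto simp: zero_one_vec_def)
  ultimately show ?thesis by (simp only: sum_pairs)
qed

text \<open>Indicators of blocks show that the block sums \<open>h i\<close> of a column are 0 or 1;
  their total is 1, so exactly one is non-zero. A choice of one index per block shows that every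
  signed sum of the block differences \<open>g i\<close> is 1 or -1. With all signs chosen
  favourably the absolute values add up to 1, and each of them is 0 or 1, so exactly one difference
  is non-zero.\<close>

lemma column_structure:
  assumes y: "y < 10"
  shows "\<exists>i j e. i < 5 \<and> j < 5 \<and> e \<in> {1, -1} \<and>
    (\<forall>a<10. S $$ (a, y) = ((if a div 2 = i then 1 else 0) + (if a div 2 = j then sg a * e else 0)) / 2)"
proof -
  define h g where "h i = S $$ (2*i, y) + S $$ (2*i+1, y)" and "g i = S $$ (2*i, y) - S $$ (2*i+1, y)" for i
  have hz: "h i \<in> {0, 1}" if i: "i < 5" for i
  proof -
    let ?v = "vec 10 (\<lambda>a. if a div 2 = i then 1 else 0) :: rat vec"
    have v: "?v \<in> VV R10" by (auto simp: VV_R10_iff)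
    have "(\<Sum>k<5. S $$ (2*k, y) * ?v $ (2*k) + S $$ (2*k+1, y) * ?v $ (2*k+1)) = (\<Sum>k<5. if k = i then h k else 0)"
      by (rule sum.cong) (auto simp: h_def)
    then show ?thesis using S_transpose_vec_entry[OF v y] i by simp
  qed
  have hsum: "(\<Sum>i<5. h i) = 1"
    using regular_orthogonal_col_sum[OF S y] unfolding h_def lessThan_atLeast0[of 10] sum_pairs .
  obtain i where i: "i < 5" "h i = 1" "\<And>k. k < 5 \<Longrightarrow> k \<noteq> i \<Longrightarrow> h k = 0"
    using sum_zero_one_eq_1[of "{..<5}" h] hz hsum by auto
  define T where "T c = (\<Sum>i<5. if c i then g i else - g i)" for c :: "nat \<Rightarrow> bool"
  have T: "T c \<in> {1, -1}" for c
  proof -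
    let ?v = "vec 10 (\<lambda>a. if even a = c (a div 2) then 1 else 0) :: rat vec"
    have v: "?v \<in> VV R10" by (auto simp: VV_R10_iff)
    have "(\<Sum>k<5. S $$ (2*k, y) * ?v $ (2*k) + S $$ (2*k+1, y) * ?v $ (2*k+1))
        = (\<Sum>k<5. (h k + (if c k then g k else - g k)) / 2)"
      by (rule sum.cong) (auto simp: h_def g_def field_simps)
    also have "\<dots> = (1 + T c) / 2"
      unfolding T_def sum_divide_distrib[symmetric] sum.distrib hsum ..
    finally show ?thesis using S_transpose_vec_entry[OF v y] by auto
  qed
  \<comment> \<open>Changing the sign of \<open>g k\<close> alone moves the signed sum from one
    element of \<open>{1, -1}\<close> to another, so \<open>2 * g k\<close> is 0, 2 or -2.\<close>
  have gz: "\<bar>g k\<bar> \<in> {0, 1}" if k: "k < 5" for k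
  proof -
    define r where "r = (\<Sum>i\<in>{..<5}-{k}. g i)"
    have "T (\<lambda>_. True) = g k + r"
      unfolding T_def r_def by (subst sum.remove[of _ k]) (use k in auto)
    moreover have "T (\<lambda>i. i \<noteq> k) = - g k + r"
      unfolding T_def r_def by (subst sum.remove[of _ k]) (use k in \<open>auto intro!: sum.cong\<close>)
    ultimately show ?thesis using T[of "\<lambda>_. True"] T[of "\<lambda>i. i \<noteq> k"] by auto
  qed
  have "T (\<lambda>i. g i \<ge> 0) = (\<Sum>i<5. \<bar>g i\<bar>)" unfolding T_def by (rule sum.cong) auto
  moreover have "(\<Sum>i<5. \<bar>g i\<bar>) \<ge> 0" by (rule sum_nonneg) simp
  ultimately have "(\<Sum>i<5. \<bar>g i\<bar>) = 1"
    using T[of "\<lambda>i. g i \<ge> 0"] by (elim insertE emptyE) linarith+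
  then obtain j where j: "j < 5" "\<bar>g j\<bar> = 1" "\<And>k. k < 5 \<Longrightarrow> k \<noteq> j \<Longrightarrow> \<bar>g k\<bar> = 0"
    using sum_zero_one_eq_1[of "{..<5}" "\<lambda>i. \<bar>g i\<bar>"] gz by auto
  have "S $$ (a, y) = (h (a div 2) + sg a * g (a div 2)) / 2" for a
  proof (cases "even a")
    case True
    then have "2 * (a div 2) = a" by simp
    then show ?thesis using True by (simp add: h_def g_def sg_def)
  next
    case False
    then have "2 * (a div 2) + 1 = a" by simp
    then show ?thesis using False unfolding h_def g_def sg_def by simp
  qed
  note Sa = this
  obtain e where e: "e = g j" by simp
  have hg: "h k = (if k = i then 1 else 0)" "g k = (if k = j then e else 0)" if "k < 5" for k
    using i j that unfolding e by auto
  have "S $$ (a, y) = ((if a div 2 = i then 1 else 0) + (if a div 2 = j then sg a * e else 0)) / 2"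
    if a: "a < 10" for a
  proof -
    have "sg a * (if a div 2 = j then e else 0) = (if a div 2 = j then sg a * e else 0)" by simp
    then show ?thesis unfolding Sa[of a] hg[OF div2_less[OF a]] by (rule arg_cong)
  qed
  moreover have "e \<in> {1, -1}" using j(2) unfolding e by auto
  ultimately show ?thesis using i(1) j(1) by blast
qed

text \<open>Orthonormal rows have sums and differences over a block of squared norm 2, so each block
  occurs twice as an \<open>\<alpha>\<close> and twice as a \<open>\<beta>\<close>. Orthogonality of
  a row sum to a row difference (\<open>fa\<close>) makes the signs cancel whenever both
  \<open>\<alpha>\<close> and \<open>\<beta>\<close> are prescribed. So the two columns with
  \<open>\<alpha> y = i\<close> share their \<open>\<beta>\<close>, which defines
  \<open>p i\<close>, and carry opposite signs; \<open>u\<close> puts them at the two positions of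
  block \<open>i\<close>.\<close>

lemma switch_normal_form:
  obtains p u where "\<And>i. i < 5 \<Longrightarrow> p i < 5" "inj_on p {..<5}" "\<And>y. y < 10 \<Longrightarrow> u y < (10::nat)"
    "\<And>z. z < 10 \<Longrightarrow> \<exists>y<10. u y = z" "\<And>a y. a < 10 \<Longrightarrow> y < 10 \<Longrightarrow> S $$ (a, u y) = switch p $$ (a, y)"
proof -
  define Q where "Q y i j e \<longleftrightarrow> y < 10 \<longrightarrow> i < 5 \<and> j < 5 \<and> e \<in> {1, -1} \<and>
    (\<forall>a<10. S $$ (a, y) = ((if a div 2 = i then 1 else 0) + (if a div 2 = j then sg a * e else 0)) / 2)"
    for y i j and e :: rat
  have "\<exists>i j e. Q y i j e" for y
    by (cases "y < 10") (use column_structure[of y] in \<open>simp_all only: Q_def simp_thms\<close>)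
  then have "\<forall>y. \<exists>i j e. Q y i j e" by (rule allI)
  then obtain \<alpha> where "\<forall>y. \<exists>j e. Q y (\<alpha> y) j e" by (rule choice[THEN exE])
  then obtain \<beta> where "\<forall>y. \<exists>e. Q y (\<alpha> y) (\<beta> y) e" by (rule choice[THEN exE])
  then obtain \<epsilon> where Q: "\<forall>y. Q y (\<alpha> y) (\<beta> y) (\<epsilon> y)" by (rule choice[THEN exE])
  have en: "S $$ (a, y) = ((if a div 2 = \<alpha> y then 1 else 0) + (if a div 2 = \<beta> y then sg a * \<epsilon> y else 0)) / 2"
    if "y < 10" "a < 10" for a y using Q[rule_format, of y] that unfolding Q_def by blast
  have ab: "\<alpha> y < 5" "\<beta> y < 5" "\<epsilon> y \<in> {1, -1}" if "y < 10" for y using Q[rule_format, of y] that unfolding Q_def by blast+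
  have hg: "S $$ (2*i, y) + S $$ (2*i+1, y) = (if \<alpha> y = i then 1 else 0)"
    "S $$ (2*i, y) - S $$ (2*i+1, y) = (if \<beta> y = i then \<epsilon> y else 0)" if "y < 10" "i < 5" for i y
  proof -
    have a: "2*i < 10" "2*i+1 < 10" using that(2) by simp_all
    have sgs: "sg (2*i) = 1" "sg (2*i+1) = -1" "2*i div 2 = i" "(2*i+1) div 2 = i" by (simp_all add: sg_def)
    show "S $$ (2*i, y) + S $$ (2*i+1, y) = (if \<alpha> y = i then 1 else 0)"
      "S $$ (2*i, y) - S $$ (2*i+1, y) = (if \<beta> y = i then \<epsilon> y else 0)"
      unfolding en[OF that(1) a(1)] en[OF that(1) a(2)] sgs by (auto simp: field_simps)
  qed
  define D where "D a b = (\<Sum>y<10. S $$ (a, y) * S $$ (b, y))" for a b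
  have D: "D a b = (if a = b then 1 else 0)" if "a < 10" "b < 10" for a b
    unfolding D_def by (rule regular_orthogonal_row_inner[OF S that])
  have fa: "(\<Sum>y<10. if \<alpha> y = i then (if \<beta> y = j then \<epsilon> y else 0) else 0) = 0" if ij: "i < 5" "j < 5" for i j
  proof -
    have "(\<Sum>y<10. if \<alpha> y = i then (if \<beta> y = j then \<epsilon> y else 0) else 0) =
      (\<Sum>y<10. (S $$ (2*i, y) + S $$ (2*i+1, y)) * (S $$ (2*j, y) - S $$ (2*j+1, y)))"
      by (rule sum.cong) (simp_all only: hg ij lessThan_iff, simp)
    also have "\<dots> = D (2*i) (2*j) - D (2*i) (2*j+1) + D (2*i+1) (2*j) - D (2*i+1) (2*j+1)"
      unfolding D_def sum.distrib[symmetric] sum_subtractf[symmetric] by (simp add: algebra_simps)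
    also have "\<dots> = 0" using ij by (simp add: D Suc_double_not_eq_double double_not_eq_Suc_double)
    finally show ?thesis .
  qed
  have ca: "card {y. y < 10 \<and> \<alpha> y = i} = 2" if i: "i < 5" for i
  proof -
    have "(\<Sum>y<10. if \<alpha> y = i then 1 else (0::rat)) =
      (\<Sum>y<10. (S $$ (2*i, y) + S $$ (2*i+1, y)) * (S $$ (2*i, y) + S $$ (2*i+1, y)))"
      by (rule sum.cong) (simp_all only: hg i lessThan_iff, simp)
    also have "\<dots> = D (2*i) (2*i) + D (2*i) (2*i+1) + D (2*i+1) (2*i) + D (2*i+1) (2*i+1)"
      unfolding D_def sum.distrib[symmetric] by (simp add: algebra_simps)
    also have "\<dots> = 2" using i by (simp add: D Suc_double_not_eq_double double_not_eq_Suc_double)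
    finally have "(\<Sum>y<10. if \<alpha> y = i then 1 else (0::rat)) = 2" .
    moreover have "(\<Sum>y<10. if \<alpha> y = i then 1 else (0::rat)) = of_nat (card {y. y < 10 \<and> \<alpha> y = i})"
      by (simp add: sum.If_cases lessThan_def Int_def)
    ultimately show ?thesis by simp
  qed
  have cb: "card {y. y < 10 \<and> \<beta> y = i} = 2" if i: "i < 5" for i
  proof -
    have "(\<Sum>y<10. if \<beta> y = i then 1 else (0::rat)) =
      (\<Sum>y<10. (S $$ (2*i, y) - S $$ (2*i+1, y)) * (S $$ (2*i, y) - S $$ (2*i+1, y)))"
    proof (rule sum.cong)
      fix y :: nat assume "y \<in> {..<10}"
      then have y: "y < 10" by simp
      show "(if \<beta> y = i then 1 else 0) = (S $$ (2*i, y) - S $$ (2*i+1, y)) * (S $$ (2*i, y) - S $$ (2*i+1, y))"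
        unfolding hg(2)[OF y i] using ab(3)[OF y] by auto
    qed simp
    also have "\<dots> = D (2*i) (2*i) - D (2*i) (2*i+1) - D (2*i+1) (2*i) + D (2*i+1) (2*i+1)"
      unfolding D_def sum.distrib[symmetric] sum_subtractf[symmetric] by (simp add: algebra_simps)
    also have "\<dots> = 2" using i by (simp add: D Suc_double_not_eq_double double_not_eq_Suc_double)
    finally have "(\<Sum>y<10. if \<beta> y = i then 1 else (0::rat)) = 2" .
    moreover have "(\<Sum>y<10. if \<beta> y = i then 1 else (0::rat)) = of_nat (card {y. y < 10 \<and> \<beta> y = i})"
      by (simp add: sum.If_cases lessThan_def Int_def)
    ultimately show ?thesis by simp
  qed
  have ex: "\<exists>y y'. {z. z < 10 \<and> \<alpha> z = i} = {y, y'} \<and> \<beta> y' = \<beta> y \<and> \<epsilon> y = 1 \<and> \<epsilon> y' = -1" if i: "i < 5" for i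
  proof -
    obtain y y' where yy: "{z. z < 10 \<and> \<alpha> z = i} = {y, y'}" "y \<noteq> y'"
      using ca[OF i] unfolding card_2_iff by blast
    have yl: "y < 10" "\<alpha> y = i" "y' < 10" "\<alpha> y' = i" using yy(1) by blast+
    have "(\<Sum>z<10. if \<alpha> z = i then (if \<beta> z = \<beta> y then \<epsilon> z else 0) else 0)
        = (\<Sum>z\<in>{z. z < 10 \<and> \<alpha> z = i}. if \<beta> z = \<beta> y then \<epsilon> z else 0)"
      by (simp add: sum.If_cases lessThan_def Int_def)
    also have "\<dots> = \<epsilon> y + (if \<beta> y' = \<beta> y then \<epsilon> y' else 0)" unfolding yy(1) using yy(2) by simp
    finally have "\<epsilon> y + (if \<beta> y' = \<beta> y then \<epsilon> y' else 0) = 0" using fa[OF i ab(2)[OF yl(1)]] by simp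
    then have s: "\<beta> y' = \<beta> y" "\<epsilon> y' = - \<epsilon> y" using ab(3)[OF yl(1)] by (auto split: if_splits)
    show ?thesis
    proof (cases "\<epsilon> y = 1")
      case True
      moreover have "\<epsilon> y' = -1" using s(2) True by simp
      ultimately show ?thesis using yy(1) s(1) by blast
    next
      case False
      then have "\<epsilon> y' = 1" "\<epsilon> y = -1" using s ab(3)[OF yl(1)] by auto
      moreover have "{z. z < 10 \<and> \<alpha> z = i} = {y', y}" unfolding yy(1) by (rule insert_commute)
      ultimately show ?thesis using s(1)[symmetric] by blast
    qed
  qed
  define F where "F i y y' \<longleftrightarrow> {z. z < 10 \<and> \<alpha> z = i} = {y, y'} \<and> \<beta> y' = \<beta> y \<and> \<epsilon> y = 1 \<and> \<epsilon> y' = -1"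
    for i y y'
  have "\<forall>i. \<exists>y y'. i < 5 \<longrightarrow> F i y y'" unfolding F_def using ex by blast
  then obtain Y where "\<forall>i. \<exists>y'. i < 5 \<longrightarrow> F i (Y i) y'" by (rule choice[THEN exE])
  then obtain Y' where "\<forall>i. i < 5 \<longrightarrow> F i (Y i) (Y' i)" by (rule choice[THEN exE])
  then have Y: "{z. z < 10 \<and> \<alpha> z = i} = {Y i, Y' i} \<and> \<beta> (Y' i) = \<beta> (Y i) \<and>
      \<epsilon> (Y i) = 1 \<and> \<epsilon> (Y' i) = -1" if "i < 5" for i
    using that unfolding F_def by blast
  define p where "p i = \<beta> (Y i)" for i
  have Yl: "Y i < 10" "Y' i < 10" "\<alpha> (Y i) = i" "\<alpha> (Y' i) = i" "\<beta> (Y i) = p i" "\<beta> (Y' i) = p i"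
    "\<epsilon> (Y i) = 1" "\<epsilon> (Y' i) = -1" if "i < 5" for i
    using Y[OF that] unfolding p_def by blast+
  have p5: "p i < 5" if "i < 5" for i using ab(2)[OF Yl(1)[OF that]] by (simp add: p_def)
  have pinj: "inj_on p {..<5}"
  proof (rule inj_onI, rule ccontr)
    fix i j assume "i \<in> {..<5}" "j \<in> {..<5}" and eq: "p i = p j" and ne: "i \<noteq> j"
    then have ij: "i < 5" "j < 5" by simp_all
    \<comment> \<open>Three different columns with the same \<open>\<beta>\<close> would exceed the
      count \<open>cb\<close>.\<close>
    have "{Y i, Y' i, Y j} \<subseteq> {y. y < 10 \<and> \<beta> y = p i}" using Yl[OF ij(1)] Yl[OF ij(2)] eq by auto
    then have "card {Y i, Y' i, Y j} \<le> 2" using card_mono[of "{y. y < 10 \<and> \<beta> y = p i}"] cb[OF p5[OF ij(1)]] by simp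
    moreover have "Y i \<noteq> Y' i" using Yl(7,8)[OF ij(1)] by auto
    moreover have "Y i \<noteq> Y j" "Y' i \<noteq> Y j" using Yl(3,4)[OF ij(1)] Yl(3)[OF ij(2)] ne by auto
    ultimately show False by simp
  qed
  define u where "u y = (if even y then Y (y div 2) else Y' (y div 2))" for y
  have u: "u y < 10" "\<alpha> (u y) = y div 2" "\<beta> (u y) = p (y div 2)" "\<epsilon> (u y) = sg y" if "y < 10" for y
    using Yl[of "y div 2"] that by (simp_all add: u_def sg_def)
  have "\<exists>y<10. u y = z" if z: "z < 10" for z
  proof -
    have a: "\<alpha> z < 5" by (rule ab(1)[OF z])
    have "z = Y (\<alpha> z) \<or> z = Y' (\<alpha> z)" using Y[OF a] z by blast
    then have "u (2 * \<alpha> z) = z \<or> u (2 * \<alpha> z + 1) = z" by (auto simp: u_def)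
    moreover have "2 * \<alpha> z < 10" "2 * \<alpha> z + 1 < 10" using a by simp_all
    ultimately show ?thesis by blast
  qed
  moreover have "S $$ (a, u y) = switch p $$ (a, y)" if "a < 10" "y < 10" for a y
    unfolding en[OF u(1)[OF that(2)] that(1)] u(2-4)[OF that(2)] switch_entry[OF that] ..
  ultimately show ?thesis using that[of p u] p5 pinj u(1) by blast
qed

lemma switch_normal_form_adjacency:
  assumes u: "\<And>y. y < 10 \<Longrightarrow> u y < 10" and e: "\<And>a y. a < 10 \<Longrightarrow> y < 10 \<Longrightarrow> S $$ (a, u y) = switch p $$ (a, y)"
    and B: "B \<in> carrier_mat 10 10" and A: "adjacency_mat 10 (transpose_mat S * B * S)"
  shows "adjacency_mat 10 (transpose_mat (switch p) * B * switch p)"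
proof -
  have eq: "(transpose_mat (switch p) * B * switch p) $$ (y, z) = (transpose_mat S * B * S) $$ (u y, u z)"
    if yz: "y < 10" "z < 10" for y z
    unfolding congruence_entry[OF switch_carrier B yz] congruence_entry[OF S_carrier B u[OF yz(1)] u[OF yz(2)]]
    by (intro sum.cong refl arg_cong2[where f = "(*)"]) (simp_all add: e yz)
  have "transpose_mat (switch p) * B * switch p \<in> carrier_mat 10 10"
    using carrier_matD[OF B] by (intro carrier_matI) simp_all
  then show ?thesis using A u unfolding adjacency_mat_iff by (simp add: eq del: index_mult_mat)
qed

end

text \<open>Column \<open>2 * i\<close> has all rows of the blocks \<open>i\<close> and
  \<open>cyc i\<close> in its support, so \<open>X\<close> contains all of these rows or none. Going
  around the cycle makes \<open>X\<close> trivial.\<close>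

lemma R10_not_row_split: "\<not> row_split 10 R10"
proof
  assume "row_split 10 R10"
  then obtain X Y where X: "X \<subseteq> {..<10}" "X \<noteq> {}" "X \<noteq> {..<10}"
    and XY: "\<And>a b. a < 10 \<Longrightarrow> b < 10 \<Longrightarrow> R10 $$ (a, b) \<noteq> 0 \<Longrightarrow> a \<in> X \<longleftrightarrow> b \<in> Y"
    unfolding row_split_def by blast
  have nz: "R10 $$ (a, b) \<noteq> 0" if "a < 10" "b < 10" "a div 2 = b div 2 \<or> a div 2 = cyc (b div 2)" for a b
    using that cyc_neq[of "b div 2"] by (auto simp: R10_eq_switch switch_entry sg_def)
  have st: "a \<in> X \<longleftrightarrow> a' \<in> X"
    if "a < 10" "a' < 10" "i < 5" "a div 2 \<in> {i, cyc i}" "a' div 2 \<in> {i, cyc i}" for a a' i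
    using XY[of a "2 * i"] XY[of a' "2 * i"] nz[of a "2 * i"] nz[of a' "2 * i"] that by auto
  have "a \<in> X \<longleftrightarrow> 0 \<in> X" if a: "a < 10" for a
  proof -
    have "a \<in> X \<longleftrightarrow> 2 * (a div 2) \<in> X" using st[of a "2 * (a div 2)" "a div 2"] a by simp
    moreover have "0 \<in> X \<longleftrightarrow> 2 \<in> X" "2 \<in> X \<longleftrightarrow> 4 \<in> X" "4 \<in> X \<longleftrightarrow> 6 \<in> X" "6 \<in> X \<longleftrightarrow> 8 \<in> X"
      by (rule st[of 0 2 0] st[of 2 4 1] st[of 4 6 2] st[of 6 8 3]; simp add: cyc_def)+
    ultimately show ?thesis using less_5_cases[OF div2_less[OF a]] by (elim disjE) simp_all
  qed
  then show False using X by blast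
qed

section \<open>Irreducibility of the three patterns\<close>

definition unused :: "nat list \<Rightarrow> nat list" where
  "unused p = filter (\<lambda>c. c \<notin> set p) [0, 1, 2, 3, 4]"

definition cyclic_if_allowed :: "nat list \<Rightarrow> bool" where
  "cyclic_if_allowed p \<longleftrightarrow> list_all (\<lambda>L. if allowed (table L) ((!) p)
     then p = [0, 1, 2, 3, 4] \<or> p = [1, 2, 3, 4, 0] else True) special_codes"

text \<open>The search runs through the 120 permutations of the blocks, written as lists of values,
  and tests each against all three patterns.\<close>

lemma special_stabilizers: "search unused cyclic_if_allowed 5 []"
  by code_simp

lemma special_allowed:
  assumes B: "even_blocks B" and L: "codes B \<in> set special_codes"
    and p: "\<And>i. i < 5 \<Longrightarrow> p i < 5" and inj: "inj_on p {..<5}" and a: "allowed (code B) p"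
  shows "(\<forall>i<5. p i = i) \<or> (\<forall>i<5. p i = cyc i)"
proof -
  define P where "P = map p [0, 1, 2, 3, 4]"
  have P: "P ! i = p i" if "i < 5" for i
    using less_5_cases[OF that] unfolding P_def by (elim disjE) simp_all
  have "p i \<in> {0, 1, 2, 3, 4}" if "i < 5" for i using less_5_cases[OF p[OF that]] by auto
  then have m: "p 0 \<in> {0, 1, 2, 3, 4}" "p 1 \<in> {0, 1, 2, 3, 4}" "p 2 \<in> {0, 1, 2, 3, 4}"
    "p 3 \<in> {0, 1, 2, 3, 4}" "p 4 \<in> {0, 1, 2, 3, 4}" by simp_all
  have ne: "p i \<noteq> p j" if "i < 5" "j < 5" "i \<noteq> j" for i j using inj that by (auto dest: inj_onD)
  have step: "search unused cyclic_if_allowed n (q @ [c])"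
    if "search unused cyclic_if_allowed m q" "c \<in> {0, 1, 2, 3, 4}" "m = Suc n" "c \<notin> set q" for m n c q
  proof (rule search_step[OF that(1,3)])
    show "c \<in> set (unused q)"
      unfolding unused_def set_filter list.set mem_Collect_eq using that(2,4) by blast
  qed
  note st = step[OF special_stabilizers m(1), of 4]
  have "search unused cyclic_if_allowed 4 ([] @ [p 0])" by (rule st) simp_all
  from step[OF this m(2), of 3] have "search unused cyclic_if_allowed 3 (([] @ [p 0]) @ [p 1])"
    by (simp add: ne)
  from step[OF this m(3), of 2]
  have "search unused cyclic_if_allowed 2 ((([] @ [p 0]) @ [p 1]) @ [p 2])" by (simp add: ne)
  from step[OF this m(4), of 1]
  have "search unused cyclic_if_allowed 1 (((([] @ [p 0]) @ [p 1]) @ [p 2]) @ [p 3])" by (simp add: ne)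
  from step[OF this m(5), of 0]
  have "search unused cyclic_if_allowed 0 P" by (simp add: ne P_def)
  then have "cyclic_if_allowed P" by (simp add: search.simps)
  moreover have "allowed (table (codes B)) ((!) P)"
    using allowed_cong[of "code B" "table (codes B)" p "(!) P"] code_eq_table[OF B] p P a by blast
  ultimately have "P = [0, 1, 2, 3, 4] \<or> P = [1, 2, 3, 4, 0]"
    using L unfolding cyclic_if_allowed_def list_all_iff by metis
  then show ?thesis
  proof
    assume "P = [0, 1, 2, 3, 4]"
    then have "p i = i" if "i < 5" for i
      using P[OF that] less_5_cases[OF that] by (elim disjE) simp_all
    then show ?thesis by blast
  next
    assume "P = [1, 2, 3, 4, 0]"
    then have "p i = cyc i" if "i < 5" for i
      using P[OF that] less_5_cases[OF that] by (elim disjE) (simp_all add: cyc_values)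
    then show ?thesis by blast
  qed
qed

text \<open>The block permutation of \<open>S\<close> can only be the identity or
  \<open>cyc\<close>. In the first case \<open>S\<close> has the columns of the identity matrix in
  some order; in the second it has those of \<open>R10\<close>, which would then be split as
  well.\<close>

lemma preserves_row_split_zero_one:
  assumes B: "even_blocks B" and L: "codes B \<in> set special_codes" and S: "regular_orthogonal 10 S"
    and pr: "preserves R10 B S" and sp: "row_split 10 S" and az: "a < 10" "z < 10"
  shows "S $$ (a, z) \<in> {0, 1}"
proof -
  have VV: "zero_one_vec (transpose_mat S *\<^sub>v v)" if "v \<in> VV R10" for v
    using pr that unfolding preserves_def by blast
  have adj: "adjacency_mat 10 (transpose_mat S * B * S)"
    using pr unfolding preserves_def R10_dim by blast
  have Bc: "B \<in> carrier_mat 10 10" using even_adjacency[OF B] by (simp add: adjacency_mat_def)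
  obtain p u where p: "\<And>i. i < 5 \<Longrightarrow> p i < 5" "inj_on p {..<5}"
    and u: "\<And>y. y < 10 \<Longrightarrow> u y < (10::nat)" "\<And>z. z < 10 \<Longrightarrow> \<exists>y<10. u y = z"
    and Su: "\<And>a y. a < 10 \<Longrightarrow> y < 10 \<Longrightarrow> S $$ (a, u y) = switch p $$ (a, y)"
    using switch_normal_form[OF S VV] by blast
  have "adjacency_mat 10 (transpose_mat (switch p) * B * switch p)"
    using switch_normal_form_adjacency[of S u p B] S VV u(1) Su Bc adj by blast
  then have "allowed (code B) p" using switch_adjacency_iff[of B p] B p by blast
  then have "(\<forall>i<5. p i = i) \<or> (\<forall>i<5. p i = cyc i)"
    using special_allowed[of B p] B L p by blast
  then show ?thesis
  proof
    assume id: "\<forall>i<5. p i = i"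
    obtain y where y: "y < 10" "z = u y" using u(2)[OF az(2)] by blast
    have "p (y div 2) = y div 2" using id y(1) by simp
    then show ?thesis unfolding y(2) Su[OF az(1) y(1)] switch_entry[OF az(1) y(1)] by (auto simp: sg_def)
  next
    assume "\<forall>i<5. p i = cyc i"
    then have R: "R10 $$ (a, y) = S $$ (a, u y)" if "a < 10" "y < 10" for a y
      using Su[OF that] that unfolding R10_eq_switch by (simp add: switch_entry)
    obtain X Y where X: "X \<subseteq> {..<10}" "X \<noteq> {}" "X \<noteq> {..<10}"
      and XY: "\<And>a b. a < 10 \<Longrightarrow> b < 10 \<Longrightarrow> S $$ (a, b) \<noteq> 0 \<Longrightarrow> a \<in> X \<longleftrightarrow> b \<in> Y"
      using sp unfolding row_split_def by blast
    have "row_split 10 R10" unfolding row_split_def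
      by (rule exI[of _ X], rule exI[of _ "{y. u y \<in> Y}"]) (use X XY u(1) in \<open>simp add: R\<close>)
    then show ?thesis using R10_not_row_split by blast
  qed
qed

text \<open>A regular orthogonal matrix with entries in \<open>{0, 1}\<close> is a permutation
  matrix, so the product only rearranges the rows of \<open>M\<close>.\<close>

lemma row_split_zero_one_mult:
  assumes P: "regular_orthogonal n P" and P01: "\<And>a b. a < n \<Longrightarrow> b < n \<Longrightarrow> P $$ (a, b) \<in> {0, 1}"
    and M: "M \<in> carrier_mat n n" and sp: "row_split n M"
  shows "row_split n (P * M)"
proof -
  have Pc: "P \<in> carrier_mat n n" using P by (simp add: regular_orthogonal_def)
  have "\<exists>b. a < n \<longrightarrow> b < n \<and> P $$ (a, b) = 1 \<and> (\<forall>c<n. c \<noteq> b \<longrightarrow> P $$ (a, c) = 0)" for a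
  proof (cases "a < n")
    case True
    then have "(\<Sum>j<n. P $$ (a, j)) = 1" using P by (simp add: regular_orthogonal_def)
    then show ?thesis using sum_zero_one_eq_1[of "{..<n}" "\<lambda>j. P $$ (a, j)"] P01[OF True] by (metis finite_lessThan lessThan_iff)
  qed simp
  then have "\<forall>a. \<exists>b. a < n \<longrightarrow> b < n \<and> P $$ (a, b) = 1 \<and> (\<forall>c<n. c \<noteq> b \<longrightarrow> P $$ (a, c) = 0)" by blast
  then obtain t where "\<forall>a. a < n \<longrightarrow> t a < n \<and> P $$ (a, t a) = 1 \<and> (\<forall>c<n. c \<noteq> t a \<longrightarrow> P $$ (a, c) = 0)"
    by (rule choice[THEN exE])
  then have t: "t a < n" "P $$ (a, t a) = 1" "\<And>c. c < n \<Longrightarrow> c \<noteq> t a \<Longrightarrow> P $$ (a, c) = 0" if "a < n" for a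
    using that by blast+
  have surj: "\<exists>a<n. t a = b" if b: "b < n" for b
  proof (rule ccontr)
    assume "\<not> (\<exists>a<n. t a = b)"
    then have "P $$ (a, b) = 0" if "a < n" for a using t(3)[OF that b] that by blast
    then show False using regular_orthogonal_col_sum[OF P b] by simp
  qed
  have PM: "(P * M) $$ (a, b) = M $$ (t a, b)" if ab: "a < n" "b < n" for a b
  proof -
    have "(P * M) $$ (a, b) = (\<Sum>l = 0..<n. if l = t a then M $$ (l, b) else 0)"
      unfolding mult_mat_entry[OF Pc M ab]
    proof (rule sum.cong)
      fix l assume "l \<in> {0..<n}"
      then show "P $$ (a, l) * M $$ (l, b) = (if l = t a then M $$ (l, b) else 0)"
        using t(2,3)[OF ab(1)] by (cases "l = t a") simp_all
    qed simp
    then show ?thesis using t(1)[OF ab(1)] by simp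
  qed
  obtain X Y where X: "X \<subseteq> {..<n}" "X \<noteq> {}" "X \<noteq> {..<n}"
    and XY: "\<And>a b. a < n \<Longrightarrow> b < n \<Longrightarrow> M $$ (a, b) \<noteq> 0 \<Longrightarrow> a \<in> X \<longleftrightarrow> b \<in> Y"
    using sp unfolding row_split_def by blast
  let ?X = "{a. a < n \<and> t a \<in> X}"
  obtain b c where bc: "b \<in> X" "c < n" "c \<notin> X" using X by blast
  obtain a where a: "a < n" "t a = b" using surj[of b] bc X by blast
  obtain d where d: "d < n" "t d = c" using surj[of c] bc by blast
  have "?X \<subseteq> {..<n}" "a \<in> ?X" "d \<notin> ?X" "d \<in> {..<n}" using a d bc by auto
  moreover have "a \<in> ?X \<longleftrightarrow> b \<in> Y" if "a < n" "b < n" "(P * M) $$ (a, b) \<noteq> 0" for a b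
    using XY[OF t(1)[OF that(1)] that(2)] that(1,3) unfolding PM[OF that(1,2)] by blast
  ultimately show ?thesis unfolding row_split_def by blast
qed

text \<open>By induction every proper partial product is a permutation matrix: multiplied by the
  next, decomposable factor it becomes row-split, and \<open>preserves_row_split_zero_one\<close>
  makes the result 0/1 again. The same step at the last factor would split
  \<open>R10\<close>.\<close>

lemma special_irreducible:
  assumes B: "even_blocks B" and L: "codes B \<in> set special_codes"
  shows "\<not> reducible_wrt R10 B"
proof
  assume "reducible_wrt R10 B"
  then obtain Rs where Rs: "\<And>M. M \<in> set Rs \<Longrightarrow> regular_orthogonal 10 M \<and> decomposable 10 M"
    and R: "R10 = mat_list_prod 10 Rs"
    and pr: "\<And>i. 1 \<le> i \<Longrightarrow> i < length Rs \<Longrightarrow> preserves R10 B (mat_list_prod 10 (take i Rs))"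
    unfolding reducible_wrt_iff[OF R10_carrier even_adjacency[OF B]] by force
  have car: "M \<in> carrier_mat 10 10" if "M \<in> set Rs" for M using Rs[OF that] by (simp add: regular_orthogonal_def)
  define P where "P i = mat_list_prod 10 (take i Rs)" for i
  have P_Suc: "P (Suc i) = P i * Rs ! i" if "i < length Rs" for i
    unfolding P_def take_Suc_conv_app_nth[OF that]
    by (rule mat_list_prod_snoc) (use car that set_take_subset[of i Rs] in auto)
  have split_Suc: "row_split 10 (P (Suc i))"
    if "regular_orthogonal 10 (P i)" "\<forall>a<10. \<forall>b<10. P i $$ (a, b) \<in> {0, 1}" "i < length Rs" for i
    unfolding P_Suc[OF that(3)]
  proof (rule row_split_zero_one_mult[OF that(1)])
    have i: "Rs ! i \<in> set Rs" using that(3) by simp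
    show "Rs ! i \<in> carrier_mat 10 10" by (rule car[OF i])
    then show "row_split 10 (Rs ! i)" by (rule decomposable_imp_row_split) (use Rs[OF i] in blast)
  qed (use that(2) in blast)
  have ind: "regular_orthogonal 10 (P i) \<and> (\<forall>a<10. \<forall>b<10. P i $$ (a, b) \<in> {0, 1})" if "i < length Rs" for i
    using that
  proof (induction i)
    case 0
    have "P 0 = 1\<^sub>m 10" by (simp add: P_def)
    then show ?case using regular_orthogonal_one by simp
  next
    case (Suc i)
    then have IH: "regular_orthogonal 10 (P i)" "\<forall>a<10. \<forall>b<10. P i $$ (a, b) \<in> {0, 1}" "i < length Rs" by simp_all
    have "regular_orthogonal 10 (P (Suc i))"
      unfolding P_Suc[OF IH(3)] by (rule regular_orthogonal_mult[OF IH(1)]) (use Rs IH(3) in simp)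
    moreover have "preserves R10 B (P (Suc i))" unfolding P_def by (rule pr) (use Suc.prems in simp_all)
    ultimately show ?case using preserves_row_split_zero_one[OF B L] split_Suc[OF IH] by blast
  qed
  show False
  proof (cases "length Rs")
    case 0
    \<comment> \<open>The empty product is ruled out separately: the corner entry of
      \<open>R10\<close> is 1/2.\<close>
    then have "R10 = 1\<^sub>m 10" using R by simp
    then have "R10 $$ (0, 0) = 1\<^sub>m 10 $$ (0, 0)" by (rule arg_cong)
    then show False unfolding R10_eq_switch by (simp add: switch_entry cyc_def)
  next
    case (Suc k)
    then have "row_split 10 (P (Suc k))" using split_Suc[of k] ind[of k] by simp
    moreover have "P (Suc k) = R10" unfolding P_def R using Suc by simp
    ultimately show False using R10_not_row_split by simp
  qed
qed

section \<open>Equivalence classes\<close>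

lemma all_permuted:
  assumes "p permutes {..<n}"
  shows "(\<forall>a<n. Q a) \<longleftrightarrow> (\<forall>a<n. Q (p a))"
  using permutes_image[OF assms] by (metis imageE imageI lessThan_iff)

lemma permutation_congruence_entry:
  assumes p: "p permutes {..<n}" and B: "B \<in> carrier_mat n n" and ab: "a < n" "b < n"
  defines "P \<equiv> mat n n (\<lambda>(i, j). if j = p i then 1 else 0)"
  shows "(transpose_mat P * B * P) $$ (p a, p b) = (B $$ (a, b) :: rat)"
proof -
  have Pt: "transpose_mat P \<in> carrier_mat n n" unfolding P_def by simp
  have pa: "p a < n" using permutes_in_image[OF p] ab by simp
  have inj: "p a = p l \<longleftrightarrow> l = a" for l using permutes_inj[OF p] by (auto dest: injD)
  have "(transpose_mat P * B * P) $$ (p a, p b) = (transpose_mat P * B) $$ (p a, b)"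
    unfolding P_def by (rule perm_mat_mult_right[OF p _ pa ab(2)]) (use B in auto)
  also have "\<dots> = (\<Sum>l = 0..<n. if l = a then B $$ (l, b) else 0)"
    unfolding mult_mat_entry[OF Pt B pa ab(2)]
    by (rule sum.cong) (use pa inj in \<open>auto simp: P_def\<close>)
  finally show ?thesis using ab by simp
qed

lemma R10_nonzero_iff:
  assumes "a < 10" "y < 10"
  shows "R10 $$ (a, y) \<noteq> 0 \<longleftrightarrow> a div 2 = y div 2 \<or> a div 2 = cyc (y div 2)"
  using cyc_neq[OF div2_less[OF assms(2)]]
  unfolding R10_eq_switch switch_entry[OF assms] by (auto simp: sg_def)

definition adjacent_blocks :: "nat \<Rightarrow> nat \<Rightarrow> bool" where
  "adjacent_blocks a b \<longleftrightarrow> a div 2 = cyc (b div 2) \<or> b div 2 = cyc (a div 2)"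

lemma same_block_iff:
  assumes "a < 10" "b < 10"
  shows "a div 2 = b div 2 \<longleftrightarrow> (\<forall>y<10. R10 $$ (a, y) \<noteq> 0 \<longleftrightarrow> R10 $$ (b, y) \<noteq> 0)"
proof
  assume r: "\<forall>y<10. R10 $$ (a, y) \<noteq> 0 \<longleftrightarrow> R10 $$ (b, y) \<noteq> 0"
  obtain i k where ik: "i = a div 2" "k = b div 2" by simp
  then have l: "i < 5" "k < 5" using assms by simp_all
  \<comment> \<open>Equal supports at the columns \<open>2 * i\<close> and \<open>2 * k\<close> make
    each block equal to the other or its successor; in a cycle of length five two different blocks
    cannot succeed each other.\<close>
  have "k = i \<or> k = cyc i" "i = k \<or> i = cyc k"
    using r[rule_format, of "2 * i"] r[rule_format, of "2 * k"] l assms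
      R10_nonzero_iff[of a "2 * i"] R10_nonzero_iff[of b "2 * i"]
      R10_nonzero_iff[of a "2 * k"] R10_nonzero_iff[of b "2 * k"] by (simp_all add: ik)
  then show "a div 2 = b div 2"
    unfolding ik[symmetric] using less_5_cases[OF l(1)] by (elim disjE) (simp_all add: cyc_values)
qed (use assms in \<open>simp add: R10_nonzero_iff\<close>)

lemma adjacent_blocks_iff:
  assumes "a < 10" "b < 10"
  shows "adjacent_blocks a b \<longleftrightarrow> a div 2 \<noteq> b div 2 \<and> (\<exists>y<10. R10 $$ (a, y) \<noteq> 0 \<and> R10 $$ (b, y) \<noteq> 0)"
proof
  assume "adjacent_blocks a b"
  then consider "a div 2 = cyc (b div 2)" | "b div 2 = cyc (a div 2)" by (auto simp: adjacent_blocks_def)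
  then show "a div 2 \<noteq> b div 2 \<and> (\<exists>y<10. R10 $$ (a, y) \<noteq> 0 \<and> R10 $$ (b, y) \<noteq> 0)"
  proof cases
    case 1
    then show ?thesis using assms cyc_neq[OF div2_less[OF assms(2)]]
      by (intro conjI exI[of _ b]) (simp_all add: R10_nonzero_iff)
  next
    case 2
    then show ?thesis using assms cyc_neq[OF div2_less[OF assms(1)]]
      by (intro conjI exI[of _ a]) (simp_all add: R10_nonzero_iff)
  qed
qed (use assms in \<open>auto simp: R10_nonzero_iff adjacent_blocks_def\<close>)

text \<open>Two rows of \<open>R10\<close> have the same support exactly if they lie in the same block, and
  meeting supports exactly if their blocks are equal or cyclically adjacent. So the symmetries of
  \<open>R10\<close> respect both relations on the indices.\<close>

lemma R10_symmetry:
  assumes p: "p permutes {..<10}" and q: "q permutes {..<10}"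
    and R: "transpose_mat (mat 10 10 (\<lambda>(i, j). if j = p i then 1 else 0)) * R10 *
      mat 10 10 (\<lambda>(i, j). if j = q i then 1 else 0) = R10"
    and ab: "a < 10" "b < 10"
  shows "p a div 2 = p b div 2 \<longleftrightarrow> a div 2 = b div 2" "adjacent_blocks (p a) (p b) \<longleftrightarrow> adjacent_blocks a b"
proof -
  let ?P = "mat 10 10 (\<lambda>(i, j). if j = p i then 1 else 0) :: rat mat"
  have Pt: "transpose_mat ?P \<in> carrier_mat 10 10" by simp
  have plt: "p x < 10" if "x < 10" for x using permutes_in_image[OF p, of x] that by simp
  have inj: "p x = p l \<longleftrightarrow> l = x" for x l using permutes_inj[OF p] by (auto dest: injD)
  have e: "R10 $$ (p x, q y) = R10 $$ (x, y)" if xy: "x < 10" "y < 10" for x y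
  proof -
    have "R10 $$ (p x, q y) = (transpose_mat ?P * R10) $$ (p x, y)"
      unfolding arg_cong[OF R, of "\<lambda>M. M $$ (p x, q y)", symmetric]
      by (rule perm_mat_mult_right[OF q mult_carrier_mat[OF Pt R10_carrier] plt[OF xy(1)] xy(2)])
    also have "\<dots> = (\<Sum>l = 0..<10. if l = x then R10 $$ (l, y) else 0)"
      unfolding mult_mat_entry[OF Pt R10_carrier plt[OF xy(1)] xy(2)]
      by (rule sum.cong) (use plt[OF xy(1)] inj in auto)
    finally show ?thesis using xy by simp
  qed
  have ap: "(\<forall>y<10. R10 $$ (p a, y) \<noteq> 0 \<longleftrightarrow> R10 $$ (p b, y) \<noteq> 0) \<longleftrightarrow>
      (\<forall>y<10. R10 $$ (a, y) \<noteq> 0 \<longleftrightarrow> R10 $$ (b, y) \<noteq> 0)"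
    unfolding all_permuted[OF q, of "\<lambda>y. R10 $$ (p a, y) \<noteq> 0 \<longleftrightarrow> R10 $$ (p b, y) \<noteq> 0"]
    using e ab by simp
  then show s: "p a div 2 = p b div 2 \<longleftrightarrow> a div 2 = b div 2"
    unfolding same_block_iff[OF ab] same_block_iff[OF plt[OF ab(1)] plt[OF ab(2)]] .
  have "(\<forall>y<10. \<not> (R10 $$ (p a, y) \<noteq> 0 \<and> R10 $$ (p b, y) \<noteq> 0)) \<longleftrightarrow>
      (\<forall>y<10. \<not> (R10 $$ (a, y) \<noteq> 0 \<and> R10 $$ (b, y) \<noteq> 0))"
    unfolding all_permuted[OF q, of "\<lambda>y. \<not> (R10 $$ (p a, y) \<noteq> 0 \<and> R10 $$ (p b, y) \<noteq> 0)"]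
    using e ab by simp
  then show "adjacent_blocks (p a) (p b) \<longleftrightarrow> adjacent_blocks a b"
    unfolding adjacent_blocks_iff[OF ab] adjacent_blocks_iff[OF plt[OF ab(1)] plt[OF ab(2)]] s by blast
qed

section \<open>Two invariants of the moves\<close>

text \<open>Both properties look at blocks between cyclic neighbours in either direction. In the
  representatives these are \<open>O2\<close> (rows agree), \<open>I2\<close> (rows complementary),
  and \<open>N2\<close> forward with \<open>N2T\<close> backward, where the former violates
  agreement and the latter complementarity.\<close>

definition rows_agree :: "rat mat \<Rightarrow> bool" where
  "rows_agree B \<longleftrightarrow> (\<forall>a<10. \<forall>a'<10. \<forall>b<10. a div 2 = a' div 2 \<and> adjacent_blocks a b \<longrightarrow>
     B $$ (a, b) = B $$ (a', b))"

definition rows_complementary :: "rat mat \<Rightarrow> bool" where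
  "rows_complementary B \<longleftrightarrow> (\<forall>a<10. \<forall>a'<10. \<forall>b<10. a div 2 = a' div 2 \<and> a \<noteq> a' \<and> adjacent_blocks a b \<longrightarrow>
     B $$ (a, b) + B $$ (a', b) = 1)"

text \<open>Complementing a whole block changes both rows of the block together, and
  \<open>x = y\<close> as well as \<open>x + y = 1\<close> are stable under replacing
  \<open>x\<close> and \<open>y\<close> by \<open>1 - x\<close> and \<open>1 - y\<close>.\<close>

lemma invariants_complement_entries:
  assumes "\<And>a b. a < 10 \<Longrightarrow> b < 10 \<Longrightarrow> adjacent_blocks a b \<Longrightarrow>
    B' $$ (a, b) = (if K (a div 2) (b div 2) then 1 - B $$ (a, b) else B $$ (a, b))"
  shows "rows_agree B' \<longleftrightarrow> rows_agree B" "rows_complementary B' \<longleftrightarrow> rows_complementary B"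
proof -
  have e: "B' $$ (a, b) = (if K (a div 2) (b div 2) then 1 - B $$ (a, b) else B $$ (a, b)) \<and>
     B' $$ (a', b) = (if K (a div 2) (b div 2) then 1 - B $$ (a', b) else B $$ (a', b))"
    if "a < 10" "a' < 10" "b < 10" "a div 2 = a' div 2" "adjacent_blocks a b" for a a' b
  proof -
    have "adjacent_blocks a' b" using that unfolding adjacent_blocks_def by simp
    then show ?thesis using assms[of a b] assms[of a' b] that by simp
  qed
  have "B' $$ (a, b) = B' $$ (a', b) \<longleftrightarrow> B $$ (a, b) = B $$ (a', b)"
    "B' $$ (a, b) + B' $$ (a', b) = 1 \<longleftrightarrow> B $$ (a, b) + B $$ (a', b) = 1"
    if "a < 10" "a' < 10" "b < 10" "a div 2 = a' div 2" "adjacent_blocks a b" for a a' b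
    using e[OF that] by (cases "K (a div 2) (b div 2)"; auto)+
  then show "rows_agree B' \<longleftrightarrow> rows_agree B" "rows_complementary B' \<longleftrightarrow> rows_complementary B"
    unfolding rows_agree_def rows_complementary_def by blast+
qed

lemma move_invariants:
  assumes "move B B'"
  shows "(rows_agree B' \<longleftrightarrow> rows_agree B) \<and> (rows_complementary B' \<longleftrightarrow> rows_complementary B)"
  using assms
proof cases
  case complement
  have Bc: "B \<in> carrier_mat 10 10" using complement(1) by (simp add: BB_iff even_blocks_def adjacency_mat_def)
  have "B' $$ (a, b) = (if True then 1 - B $$ (a, b) else B $$ (a, b))"
    if "a < 10" "b < 10" "adjacent_blocks a b" for a b
  proof -
    have "a \<noteq> b" using that cyc_neq[of "a div 2"] unfolding adjacent_blocks_def by auto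
    then show ?thesis using that Bc unfolding complement(3) by (simp add: all_ones_mat_def)
  qed
  then show ?thesis using invariants_complement_entries[of B' "\<lambda>_ _. True" B] by blast
next
  case (block i j)
  have Bc: "B \<in> carrier_mat 10 10" using block(1) by (simp add: BB_iff even_blocks_def adjacency_mat_def)
  have "B' $$ (a, b) = (if (a div 2, b div 2) \<in> {(i, j), (j, i)} then 1 - B $$ (a, b) else B $$ (a, b))"
    if "a < 10" "b < 10" "adjacent_blocks a b" for a b
    using that Bc unfolding block(6) complement_block_def by simp
  then show ?thesis using invariants_complement_entries[of B' "\<lambda>k l. (k, l) \<in> {(i, j), (j, i)}" B] by blast
next
  case (conjugate P P')
  have Bc: "B \<in> carrier_mat 10 10" using conjugate(1) by (simp add: BB_iff even_blocks_def adjacency_mat_def)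
  obtain p where p: "p permutes {..<10}" and P: "P = mat 10 10 (\<lambda>(i, j). if j = p i then 1 else 0)"
    using conjugate(3) by (auto simp: permutation_mat_def)
  obtain q where q: "q permutes {..<10}" and P': "P' = mat 10 10 (\<lambda>(i, j). if j = q i then 1 else 0)"
    using conjugate(4) by (auto simp: permutation_mat_def)
  note sym = R10_symmetry[OF p q conjugate(5)[unfolded P P']]
  have e: "B' $$ (p a, p b) = B $$ (a, b)" if "a < 10" "b < 10" for a b
    unfolding conjugate(6) P by (rule permutation_congruence_entry[OF p Bc that])
  have inj: "p a = p b \<longleftrightarrow> a = b" for a b using permutes_inj[OF p] by (auto dest: injD)
  have ap3: "(\<forall>a<10. \<forall>a'<10. \<forall>b<10. Q a a' b) \<longleftrightarrow> (\<forall>a<10. \<forall>a'<10. \<forall>b<10. Q (p a) (p a') (p b))" for Q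
    using all_permuted[OF p, of "\<lambda>a. \<forall>a'<10. \<forall>b<10. Q a a' b"]
      all_permuted[OF p, of "\<lambda>a'. \<forall>b<10. Q (p _) a' b"] all_permuted[OF p] by auto
  have "rows_agree B' \<longleftrightarrow> rows_agree B"
    unfolding rows_agree_def ap3[of "\<lambda>a a' b. a div 2 = a' div 2 \<and> adjacent_blocks a b \<longrightarrow> B' $$ (a, b) = B' $$ (a', b)"]
    using sym e by simp
  moreover have "rows_complementary B' \<longleftrightarrow> rows_complementary B"
    unfolding rows_complementary_def ap3[of "\<lambda>a a' b. a div 2 = a' div 2 \<and> a \<noteq> a' \<and> adjacent_blocks a b \<longrightarrow>
      B' $$ (a, b) + B' $$ (a', b) = 1"]
    using sym e inj by simp
  ultimately show ?thesis by blast
qed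

lemma equivclp_move_invariants:
  assumes "equivclp move B B'"
  shows "(rows_agree B' \<longleftrightarrow> rows_agree B) \<and> (rows_complementary B' \<longleftrightarrow> rows_complementary B)"
  using assms by (induction rule: equivclp_induct) (use move_invariants in blast)+

section \<open>Equal codes imply equivalence\<close>

text \<open>Complementing a block replaces \<open>ee\<close> by \<open>4 - ee\<close> and negates
  the other coordinates; the code sees only which of these vanish.\<close>

lemma even_flip:
  assumes B: "even_blocks B" and A: "adjacency_mat 10 B'"
    and d: "\<And>i. i < 5 \<Longrightarrow> B' $$ (2*i, 2*i+1) = B' $$ (0, 1)"
    and bl: "\<And>i j. i < 5 \<Longrightarrow> j < 5 \<Longrightarrow> i \<noteq> j \<Longrightarrow>
      ee B' i j = ee B i j \<and> ef B' i j = ef B i j \<and> fe B' i j = fe B i j \<and> ff B' i j = ff B i j \<or>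
      ee B' i j = 4 - ee B i j \<and> ef B' i j = - ef B i j \<and> fe B' i j = - fe B i j \<and> ff B' i j = - ff B i j"
  shows "even_blocks B'" "\<And>i j. i < 5 \<Longrightarrow> j < 5 \<Longrightarrow> code B' i j = code B i j"
proof -
  have "ee B' i j \<in> {0, 2, 4}" if ij: "i < 5" "j < 5" "i \<noteq> j" for i j
    using bl[OF ij] even_ee_ff(1)[OF B ij] by auto
  then show "even_blocks B'" using A d unfolding even_blocks_def by blast
  show "code B' i j = code B i j" if ij: "i < 5" "j < 5" for i j
  proof (cases "i = j")
    case False
    then show ?thesis using bl[OF ij False] unfolding code_def by auto
  qed (simp add: code_def)
qed

lemma BB_flip:
  assumes B: "B \<in> BB R10" and A: "adjacency_mat 10 B'"
    and d: "\<And>i. i < 5 \<Longrightarrow> B' $$ (2*i, 2*i+1) = B' $$ (0, 1)"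
    and bl: "\<And>i j. i < 5 \<Longrightarrow> j < 5 \<Longrightarrow> i \<noteq> j \<Longrightarrow>
      ee B' i j = ee B i j \<and> ef B' i j = ef B i j \<and> fe B' i j = fe B i j \<and> ff B' i j = ff B i j \<or>
      ee B' i j = 4 - ee B i j \<and> ef B' i j = - ef B i j \<and> fe B' i j = - fe B i j \<and> ff B' i j = - ff B i j"
  shows "B' \<in> BB R10" "codes B' = codes B"
proof -
  have ev: "even_blocks B" using B by (simp add: BB_iff)
  have ev': "even_blocks B'" by (rule even_flip(1)[OF ev A d bl])
  have c: "code B' i j = code B i j" if "i < 5" "j < 5" for i j by (rule even_flip(2)[OF ev A d bl that])
  have "allowed (code B') cyc = allowed (code B) cyc" by (rule allowed_cong[OF c]) simp_all
  then show "B' \<in> BB R10" using B ev' by (simp add: BB_iff)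
  show "codes B' = codes B" unfolding codes_def by (simp add: c)
qed

lemma BB_facts:
  assumes "B \<in> BB R10"
  shows "B \<in> carrier_mat 10 10" "\<And>a b. a < 10 \<Longrightarrow> b < 10 \<Longrightarrow> B $$ (a, b) \<in> {0, 1} \<and> B $$ (b, a) = B $$ (a, b)"
    "\<And>a. a < 10 \<Longrightarrow> B $$ (a, a) = 0" "\<And>i. i < 5 \<Longrightarrow> B $$ (2*i, 2*i+1) = B $$ (0, 1)"
  using assms unfolding BB_iff even_blocks_def adjacency_mat_iff by blast+

lemma complement_block_BB:
  assumes B: "B \<in> BB R10" and ij: "i < 5" "j < 5" "i \<noteq> j"
  shows "complement_block i j B \<in> BB R10" "codes (complement_block i j B) = codes B"
proof -
  let ?B = "complement_block i j B"
  have dim: "dim_row B = 10" "dim_col B = 10" using BB_facts(1)[OF B] by auto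
  have e: "?B $$ (a, b) = (if (a div 2, b div 2) \<in> {(i, j), (j, i)} then 1 - B $$ (a, b) else B $$ (a, b))"
    if "a < 10" "b < 10" for a b using that by (simp add: complement_block_def dim)
  have "?B $$ (a, b) \<in> {0, 1} \<and> ?B $$ (b, a) = ?B $$ (a, b)" if "a < 10" "b < 10" for a b
    using BB_facts(2)[OF B that] unfolding e[OF that] e[OF that(2,1)] by auto
  moreover have "?B $$ (a, a) = 0" if "a < 10" for a
    using BB_facts(3)[OF B that] ij(3) unfolding e[OF that that] by auto
  moreover have "?B \<in> carrier_mat 10 10" by (simp add: complement_block_def dim)
  ultimately have A: "adjacency_mat 10 ?B" unfolding adjacency_mat_iff by blast
  have d: "?B $$ (2*k, 2*k+1) = ?B $$ (0, 1)" if "k < 5" for k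
    using BB_facts(4)[OF B that] that ij by (simp add: e)
  have bl: "ee ?B k l = ee B k l \<and> ef ?B k l = ef B k l \<and> fe ?B k l = fe B k l \<and> ff ?B k l = ff B k l \<or>
      ee ?B k l = 4 - ee B k l \<and> ef ?B k l = - ef B k l \<and> fe ?B k l = - fe B k l \<and> ff ?B k l = - ff B k l"
    if "k < 5" "l < 5" for k l
  proof -
    have e4: "?B $$ (2*k, 2*l) = (if K then 1 - B $$ (2*k, 2*l) else B $$ (2*k, 2*l))"
      "?B $$ (2*k, 2*l+1) = (if K then 1 - B $$ (2*k, 2*l+1) else B $$ (2*k, 2*l+1))"
      "?B $$ (2*k+1, 2*l) = (if K then 1 - B $$ (2*k+1, 2*l) else B $$ (2*k+1, 2*l))"
      "?B $$ (2*k+1, 2*l+1) = (if K then 1 - B $$ (2*k+1, 2*l+1) else B $$ (2*k+1, 2*l+1))"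
      if "K \<longleftrightarrow> (k, l) \<in> {(i, j), (j, i)}" for K
      using \<open>k < 5\<close> \<open>l < 5\<close> by (simp_all add: e that)
    show ?thesis
    proof (cases "(k, l) \<in> {(i, j), (j, i)}")
      case True
      then have t: "True \<longleftrightarrow> (k, l) \<in> {(i, j), (j, i)}" by simp
      show ?thesis unfolding ee_def ef_def fe_def ff_def e4[OF t] by simp
    next
      case False
      then have t: "False \<longleftrightarrow> (k, l) \<in> {(i, j), (j, i)}" by simp
      show ?thesis unfolding ee_def ef_def fe_def ff_def e4[OF t] by simp
    qed
  qed
  show "?B \<in> BB R10" "codes ?B = codes B" using BB_flip[OF B A d] bl by blast+
qed

lemma complement_BB:
  assumes B: "B \<in> BB R10"
  shows "all_ones_mat 10 - 1\<^sub>m 10 - B \<in> BB R10" "codes (all_ones_mat 10 - 1\<^sub>m 10 - B) = codes B"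
    "(all_ones_mat 10 - 1\<^sub>m 10 - B) $$ (0, 1) = 1 - B $$ (0, 1)"
proof -
  let ?B = "all_ones_mat 10 - 1\<^sub>m 10 - B"
  have Bc: "B \<in> carrier_mat 10 10" by (rule BB_facts[OF B])
  have e: "?B $$ (a, b) = (if a = b then 0 else 1 - B $$ (a, b))" if "a < 10" "b < 10" for a b
    using that Bc BB_facts(3)[OF B] by (simp add: all_ones_mat_def)
  have "?B $$ (a, b) \<in> {0, 1} \<and> ?B $$ (b, a) = ?B $$ (a, b)" if "a < 10" "b < 10" for a b
    using BB_facts(2)[OF B that] unfolding e[OF that] e[OF that(2,1)] by auto
  moreover have "?B \<in> carrier_mat 10 10" using Bc by (simp add: minus_carrier_mat)
  ultimately have A: "adjacency_mat 10 ?B" unfolding adjacency_mat_iff using e by simp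
  show "?B $$ (0, 1) = 1 - B $$ (0, 1)" by (simp add: e)
  have d: "?B $$ (2*k, 2*k+1) = ?B $$ (0, 1)" if "k < 5" for k
    using BB_facts(4)[OF B that] that by (simp add: e)
  have bl: "ee ?B k l = 4 - ee B k l \<and> ef ?B k l = - ef B k l \<and> fe ?B k l = - fe B k l \<and> ff ?B k l = - ff B k l"
    if "k < 5" "l < 5" "k \<noteq> l" for k l
    using that by (simp add: ee_def ef_def fe_def ff_def e double_not_eq_Suc_double Suc_double_not_eq_double)
  show "?B \<in> BB R10" "codes ?B = codes B" using BB_flip[OF B A d] bl by blast+
qed

lemma eq_by_coordinates:
  assumes "B \<in> carrier_mat 10 10" "C \<in> carrier_mat 10 10"
    and "\<And>i j. i < 5 \<Longrightarrow> j < 5 \<Longrightarrow> ee B i j = ee C i j \<and> ef B i j = ef C i j \<and> fe B i j = fe C i j \<and> ff B i j = ff C i j"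
  shows "B = C"
proof (rule eq_matI)
  fix a b assume "a < dim_row C" "b < dim_col C"
  then have ab: "a < 10" "b < 10" using assms(2) by auto
  obtain i x where a: "a = 2 * i + x" "x < 2" "i < 5" using pair_index ab(1) by blast
  obtain j y where b: "b = 2 * j + y" "y < 2" "j < 5" using pair_index ab(2) by blast
  have "B $$ (2*i+x, 2*j+y) = C $$ (2*i+x, 2*j+y)"
    using less_2_cases[OF a(2)] less_2_cases[OF b(2)] assms(3)[OF a(3) b(3)]
    by (elim disjE) (simp_all add: block_entries[of B i j] block_entries[of C i j] del: One_nat_def)
  then show "B $$ (a, b) = C $$ (a, b)" unfolding a(1) b(1) .
qed (use assms(1,2) in auto)

text \<open>Each code is shared by exactly two blocks, which are complements of each other, so one
  entry distinguishes them.\<close>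

lemma even_block_determined:
  assumes B: "even_blocks B" and C: "even_blocks C" and ij: "i < 5" "j < 5" "i \<noteq> j"
    and c: "code B i j = code C i j" and e: "B $$ (2*i, 2*j) = C $$ (2*i, 2*j)"
  shows "ee B i j = ee C i j \<and> ef B i j = ef C i j \<and> fe B i j = fe C i j \<and> ff B i j = ff C i j"
  using even_block_cases[OF B ij] even_block_cases[OF C ij] c e
  unfolding block_entries(1)[of B] block_entries(1)[of C] by (elim disjE conjE) auto

definition corner_diff :: "rat mat \<Rightarrow> rat mat \<Rightarrow> (nat \<times> nat) set" where
  "corner_diff B C = {(i, j). i < j \<and> j < 5 \<and> B $$ (2*i, 2*j) \<noteq> C $$ (2*i, 2*j)}"

lemma finite_corner_diff: "finite (corner_diff B C)"
  by (rule finite_subset[of _ "{..<5} \<times> {..<5}"]) (auto simp: corner_diff_def)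

lemma codes_eqD:
  assumes "even_blocks B" "even_blocks C" "codes B = codes C" "i < 5" "j < 5"
  shows "code B i j = code C i j"
  using code_eq_table[OF assms(1,4,5)] code_eq_table[OF assms(2,4,5)] assms(3) by simp

text \<open>\<open>corner_diff\<close> collects the off-diagonal blocks that still have to be
  complemented; each block move removes one of them. The diagonal blocks already coincide because
  they are all determined by the entry \<open>(0, 1)\<close>.\<close>

lemma equivclp_same_corner:
  assumes "B \<in> BB R10" "C \<in> BB R10" "codes B = codes C" "B $$ (0, 1) = C $$ (0, 1)"
  shows "equivclp move B C"
  using assms
proof (induction "card (corner_diff B C)" arbitrary: B)
  case 0
  have ev: "even_blocks B" "even_blocks C" using 0 by (simp_all add: BB_iff)
  have A: "adjacency_mat 10 B" "adjacency_mat 10 C" using ev even_adjacency by blast+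
  have nd: "B $$ (2*i, 2*j) = C $$ (2*i, 2*j)" if "i < j" "j < 5" for i j
    using 0(1) finite_corner_diff[of B C] that by (auto simp: corner_diff_def)
  have "B = C"
  proof (rule eq_by_coordinates[OF BB_facts(1)[OF 0(2)] BB_facts(1)[OF 0(3)]])
    fix i j :: nat assume ij: "i < 5" "j < 5"
    show "ee B i j = ee C i j \<and> ef B i j = ef C i j \<and> fe B i j = fe C i j \<and> ff B i j = ff C i j"
    proof (cases "i = j")
      case True
      have "B $$ (2*j, 2*j+1) = C $$ (2*j, 2*j+1)"
        using BB_facts(4)[OF 0(2) ij(2)] BB_facts(4)[OF 0(3) ij(2)] 0(5) by simp
      then show ?thesis
        unfolding True diagonal_block[OF A(1) ij(2)] diagonal_block[OF A(2) ij(2)] by simp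
    next
      case False
      have "2*i < 10" "2*j < 10" using ij by simp_all
      then have s: "B $$ (2*i, 2*j) = B $$ (2*j, 2*i)" "C $$ (2*i, 2*j) = C $$ (2*j, 2*i)"
        using BB_facts(2)[OF 0(2)] BB_facts(2)[OF 0(3)] by blast+
      have "B $$ (2*i, 2*j) = C $$ (2*i, 2*j)"
        using nd[of i j] nd[of j i] False ij s by (cases "i < j") simp_all
      then show ?thesis
        using even_block_determined[OF ev ij False] codes_eqD[OF ev 0(4) ij] by blast
    qed
  qed
  then show ?case by simp
next
  case (Suc n)
  have "corner_diff B C \<noteq> {}" using Suc(2) by auto
  then obtain i j where ij: "(i, j) \<in> corner_diff B C" by auto
  then have l: "i < j" "j < 5" and ne: "B $$ (2*i, 2*j) \<noteq> C $$ (2*i, 2*j)" by (auto simp: corner_diff_def)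
  have l': "i < 5" "i \<noteq> j" using l by simp_all
  let ?B = "complement_block i j B"
  note cb = complement_block_BB[OF Suc(3) l'(1) l(2) l'(2)]
  have dim: "dim_row B = 10" "dim_col B = 10" using BB_facts(1)[OF Suc(3)] by auto
  have e: "?B $$ (2*k, 2*m) = (if (k, m) = (i, j) then 1 - B $$ (2*k, 2*m) else B $$ (2*k, 2*m))"
    if "k < m" "m < 5" for k m using that l by (auto simp: complement_block_def dim)
  have "2*i < 10" "2*j < 10" using l by simp_all
  then have "B $$ (2*i, 2*j) \<in> {0, 1}" "C $$ (2*i, 2*j) \<in> {0, 1}"
    using BB_facts(2)[OF Suc(3)] BB_facts(2)[OF Suc(4)] by blast+
  then have fl: "1 - B $$ (2*i, 2*j) = C $$ (2*i, 2*j)" using ne by auto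
  have "corner_diff ?B C = corner_diff B C - {(i, j)}"
    unfolding corner_diff_def using fl by (auto simp: e split: if_splits)
  then have card: "n = card (corner_diff ?B C)" using Suc(2) ij finite_corner_diff[of B C] by simp
  have "?B $$ (0, 1) = B $$ (0, 1)" using l by (simp add: complement_block_def dim)
  then have "equivclp move ?B C" using Suc(1)[OF card cb(1) Suc(4)] cb(2) Suc(5,6) by simp
  moreover have "move B ?B" by (rule move.block[OF Suc(3) cb(1) l'(1) l(2) l'(2) refl])
  ultimately show ?case using r_into_equivclp equivclp_trans by metis
qed

text \<open>Block moves leave the diagonal blocks alone. If these differ, one complementation of the
  whole matrix makes them agree without changing the codes.\<close>

lemma equivclp_same_codes:
  assumes B: "B \<in> BB R10" and C: "C \<in> BB R10" and c: "codes B = codes C"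
  shows "equivclp move B C"
proof (cases "B $$ (0, 1) = C $$ (0, 1)")
  case True
  then show ?thesis by (rule equivclp_same_corner[OF B C c])
next
  case False
  let ?B = "all_ones_mat 10 - 1\<^sub>m 10 - B"
  have "B $$ (0, 1) \<in> {0, 1}" "C $$ (0, 1) \<in> {0, 1}" using BB_facts(2)[OF B] BB_facts(2)[OF C] by simp_all
  then have "?B $$ (0, 1) = C $$ (0, 1)" using False unfolding complement_BB(3)[OF B] by auto
  then have "equivclp move ?B C"
    using equivclp_same_corner[OF complement_BB(1)[OF B] C] complement_BB(2)[OF B] c by simp
  moreover have "move B ?B" by (rule move.complement[OF B complement_BB(1)[OF B] refl])
  ultimately show ?thesis using r_into_equivclp equivclp_trans by metis
qed

section \<open>The three circulants\<close>

lemma circulant_block: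
  assumes X: "length Xs = 5" and ij: "i < 5" "j < 5"
  defines "X \<equiv> Xs ! ((j + 5 - i) mod 5)"
  shows "ee (circulant Xs) i j = ee X 0 0" "ef (circulant Xs) i j = ef X 0 0"
    "fe (circulant Xs) i j = fe X 0 0" "ff (circulant Xs) i j = ff X 0 0"
    "zero_one_block (circulant Xs) i j \<longleftrightarrow> zero_one_block X 0 0"
    "circulant Xs $$ (2*i, 2*j) = X $$ (0, 0)" "circulant Xs $$ (2*i, 2*j+1) = X $$ (0, 1)"
    "circulant Xs $$ (2*i+1, 2*j) = X $$ (1, 0)" "circulant Xs $$ (2*i+1, 2*j+1) = X $$ (1, 1)"
proof -
  show e: "circulant Xs $$ (2*i, 2*j) = X $$ (0, 0)" "circulant Xs $$ (2*i, 2*j+1) = X $$ (0, 1)"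
    "circulant Xs $$ (2*i+1, 2*j) = X $$ (1, 0)" "circulant Xs $$ (2*i+1, 2*j+1) = X $$ (1, 1)"
    unfolding X_def using ij by (simp_all add: circulant_entry[OF X])
  show "ee (circulant Xs) i j = ee X 0 0" "ef (circulant Xs) i j = ef X 0 0"
    "fe (circulant Xs) i j = fe X 0 0" "ff (circulant Xs) i j = ff X 0 0"
    "zero_one_block (circulant Xs) i j \<longleftrightarrow> zero_one_block X 0 0"
    unfolding ee_def ef_def fe_def ff_def zero_one_block_def e by simp_all
qed

lemma N2_entries: "N2 $$ (0, 0) = 0" "N2 $$ (0, 1) = 0" "N2 $$ (1, 0) = 1" "N2 $$ (1, 1) = 1"
  "N2T $$ (0, 0) = 0" "N2T $$ (0, 1) = 1" "N2T $$ (1, 0) = 0" "N2T $$ (1, 1) = 1"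
  by (simp_all add: N2_def mat_of_rows_list_def)

lemma small_blocks:
  "ee O2 0 0 = 0" "ef O2 0 0 = 0" "fe O2 0 0 = 0" "ff O2 0 0 = 0" "zero_one_block O2 0 0"
  "ee I2 0 0 = 2" "ef I2 0 0 = 0" "fe I2 0 0 = 0" "ff I2 0 0 = 2" "zero_one_block I2 0 0"
  "ee N2 0 0 = 2" "ef N2 0 0 = 0" "fe N2 0 0 = -2" "ff N2 0 0 = 0" "zero_one_block N2 0 0"
  "ee N2T 0 0 = 2" "ef N2T 0 0 = -2" "fe N2T 0 0 = 0" "ff N2T 0 0 = 0" "zero_one_block N2T 0 0"
  using N2_entries by (simp_all add: ee_def ef_def fe_def ff_def zero_one_block_def)

lemma special_codes_allowed: "list_all (\<lambda>L. allowed (table L) cyc) special_codes"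
  by code_simp

text \<open>The conditions on \<open>X'\<close> and \<open>Y'\<close> make the circulant symmetric.\<close>

lemma circulant_special:
  assumes X: "X \<in> {O2, I2, N2}" and Y: "Y \<in> {N2, N2T}" and
    X': "X' = transpose_mat X" and Y': "Y' = transpose_mat Y"
    and L: "codes (circulant [O2, X, Y, Y', X']) \<in> set special_codes"
  shows "circulant [O2, X, Y, Y', X'] \<in> BB R10"
proof -
  let ?C = "circulant [O2, X, Y, Y', X']"
  have len: "length [O2, X, Y, Y', X'] = 5" by simp
  note cb = circulant_block[OF len]
  have tr: "transpose_mat N2T = N2" "transpose_mat O2 = O2" "transpose_mat I2 = I2" by simp_all
  have c: "X = O2 \<and> X' = O2 \<or> X = I2 \<and> X' = I2 \<or> X = N2 \<and> X' = N2T"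
    "Y = N2 \<and> Y' = N2T \<or> Y = N2T \<and> Y' = N2"
    using X Y unfolding X' Y' by auto
  have sb: "ee ?C j i = ee ?C i j \<and> ef ?C j i = fe ?C i j \<and> ff ?C j i = ff ?C i j \<and> zero_one_block ?C i j \<and>
      ee ?C i j \<in> {0, 2, 4}"
    if ij: "i < 5" "j < 5" for i j
  proof -
    obtain k k' where k: "k = (j + 5 - i) mod 5" "k' = (i + 5 - j) mod 5" by simp
    have "k = 0 \<and> k' = 0 \<or> k = 1 \<and> k' = 4 \<or> k = 2 \<and> k' = 3 \<or> k = 3 \<and> k' = 2 \<or> k = 4 \<and> k' = 1"
      using less_5_cases[OF ij(1)] less_5_cases[OF ij(2)] unfolding k by (elim disjE; simp)
    then show ?thesis
      unfolding cb[OF ij] cb[OF ij(2,1)] k[symmetric] using c by (elim disjE conjE; simp add: small_blocks)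
  qed
  have d: "?C $$ (2*i, 2*i) = 0 \<and> ?C $$ (2*i+1, 2*i+1) = 0 \<and> ?C $$ (2*i, 2*i+1) = 0" if "i < 5" for i
    unfolding cb(6-9)[OF that that] by simp
  have "adjacency_mat 10 ?C" unfolding adjacency_mat_blocks
    using sb d by (auto intro!: carrier_matI)
  moreover have "?C $$ (0, 1) = 0" using d[of 0] by simp
  ultimately have ev: "even_blocks ?C" unfolding even_blocks_def using sb d by simp
  moreover have "allowed (code ?C) cyc = allowed (table (codes ?C)) cyc"
    by (rule allowed_cong) (use code_eq_table[OF ev] in simp_all)
  ultimately show ?thesis using L special_codes_allowed unfolding BB_iff list_all_iff by simp
qed

lemma circulant_codes:
  "codes (circulant [O2, O2, N2, N2T, O2]) = [0,0,0,0,0, 2,2,2,2,2]"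
  "codes (circulant [O2, I2, N2, N2T, I2]) = [3,3,3,3,3, 2,2,2,2,2]"
  "codes (circulant [O2, N2, N2T, N2, N2T]) = [2,2,2,2,2, 1,1,1,1,1]"
  by (simp_all add: codes_def code_def circulant_block small_blocks)

lemma circulant_invariants:
  "rows_agree (circulant [O2, O2, N2, N2T, O2])" "\<not> rows_agree (circulant [O2, I2, N2, N2T, I2])"
  "\<not> rows_agree (circulant [O2, N2, N2T, N2, N2T])" "rows_complementary (circulant [O2, I2, N2, N2T, I2])"
  "\<not> rows_complementary (circulant [O2, N2, N2T, N2, N2T])"
proof -
  \<comment> \<open>Cyclic neighbours use the list indices 1 and 4. The first two representatives
    have the same block there, so direction is irrelevant for them.\<close>
  have nth: "[A, X, Y, Y', X] ! ((b div 2 + 5 - a div 2) mod 5) = X"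
    if "a < 10" "b < 10" "adjacent_blocks a b" for a b and A X Y Y' :: "rat mat"
    using that(3) less_5_cases[OF div2_less[OF that(1)]] less_5_cases[OF div2_less[OF that(2)]]
    unfolding adjacent_blocks_def by (elim disjE) (simp_all add: cyc_values)
  have adj: "adjacent_blocks 0 2" "adjacent_blocks 1 2" "adjacent_blocks 2 0" "adjacent_blocks 3 0"
    by (simp_all add: adjacent_blocks_def cyc_def)
  have e: "circulant [A, X, Y, Y', X] $$ (a, b) = X $$ (a mod 2, b mod 2)"
    if "a < 10" "b < 10" "adjacent_blocks a b" for a b and A X Y Y' :: "rat mat"
    unfolding circulant_entry[OF _ that(1,2), of "[A, X, Y, Y', X]", simplified] nth[OF that, simplified] ..
  have a': "adjacent_blocks a' b" if "adjacent_blocks a b" "a div 2 = a' div 2" for a a' b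
    using that unfolding adjacent_blocks_def by simp
  show "rows_agree (circulant [O2, O2, N2, N2T, O2])"
    unfolding rows_agree_def
  proof (intro allI impI)
    fix a a' b :: nat assume h: "a < 10" "a' < 10" "b < 10" "a div 2 = a' div 2 \<and> adjacent_blocks a b"
    then show "circulant [O2, O2, N2, N2T, O2] $$ (a, b) = circulant [O2, O2, N2, N2T, O2] $$ (a', b)"
      using e[of a b] e[of a' b] a'[of a b a'] by simp
  qed
  show "rows_complementary (circulant [O2, I2, N2, N2T, I2])"
    unfolding rows_complementary_def
  proof (intro allI impI)
    fix a a' b :: nat assume h: "a < 10" "a' < 10" "b < 10" "a div 2 = a' div 2 \<and> a \<noteq> a' \<and> adjacent_blocks a b"
    then have "a mod 2 \<noteq> a' mod 2" by (metis mult_div_mod_eq)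
    then have "a mod 2 = 0 \<and> a' mod 2 = 1 \<or> a mod 2 = 1 \<and> a' mod 2 = 0" by auto
    moreover have "b mod 2 = 0 \<or> b mod 2 = 1" by auto
    ultimately show "circulant [O2, I2, N2, N2T, I2] $$ (a, b) + circulant [O2, I2, N2, N2T, I2] $$ (a', b) = 1"
      using h e[of a b] e[of a' b] a'[of a b a'] by auto
  qed
  \<comment> \<open>The entries \<open>(0, 2)\<close> and \<open>(1, 2)\<close> belong to block
    \<open>(0, 1)\<close>, the entries \<open>(2, 0)\<close> and \<open>(3, 0)\<close> to block
    \<open>(1, 0)\<close>; in the third circulant these blocks are \<open>N2\<close> and
    \<open>N2T\<close>.\<close>
  have v: "circulant [O2, I2, N2, N2T, I2] $$ (0, 2) = 1" "circulant [O2, I2, N2, N2T, I2] $$ (1, 2) = 0"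
    "circulant [O2, N2, N2T, N2, N2T] $$ (0, 2) = 0" "circulant [O2, N2, N2T, N2, N2T] $$ (1, 2) = 1"
    "circulant [O2, N2, N2T, N2, N2T] $$ (2, 0) = 0" "circulant [O2, N2, N2T, N2, N2T] $$ (3, 0) = 0"
    using N2_entries by (simp_all add: circulant_entry)
  have "M $$ (0, 2) = M $$ (1, 2)" if "rows_agree M" for M
    using that[unfolded rows_agree_def, rule_format, of 0 1 2] adj(1) by simp
  then show "\<not> rows_agree (circulant [O2, I2, N2, N2T, I2])" "\<not> rows_agree (circulant [O2, N2, N2T, N2, N2T])"
    using v(1-4) by fastforce+
  show "\<not> rows_complementary (circulant [O2, N2, N2T, N2, N2T])"
  proof
    assume "rows_complementary (circulant [O2, N2, N2T, N2, N2T])"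
    from this[unfolded rows_complementary_def, rule_format, of 2 3 0]
    have "circulant [O2, N2, N2T, N2, N2T] $$ (2, 0) + circulant [O2, N2, N2T, N2, N2T] $$ (3, 0) = 1"
      using adj(3) by simp
    then show False using v(5,6) by simp
  qed
qed

theorem theorem22:
  defines "C1 \<equiv> circulant [O2, O2, N2, N2T, O2]"
    and "C2 \<equiv> circulant [O2, I2, N2, N2T, I2]"
    and "C3 \<equiv> circulant [O2, N2, N2T, N2, N2T]"
  shows "card (irreducibles R10 // equiv_R10) = 3
    \<and> {C1, C2, C3} \<subseteq> irreducibles R10
    \<and> irreducibles R10 // equiv_R10 = {equiv_R10 `` {C1}, equiv_R10 `` {C2}, equiv_R10 `` {C3}}"
proof -
  have codes: "codes C1 \<in> set special_codes" "codes C2 \<in> set special_codes" "codes C3 \<in> set special_codes"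
    "set special_codes = {codes C1, codes C2, codes C3}"
    unfolding C1_def C2_def C3_def circulant_codes special_codes_def by simp_all
  have BB: "C1 \<in> BB R10" "C2 \<in> BB R10" "C3 \<in> BB R10"
    unfolding C1_def C2_def C3_def
    by (rule circulant_special; use codes in \<open>simp add: C1_def C2_def C3_def\<close>)+
  have irr: "C \<in> irreducibles R10" if "C \<in> {C1, C2, C3}" for C
  proof -
    have "C \<in> BB R10" "codes C \<in> set special_codes" using that BB codes by auto
    then show ?thesis unfolding irreducibles_def using special_irreducible[of C] BB_iff by blast
  qed
  have cls: "equiv_R10 `` {B} = equiv_R10 `` {C}" if "(B, C) \<in> equiv_R10" for B C
    using that unfolding equiv_R10_def by (auto intro: equivclp_trans equivclp_sym)
  have rep: "\<exists>C\<in>{C1, C2, C3}. (B, C) \<in> equiv_R10" if "B \<in> irreducibles R10" for B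
  proof -
    have B: "B \<in> BB R10" "\<not> reducible_wrt R10 B" using that by (simp_all add: irreducibles_def)
    then have "codes B \<in> {codes C1, codes C2, codes C3}" using special_or_reducible[OF B(1)] codes(4) by blast
    then show ?thesis using equivclp_same_codes[OF B(1)] B(1) BB unfolding equiv_R10_def by auto
  qed
  have ne: "equiv_R10 `` {C} \<noteq> equiv_R10 `` {C'}"
    if "C' \<in> BB R10" "rows_agree C \<noteq> rows_agree C' \<or> rows_complementary C \<noteq> rows_complementary C'" for C C'
  proof
    assume "equiv_R10 `` {C} = equiv_R10 `` {C'}"
    moreover have "C' \<in> equiv_R10 `` {C'}" using that(1) by (simp add: equiv_R10_def)
    ultimately have "C' \<in> equiv_R10 `` {C}" by (rule ssubst)
    then have "equivclp move C C'" by (simp add: equiv_R10_def)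
    then show False using equivclp_move_invariants[of C C'] that(2) by blast
  qed
  note inv = circulant_invariants[folded C1_def C2_def C3_def]
  \<comment> \<open>\<open>rows_agree\<close> separates the first class from the other two,
    \<open>rows_complementary\<close> separates those from each other.\<close>
  have n: "equiv_R10 `` {C1} \<noteq> equiv_R10 `` {C2}" "equiv_R10 `` {C1} \<noteq> equiv_R10 `` {C3}"
    "equiv_R10 `` {C2} \<noteq> equiv_R10 `` {C3}"
    using ne[of C2 C1] ne[of C3 C1] ne[of C3 C2] BB inv by blast+
  have q: "irreducibles R10 // equiv_R10 = {equiv_R10 `` {C1}, equiv_R10 `` {C2}, equiv_R10 `` {C3}}"
  proof
    show "irreducibles R10 // equiv_R10 \<subseteq> {equiv_R10 `` {C1}, equiv_R10 `` {C2}, equiv_R10 `` {C3}}"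
    proof
      fix K assume "K \<in> irreducibles R10 // equiv_R10"
      then obtain B where B: "B \<in> irreducibles R10" "K = equiv_R10 `` {B}" by (rule quotientE)
      obtain C where "C \<in> {C1, C2, C3}" "(B, C) \<in> equiv_R10" using rep[OF B(1)] by blast
      then show "K \<in> {equiv_R10 `` {C1}, equiv_R10 `` {C2}, equiv_R10 `` {C3}}"
        unfolding B(2) using cls[of B C] by blast
    qed
    show "{equiv_R10 `` {C1}, equiv_R10 `` {C2}, equiv_R10 `` {C3}} \<subseteq> irreducibles R10 // equiv_R10"
      using irr quotientI[of _ "irreducibles R10" equiv_R10] by blast
  qed
  have "card (irreducibles R10 // equiv_R10) = 3" unfolding q using n by simp
  then show ?thesis using q irr by blast
qed

end
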